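(* Let $d\in\mathbb{N}$ and $T\in(0,\infty)$. Let $I(t)=\partial\Omega(t)\subset\mathbb{R}^d$, $t\in[0,T]$, be a compact interface evolving smoothly by mean curvature, and let $\chi:\mathbb{R}^d\times[0,T]\to\{-1,1\}$ be given by $\chi(x,t)=1$ if $x\in\Omega(t)$ and $\chi(x,t)=-1$ if $x\notin\Omega(t)$. Let $W$ be a standard double-well potential and $\theta$ the corresponding one-dimensional equilibrium profile (both specified in the context). For $\varepsilon\in(0,1]$ let $u_\varepsilon$ be the (bounded) solution on $\mathbb{R}^d\times[0,T]$ of the Allen-Cahn equation $$\partial_t u_\varepsilon=\Delta u_\varepsilon-\frac{1}{\varepsilon^2}W'(u_\varepsilon)$$ with initial data $u_\varepsilon(x,0)=\theta\big(\varepsilon^{-1}\operatorname{dist}^{\pm}(x,I(0))\big)$, where $\operatorname{dist}^{\pm}(\cdot,I(0))$ is the signed distance function to $I(0)$, with $\operatorname{dist}^{\pm}(x,I(0))>0$ for $x\in\Omega(0)$. Define $\psi_\varepsilon(x,t):=\int_0^{u_\varepsilon(x,t)}\sqrt{2W(s)}\,\mathrm{d}s$. Then there is a constant $C$, depending only on $d$, $T$, $(I(t))_{t\in[0,T]}$ and the fixed potential $W$ (and in particular not on $\varepsilon$), such that for all $\varepsilon\in(0,1]$ $$\sup_{t\in[0,T]}\|\psi_\varepsilon(\cdot,t)-\chi(\cdot,t)\|_{L^1(\mathbb{R}^d)}\le C\,\varepsilon .$$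
   Context: Smooth evolution by mean curvature: $I(t)=\partial\Omega(t)$, $t\in[0,T]$, is a smoothly evolving family of smooth compact embedded hypersurfaces in $\mathbb{R}^d$ whose normal velocity vector at each point equals the mean curvature vector $\mathrm{H}_I=-(\nabla\cdot \mathrm{n}_I)\mathrm{n}_I$, where $\mathrm{n}_I=\nabla\operatorname{dist}^{\pm}(\cdot,I)$ is the unit normal pointing into $\Omega(t)$. Equivalently, $\partial_t\operatorname{dist}^{\pm}(x,I(t))=-\mathrm{H}_I\cdot\mathrm{n}_I$ on $I(t)$. The signed distance $\operatorname{dist}^{\pm}(\cdot,I(t))$ is positive in $\Omega(t)$. Standard double-well potential: $W:\mathbb{R}\to[0,\infty)$ is twice continuously differentiable, symmetric around the origin ($W(-s)=W(s)$), satisfies $W(1)=W(-1)=0$ and $W(s)\ge c\min\{|s-1|^2,|s+1|^2\}$ for all $s$ and some $c>0$, and is normalized by $\int_{-1}^1\sqrt{2W(s)}\,\mathrm{d}s=2$. Equilibrium profile: $\theta:\mathbb{R}\to\mathbb{R}$ is the unique odd solution of $\theta'(s)=\sqrt{2W(\theta(s))}$ with $\theta(\pm\infty)=\pm1$. The solution $u_\varepsilon$ is the unique bounded solution (classical for $t>0$, continuous up to $t=0$); it takes values in $[-1,1]$. *)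

theory Defs
  imports "HOL-Analysis.Analysis"
begin

section \<open>Differential operators\<close>

definition gradient :: "(real^'n \<Rightarrow> real) \<Rightarrow> real^'n \<Rightarrow> real^'n"
  where "gradient f x = (THE D. GDERIV f x :> D)"

definition divergence :: "(real^'n \<Rightarrow> real^'n) \<Rightarrow> real^'n \<Rightarrow> real"
  where "divergence V x = trace (jacobian V (at x))"

definition laplacian :: "(real^'n \<Rightarrow> real) \<Rightarrow> real^'n \<Rightarrow> real"
  where "laplacian f x = divergence (gradient f) x"

text \<open>Only used for open \<open>S\<close>: all directional derivatives up to order \<open>k\<close> exist and are
  continuous on \<open>S\<close>.\<close>

fun higher_differentiable_on ::
  "'a::real_normed_vector set \<Rightarrow> ('a \<Rightarrow> 'b::real_normed_vector) \<Rightarrow> nat \<Rightarrow> bool"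
  where
    "higher_differentiable_on S f 0 \<longleftrightarrow> continuous_on S f"
  | "higher_differentiable_on S f (Suc k) \<longleftrightarrow>
       (\<forall>x\<in>S. f differentiable (at x)) \<and>
       (\<forall>v. higher_differentiable_on S (\<lambda>x. frechet_derivative f (at x) v) k)"

definition smooth_on ::
  "'a::real_normed_vector set \<Rightarrow> ('a \<Rightarrow> 'b::real_normed_vector) \<Rightarrow> bool"
  where "smooth_on S f \<longleftrightarrow> (\<forall>k. higher_differentiable_on S f k)"

section \<open>Smooth mean curvature flow of a compact interface\<close>

text \<open>The signed distance to \<open>frontier \<Omega>\<close>, positive inside \<open>\<Omega>\<close>. It is meaningful only for a
  nonempty frontier, since \<^term>\<open>infdist x {} = 0\<close>.\<close>

definition signed_dist :: "(real^'n) set \<Rightarrow> real^'n \<Rightarrow> real"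
  where "signed_dist \<Omega> x =
    (if x \<in> \<Omega> then infdist x (frontier \<Omega>) else - infdist x (frontier \<Omega>))"

definition unit_normal :: "(real^'n) set \<Rightarrow> real^'n \<Rightarrow> real^'n"
  where "unit_normal \<Omega> x = gradient (signed_dist \<Omega>) x"

definition mean_curvature :: "(real^'n) set \<Rightarrow> real^'n \<Rightarrow> real^'n"
  where "mean_curvature \<Omega> x = - (divergence (unit_normal \<Omega>) x *\<^sub>R unit_normal \<Omega> x)"

text \<open>The frontiers form a smooth family of compact embedded hypersurfaces: around each of its
  points the space-time track is the zero set of a smooth function with nonvanishing spatial
  gradient, positive exactly on \<open>\<Omega>\<close>. The neighbourhood \<open>N\<close> is open in all of space-time, so that
  smoothness holds up to the times \<open>0\<close> and \<open>T\<close>. Compactness of the whole track, and not just of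
  each time slice, excludes that components appear, vanish or escape to infinity.\<close>

definition smoothly_evolving_domain :: "real \<Rightarrow> (real \<Rightarrow> (real^'n) set) \<Rightarrow> bool"
  where "smoothly_evolving_domain T \<Omega> \<longleftrightarrow>
    (\<forall>t\<in>{0..T}. open (\<Omega> t) \<and> frontier (\<Omega> t) \<noteq> {}) \<and>
    compact {(x, t). t \<in> {0..T} \<and> x \<in> frontier (\<Omega> t)} \<and>
    (\<forall>t\<^sub>0\<in>{0..T}. \<forall>x\<^sub>0\<in>frontier (\<Omega> t\<^sub>0).
       \<exists>N (\<phi> :: (real^'n) \<times> real \<Rightarrow> real).
         open N \<and> (x\<^sub>0, t\<^sub>0) \<in> N \<and> smooth_on N \<phi> \<and>
         (\<forall>(x, t)\<in>N. gradient (\<lambda>y. \<phi> (y, t)) x \<noteq> 0) \<and>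
         (\<forall>(x, t)\<in>N. t \<in> {0..T} \<longrightarrow>
            (x \<in> \<Omega> t \<longleftrightarrow> \<phi> (x, t) > 0) \<and>
            (x \<in> frontier (\<Omega> t) \<longleftrightarrow> \<phi> (x, t) = 0)))"

text \<open>The normal speed in the direction of \<^const>\<open>unit_normal\<close> is minus the time derivative of the
  signed distance.\<close>

definition smooth_mean_curvature_flow :: "real \<Rightarrow> (real \<Rightarrow> (real^'n) set) \<Rightarrow> bool"
  where "smooth_mean_curvature_flow T \<Omega> \<longleftrightarrow>
    smoothly_evolving_domain T \<Omega> \<and>
    (\<forall>t\<in>{0..T}. \<forall>x\<in>frontier (\<Omega> t).
       ((\<lambda>\<tau>. signed_dist (\<Omega> \<tau>) x) has_real_derivative
          - (mean_curvature (\<Omega> t) x \<bullet> unit_normal (\<Omega> t) x)) (at t within {0..T}))"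

definition phase :: "(real \<Rightarrow> (real^'n) set) \<Rightarrow> real^'n \<Rightarrow> real \<Rightarrow> real"
  where "phase \<Omega> x t = (if x \<in> \<Omega> t then 1 else - 1)"

section \<open>Potential and equilibrium profile\<close>

definition standard_double_well :: "(real \<Rightarrow> real) \<Rightarrow> bool"
  where "standard_double_well W \<longleftrightarrow>
    W differentiable_on UNIV \<and> deriv W differentiable_on UNIV \<and>
    continuous_on UNIV (deriv (deriv W)) \<and>
    (\<forall>s. W s \<ge> 0) \<and> (\<forall>s. W (- s) = W s) \<and> W 1 = 0 \<and> W (- 1) = 0 \<and>
    (\<exists>c>0. \<forall>s. W s \<ge> c * min (\<bar>s - 1\<bar>\<^sup>2) (\<bar>s + 1\<bar>\<^sup>2)) \<and>
    (LBINT s=-1..1. sqrt (2 * W s)) = 2"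

definition equilibrium_profile :: "(real \<Rightarrow> real) \<Rightarrow> (real \<Rightarrow> real) \<Rightarrow> bool"
  where "equilibrium_profile W \<theta> \<longleftrightarrow>
    (\<forall>s. \<theta> (- s) = - \<theta> s) \<and>
    (\<forall>s. (\<theta> has_real_derivative sqrt (2 * W (\<theta> s))) (at s)) \<and>
    (\<theta> \<longlongrightarrow> 1) at_top \<and> (\<theta> \<longlongrightarrow> - 1) at_bot"

section \<open>Solutions of the Allen-Cahn equation\<close>

text \<open>Bounded, continuous on \<open>[0,T]\<close> and classical (continuously differentiable once in time and
  twice in space) on \<open>(0,T]\<close>, with a one-sided time derivative at \<open>T\<close>. Continuity of the time
  derivative follows from the equation and continuity of the second spatial derivatives.\<close>

definition allen_cahn_solution ::
  "(real \<Rightarrow> real) \<Rightarrow> real \<Rightarrow> real \<Rightarrow> (real^'n \<Rightarrow> real) \<Rightarrow> (real^'n \<Rightarrow> real \<Rightarrow> real) \<Rightarrow> bool"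
  where "allen_cahn_solution W \<epsilon> T u\<^sub>0 u \<longleftrightarrow>
    bounded ((\<lambda>(x, t). u x t) ` (UNIV \<times> {0..T})) \<and>
    continuous_on (UNIV \<times> {0..T}) (\<lambda>(x, t). u x t) \<and>
    (\<forall>x. u x 0 = u\<^sub>0 x) \<and>
    (\<forall>t\<in>{0<..T}. (\<lambda>x. u x t) differentiable_on UNIV \<and>
                  gradient (\<lambda>x. u x t) differentiable_on UNIV) \<and>
    continuous_on (UNIV \<times> {0<..T}) (\<lambda>(x, t). gradient (\<lambda>y. u y t) x) \<and>
    continuous_on (UNIV \<times> {0<..T}) (\<lambda>(x, t). jacobian (gradient (\<lambda>y. u y t)) (at x)) \<and>
    (\<forall>x. \<forall>t\<in>{0<..T}.
       ((\<lambda>s. u x s) has_real_derivative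
          laplacian (\<lambda>y. u y t) x - 1 / \<epsilon>\<^sup>2 * deriv W (u x t)) (at t within {0..T}))"

definition psi :: "(real \<Rightarrow> real) \<Rightarrow> (real^'n \<Rightarrow> real \<Rightarrow> real) \<Rightarrow> real^'n \<Rightarrow> real \<Rightarrow> real"
  where "psi W u x t = (LBINT s=0..u x t. sqrt (2 * W s))"

text \<open>The norm is a Lebesgue integral with values in \<open>[0,\<infinity>]\<close>, so a finite bound on it also
  asserts integrability (of a measurable function).\<close>

definition L1_norm :: "(real^'n \<Rightarrow> real) \<Rightarrow> ennreal"
  where "L1_norm f = (\<integral>\<^sup>+ x. ennreal \<bar>f x\<bar> \<partial>lborel)"

end

theory Submission
  imports Defs
begin

text \<open>No integration by parts is needed: the estimate follows from the comparison principle.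
  The signed distance \<open>d\<close> is a C2 function in a tube around the interface, and there
  \<open>\<bar>\<partial>\<^sub>t d - \<Delta> d\<bar> \<le> K \<bar>d\<bar>\<close>: both sides are functions of the foot point up to an error \<open>O(d)\<close>, and they agree on
  the interface by the flow equation. Hence \<open>\<theta> ((d + \<epsilon> exp (B t)) / \<epsilon>) + \<epsilon>\<^sup>2 q\<close> is a supersolution in the tube,
  and it is matched to the barrier \<open>- 1 + O(\<epsilon>\<^sup>2)\<close>, decaying at infinity, outside. So at distance \<open>s\<close> outside
  the interface \<open>u + 1\<close> is at most \<open>C (exp (- \<kappa> s / \<epsilon>) + \<epsilon>\<^sup>2)\<close>. By the symmetry \<open>u \<mapsto> - u\<close> the same holds for
  \<open>1 - u\<close> inside, and integrating over the layers \<open>{\<bar>d\<bar> \<le> k \<epsilon>}\<close>, of volume \<open>O(k \<epsilon>)\<close>, gives the bound.\<close>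

section \<open>The double well and its profile\<close>

text \<open>Why the barrier has this form: with p = \<epsilon> exp (B t) and d = \<epsilon> z - p,
  the geometric error K |d| \<theta>' / \<epsilon> splits into K \<theta>' |z|, which is bounded
  because \<theta>' decays exponentially, and K \<theta>' p / \<epsilon>, which the time derivative
  B \<theta>' p / \<epsilon> of the shift absorbs. A bounded error is affordable, since a correction
  of size \<epsilon>^2 changes the reaction by order one, with the right sign where W'' > 0. Between
  the wells the sign may be wrong, but there \<theta>' is bounded below and a large B pays. The
  corrected profile is C2 only in a tube, and a constant excess \<epsilon>^2 is not integrable over
  the whole space; both obstacles lead to a minimum with a second barrier. This works for small
  \<epsilon> only; for \<epsilon> bounded away from 0 a crude exponential bound gives a finite L1
  norm, which is then trivially O(\<epsilon>). The tube is built from an arbitrary choice of nearest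
  points: they satisfy an implicit equation that first makes them Lipschitz and then makes the
  transported normal differentiable.\<close>

lemma double_well_deriv:
  assumes "standard_double_well W"
  shows "(W has_real_derivative deriv W s) (at s)"
    and "(deriv W has_real_derivative deriv (deriv W) s) (at s)"
  using assms
  by (auto simp: standard_double_well_def differentiable_on_def
      DERIV_deriv_iff_real_differentiable)

lemma double_well_deriv_odd:
  assumes "standard_double_well W"
  shows "deriv W (- s) = - deriv W s"
proof -
  have "((\<lambda>s. W (- s)) has_real_derivative deriv W (- s) * (-1)) (at s)"
    by (rule DERIV_chain2[OF double_well_deriv(1)[OF assms]]) (auto intro!: derivative_eq_intros)
  moreover have "(\<lambda>s. W (- s)) = W"
    using assms by (auto simp: standard_double_well_def)
  ultimately show ?thesis
    using DERIV_unique[OF double_well_deriv(1)[OF assms, of s]] by fastforce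
qed

lemma double_well_deriv_one:
  assumes "standard_double_well W"
  shows "deriv W 1 = 0" "deriv W (- 1) = 0"
proof -
  show *: "deriv W 1 = 0"
    using assms by (intro DERIV_local_min[OF double_well_deriv(1)[OF assms], of 1])
      (auto simp: standard_double_well_def)
  show "deriv W (- 1) = 0"
    using double_well_deriv_odd[OF assms, of 1] * by simp
qed

lemma double_well_deriv_lipschitz:
  assumes "standard_double_well W"
  obtains L where "L \<ge> 0"
    "\<And>a b. a \<in> {-M..M} \<Longrightarrow> b \<in> {-M..M} \<Longrightarrow> \<bar>deriv W a - deriv W b\<bar> \<le> L * \<bar>a - b\<bar>"
proof -
  have "continuous_on {-M..M} (deriv (deriv W))"
    using assms continuous_on_subset by (force simp: standard_double_well_def)
  then have "bounded (deriv (deriv W) ` {-M..M})"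
    by (simp add: compact_continuous_image compact_imp_bounded)
  then obtain L where L: "L > 0" "\<And>s. s \<in> {-M..M} \<Longrightarrow> \<bar>deriv (deriv W) s\<bar> \<le> L"
    by (auto simp: bounded_pos)
  have "\<bar>deriv W a - deriv W b\<bar> \<le> L * \<bar>a - b\<bar>" if "a \<in> {-M..M}" "b \<in> {-M..M}" for a b
    using field_differentiable_bound[of "{-M..M}" "deriv W" "deriv (deriv W)" L b a,
        OF _ has_field_derivative_at_within[OF double_well_deriv(2)[OF assms]]] L that
    by (auto simp: abs_minus_commute)
  then show thesis
    using L(1) by (intro that[of L]) auto
qed

text \<open>The quadratic lower bound of the well forces W''(1) \<ge> c: otherwise two mean value
  steps give W(s) < c (s - 1)^2 just to the right of 1. Continuity keeps W'' > c / 2 nearby. The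
  window is doubled so that both \<open>a\<close> and \<open>a - q\<close> fit into it when
  \<open>a \<ge> 1 - \<eta>\<close> and \<open>q \<le> \<eta>\<close>.\<close>

lemma double_well_convex_near_one:
  assumes W: "standard_double_well W"
  obtains c \<eta> where "c > 0" "0 < \<eta>" "\<eta> \<le> 1/4"
    "\<And>a b. 1 - 2 * \<eta> \<le> a \<Longrightarrow> a \<le> b \<Longrightarrow> b \<le> 1 + 2 * \<eta> \<Longrightarrow> deriv W b - deriv W a \<ge> c * (b - a)"
proof -
  obtain c where c: "c > 0" "\<And>s. W s \<ge> c * min (\<bar>s - 1\<bar>\<^sup>2) (\<bar>s + 1\<bar>\<^sup>2)"
    using W by (auto simp: standard_double_well_def)
  have W1: "W 1 = 0" using W by (auto simp: standard_double_well_def)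
  have cont: "isCont (deriv (deriv W)) 1"
    using W by (auto simp: standard_double_well_def continuous_on_eq_continuous_at)
  have ge: "deriv (deriv W) 1 \<ge> c"
  proof (rule ccontr)
    assume "\<not> ?thesis"
    then have "eventually (\<lambda>s. deriv (deriv W) s < c) (nhds 1)"
      using cont order_tendstoD(2)[of "deriv (deriv W)" _ "nhds 1" c]
      by (auto simp: isCont_def tendsto_at_iff_tendsto_nhds)
    then obtain r where r: "r > 0" "\<And>s. \<bar>s - 1\<bar> < r \<Longrightarrow> deriv (deriv W) s < c"
      by (auto simp: eventually_nhds_metric dist_real_def)
    define s where "s = 1 + min r 1 / 2"
    have s: "1 < s" "s < 1 + r" "s \<le> 2" using r(1) by (auto simp: s_def min_def)
    obtain y where y: "1 < y" "y < s" "W s - W 1 = (s - 1) * deriv W y"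
      using MVT2[of 1 s W "deriv W"] s double_well_deriv(1)[OF W] by auto
    obtain z where z: "1 < z" "z < y" "deriv W y - deriv W 1 = (y - 1) * deriv (deriv W) z"
      using MVT2[of 1 y "deriv W" "deriv (deriv W)"] y double_well_deriv(2)[OF W] by auto
    have zc: "deriv (deriv W) z < c" using r z y s by auto
    have dy: "deriv W y < (y - 1) * c"
      using z zc y double_well_deriv_one(1)[OF W] by simp
    have "(y - 1) * c \<le> (s - 1) * c" using y c by simp
    then have "W s < (s - 1) * ((s - 1) * c)"
      using y dy s W1 mult_strict_left_mono[of "deriv W y" "(s - 1) * c" "s - 1"] by auto
    moreover have "W s \<ge> c * (s - 1)^2"
    proof -
      have "\<bar>s - 1\<bar>\<^sup>2 \<le> \<bar>s + 1\<bar>\<^sup>2" using s by (intro power_mono) auto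
      then show ?thesis using c(2)[of s] by (simp add: min_def)
    qed
    ultimately show False by (simp add: power2_eq_square algebra_simps)
  qed
  have "eventually (\<lambda>s. deriv (deriv W) s > c / 2) (nhds 1)"
    using cont order_tendstoD(1)[of "deriv (deriv W)" _ "nhds 1" "c/2"] ge c
    by (auto simp: isCont_def tendsto_at_iff_tendsto_nhds)
  then obtain r where r: "r > 0" "\<And>s. \<bar>s - 1\<bar> < r \<Longrightarrow> deriv (deriv W) s > c / 2"
    by (auto simp: eventually_nhds_metric dist_real_def)
  define \<eta> where "\<eta> = min (r / 4) (1/4)"
  show thesis
  proof (rule that[of "c / 2" \<eta>])
    show "c / 2 > 0" "0 < \<eta>" "\<eta> \<le> 1/4" using c r by (auto simp: \<eta>_def)
    fix a b assume ab: "1 - 2 * \<eta> \<le> a" "a \<le> b" "b \<le> 1 + 2 * \<eta>"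
    show "c / 2 * (b - a) \<le> deriv W b - deriv W a"
    proof (cases "a = b")
      case False
      then obtain z where z: "a < z" "z < b" "deriv W b - deriv W a = (b - a) * deriv (deriv W) z"
        using MVT2[of a b "deriv W" "deriv (deriv W)"] ab double_well_deriv(2)[OF W] by auto
      have "4 * \<eta> \<le> r" by (simp add: \<eta>_def)
      then have "deriv (deriv W) z > c / 2" using z ab r by (intro r) auto
      then show ?thesis using z by (simp add: mult.commute mult_left_mono)
    qed auto
  qed
qed

text \<open>Barriers lie above the profile, so only increments q \<ge> 0 occur. Near -1 the step
  from \<open>a\<close> to \<open>a + q\<close> is reflected to the step from \<open>- a - q\<close>
  to \<open>- a\<close> by oddness of W'.\<close>

lemma double_well_convex_near_wells:
  assumes W: "standard_double_well W"
  obtains c \<eta> where "c > 0" "0 < \<eta>" "\<eta> \<le> 1/4"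
    "\<And>a q. \<bar>a\<bar> \<le> 1 \<Longrightarrow> 1 - \<eta> \<le> \<bar>a\<bar> \<Longrightarrow> 0 \<le> q \<Longrightarrow> q \<le> \<eta> \<Longrightarrow> deriv W (a + q) - deriv W a \<ge> c * q"
proof -
  obtain c \<eta> where c: "c > 0" "0 < \<eta>" "\<eta> \<le> 1/4"
    "\<And>a b. 1 - 2 * \<eta> \<le> a \<Longrightarrow> a \<le> b \<Longrightarrow> b \<le> 1 + 2 * \<eta> \<Longrightarrow> deriv W b - deriv W a \<ge> c * (b - a)"
    using double_well_convex_near_one[OF W] by blast
  show thesis
  proof (rule that[of c \<eta>, OF c(1-3)])
    fix a q :: real assume *: "\<bar>a\<bar> \<le> 1" "1 - \<eta> \<le> \<bar>a\<bar>" "0 \<le> q" "q \<le> \<eta>"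
    show "deriv W (a + q) - deriv W a \<ge> c * q"
    proof (cases "a \<ge> 0")
      case True
      then show ?thesis using c(4)[of a "a + q"] * c by auto
    next
      case False
      have "deriv W (- a) - deriv W (- a - q) \<ge> c * q" using c(4)[of "- a - q" "- a"] * c False by auto
      then show ?thesis
        using double_well_deriv_odd[OF W, of a] double_well_deriv_odd[OF W, of "a + q"]
        by (simp add: algebra_simps)
    qed
  qed
qed

text \<open>Makes the profile equation comparable to a linear equation for the distance to the
  nearer well. The lower bound is the well condition; the upper one follows from W(1) = W'(1) = 0
  and the Lipschitz bound for W'.\<close>

lemma sqrt_double_well_bounds:
  assumes W: "standard_double_well W"
  obtains \<kappa> M where "\<kappa> > 0" "M > 0"
    "\<And>a. \<bar>a\<bar> \<le> 1 \<Longrightarrow> \<kappa> * (1 - \<bar>a\<bar>) \<le> sqrt (2 * W a)"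
    "\<And>a. \<bar>a\<bar> \<le> 1 \<Longrightarrow> sqrt (2 * W a) \<le> M * (1 - \<bar>a\<bar>)"
proof -
  obtain c where c: "c > 0" "\<And>s. W s \<ge> c * min (\<bar>s - 1\<bar>\<^sup>2) (\<bar>s + 1\<bar>\<^sup>2)"
    using W by (auto simp: standard_double_well_def)
  obtain L where L: "L \<ge> 0"
    "\<And>a b. a \<in> {-1..1} \<Longrightarrow> b \<in> {-1..1} \<Longrightarrow> \<bar>deriv W a - deriv W b\<bar> \<le> L * \<bar>a - b\<bar>"
    using double_well_deriv_lipschitz[OF W] by blast
  have even: "W \<bar>a\<bar> = W a" for a using W by (auto simp: standard_double_well_def abs_if)
  have W1: "W 1 = 0" using W by (auto simp: standard_double_well_def)
  have lower: "sqrt (2 * c) * (1 - \<bar>a\<bar>) \<le> sqrt (2 * W a)" if "\<bar>a\<bar> \<le> 1" for a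
  proof -
    have "(1 - \<bar>a\<bar>)\<^sup>2 \<le> (\<bar>a\<bar> + 1)\<^sup>2" using that by (intro power_mono) auto
    then have "c * (1 - \<bar>a\<bar>)\<^sup>2 \<le> W \<bar>a\<bar>"
      using c(2)[of "\<bar>a\<bar>"] that by (simp add: min_def power2_commute)
    then have "sqrt (2 * c * (1 - \<bar>a\<bar>)\<^sup>2) \<le> sqrt (2 * W a)" by (simp add: even)
    then show ?thesis using that by (simp add: real_sqrt_mult)
  qed
  have upper: "sqrt (2 * W a) \<le> sqrt (2 * (L + 1)) * (1 - \<bar>a\<bar>)" if a1: "\<bar>a\<bar> \<le> 1" for a
  proof -
    have "W \<bar>a\<bar> \<le> (L + 1) * (1 - \<bar>a\<bar>)\<^sup>2"
    proof (cases "\<bar>a\<bar> = 1")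
      case False
      then obtain z where z: "\<bar>a\<bar> < z" "z < 1" "W 1 - W \<bar>a\<bar> = (1 - \<bar>a\<bar>) * deriv W z"
        using MVT2[of "\<bar>a\<bar>" 1 W "deriv W", OF _ double_well_deriv(1)[OF W]] a1 by fastforce
      have "\<bar>deriv W z\<bar> \<le> L * (1 - z)"
        using L(2)[of z 1] z double_well_deriv_one[OF W] that by auto
      also have "\<dots> \<le> (L + 1) * (1 - \<bar>a\<bar>)" using z L by (intro mult_mono) auto
      finally have "- deriv W z \<le> (L + 1) * (1 - \<bar>a\<bar>)" by auto
      then have "(1 - \<bar>a\<bar>) * (- deriv W z) \<le> (1 - \<bar>a\<bar>) * ((L + 1) * (1 - \<bar>a\<bar>))"
        using that by (intro mult_left_mono) auto
      then show ?thesis using z W1 by (simp add: power2_eq_square algebra_simps)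
    qed (use W1 in auto)
    then have "sqrt (2 * W a) \<le> sqrt (2 * (L + 1) * (1 - \<bar>a\<bar>)\<^sup>2)"
      by (simp only: even real_sqrt_le_iff)
    then show ?thesis using a1 by (simp add: real_sqrt_mult)
  qed
  show thesis
    by (rule that[of "sqrt (2 * c)" "sqrt (2 * (L + 1))"]) (use lower upper c L in auto)
qed

text \<open>The strict bound |\<theta>| < 1 makes the square root differentiable along the profile;
  the last claim is then the second-order equation \<theta>'' = W'(\<theta>), obtained by
  differentiating the first-order one.\<close>

lemma equilibrium_profile_bounds:
  assumes W: "standard_double_well W" and \<theta>: "equilibrium_profile W \<theta>"
  shows "mono \<theta>" "\<bar>\<theta> z\<bar> < 1" "\<theta> (- z) = - \<theta> z"
    and "(\<theta> has_real_derivative sqrt (2 * W (\<theta> z))) (at z)"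
    and "((\<lambda>z. sqrt (2 * W (\<theta> z))) has_real_derivative deriv W (\<theta> z)) (at z)"
proof -
  have d: "(\<theta> has_real_derivative sqrt (2 * W (\<theta> s))) (at s)" for s
    using \<theta> by (auto simp: equilibrium_profile_def)
  show "(\<theta> has_real_derivative sqrt (2 * W (\<theta> z))) (at z)" by fact
  have odd: "\<theta> (- s) = - \<theta> s" for s using \<theta> by (auto simp: equilibrium_profile_def)
  show "\<theta> (- z) = - \<theta> z" by fact
  have Wpos: "W s \<ge> 0" for s using W by (auto simp: standard_double_well_def)
  show mono: "mono \<theta>"
  proof (rule monoI)
    show "\<theta> x \<le> \<theta> y" if "x \<le> y" for x y
      by (rule DERIV_nonneg_imp_nondecreasing[OF that]) (use d Wpos in \<open>meson mult_nonneg_nonneg real_sqrt_ge_zero zero_le_numeral\<close>)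
  qed
  have le1: "\<theta> s \<le> 1" for s
  proof (rule tendsto_lowerbound)
    show "(\<theta> \<longlongrightarrow> 1) at_top" using \<theta> by (auto simp: equilibrium_profile_def)
    show "\<forall>\<^sub>F x in at_top. \<theta> s \<le> \<theta> x"
      using eventually_ge_at_top[of s] by eventually_elim (use mono in \<open>auto dest: monoD\<close>)
  qed auto
  have th0: "\<theta> 0 = 0" using odd[of 0] by simp
  obtain \<kappa> M where \<kappa>: "\<kappa> > 0" and M: "M > 0"
    and lo: "\<And>a. \<bar>a\<bar> \<le> 1 \<Longrightarrow> \<kappa> * (1 - \<bar>a\<bar>) \<le> sqrt (2 * W a)"
    and up: "\<And>a. \<bar>a\<bar> \<le> 1 \<Longrightarrow> sqrt (2 * W a) \<le> M * (1 - \<bar>a\<bar>)"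
    using sqrt_double_well_bounds[OF W] by metis
  \<comment> \<open>Gronwall: \<open>(1 - \<theta> s) * exp (M * s)\<close> cannot decrease, so it
    stays at least at its value 1 at the origin and the well is never reached.\<close>
  have pos: "\<theta> s < 1" if "s \<ge> 0" for s
  proof -
    have "(1 - \<theta> 0) * exp (M * 0) \<le> (1 - \<theta> s) * exp (M * s)"
    proof (rule DERIV_nonneg_imp_nondecreasing[OF that])
      fix x assume x: "0 \<le> x" "x \<le> s"
      have "0 \<le> \<theta> x" using monoD[OF mono x(1)] th0 by simp
      then have "sqrt (2 * W (\<theta> x)) \<le> M * (1 - \<theta> x)" using up[of "\<theta> x"] le1[of x] by auto
      then have "0 \<le> (M * (1 - \<theta> x) - sqrt (2 * W (\<theta> x))) * exp (M * x)" by simp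
      moreover have "((\<lambda>x. (1 - \<theta> x) * exp (M * x)) has_real_derivative
          (M * (1 - \<theta> x) - sqrt (2 * W (\<theta> x))) * exp (M * x)) (at x)"
        by (auto intro!: derivative_eq_intros d simp: algebra_simps)
      ultimately show "\<exists>y. ((\<lambda>x. (1 - \<theta> x) * exp (M * x)) has_real_derivative y) (at x) \<and> 0 \<le> y"
        by blast
    qed
    then have "0 < (1 - \<theta> s) * exp (M * s)" using th0 by simp
    then show ?thesis by (simp add: zero_less_mult_iff)
  qed
  have lt1: "\<bar>\<theta> s\<bar> < 1" for s
  proof -
    have "\<theta> \<bar>s\<bar> < 1" by (rule pos) auto
    moreover have "\<theta> (- \<bar>s\<bar>) \<le> \<theta> s" "\<theta> s \<le> \<theta> \<bar>s\<bar>" by (auto intro!: monoD[OF mono])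
    ultimately show ?thesis using odd by (auto simp: abs_less_iff)
  qed
  show "\<bar>\<theta> z\<bar> < 1" by fact
  have "0 < \<kappa> * (1 - \<bar>\<theta> z\<bar>)" using \<kappa> lt1[of z] by simp
  then have sp: "0 < sqrt (2 * W (\<theta> z))" using lo[of "\<theta> z"] lt1[of z] by linarith
  have "((\<lambda>z. 2 * W (\<theta> z)) has_real_derivative 2 * (deriv W (\<theta> z) * sqrt (2 * W (\<theta> z)))) (at z)"
    by (intro DERIV_cmult DERIV_chain2[OF double_well_deriv(1)[OF W] d])
  from DERIV_chain2[OF DERIV_real_sqrt this] sp
  have "((\<lambda>z. sqrt (2 * W (\<theta> z))) has_real_derivative
      inverse (sqrt (2 * W (\<theta> z))) / 2 * (2 * (deriv W (\<theta> z) * sqrt (2 * W (\<theta> z))))) (at z)"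
    by simp
  moreover have "inverse (sqrt (2 * W (\<theta> z))) / 2 * (2 * (deriv W (\<theta> z) * sqrt (2 * W (\<theta> z)))) = deriv W (\<theta> z)"
    using sp by (simp add: divide_simps)
  ultimately show "((\<lambda>z. sqrt (2 * W (\<theta> z))) has_real_derivative deriv W (\<theta> z)) (at z)" by metis
qed

text \<open>On the positive axis \<open>(1 - \<theta> s) * exp (\<kappa> * s)\<close> cannot
  increase. The factor 2 extends the bound to negative arguments, where 1 - \<theta> < 2 and the
  exponential is at least 1.\<close>

lemma equilibrium_profile_decay:
  assumes W: "standard_double_well W" and \<theta>: "equilibrium_profile W \<theta>"
  obtains \<kappa> where "\<kappa> > 0" "\<And>z. 1 - \<theta> z \<le> 2 * exp (- \<kappa> * z)" "\<And>z. \<theta> z + 1 \<le> 2 * exp (\<kappa> * z)"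
proof -
  note th = equilibrium_profile_bounds[OF W \<theta>]
  obtain \<kappa> M where \<kappa>: "\<kappa> > 0" and M: "M > 0"
    and lo: "\<And>a. \<bar>a\<bar> \<le> 1 \<Longrightarrow> \<kappa> * (1 - \<bar>a\<bar>) \<le> sqrt (2 * W a)"
    and up: "\<And>a. \<bar>a\<bar> \<le> 1 \<Longrightarrow> sqrt (2 * W a) \<le> M * (1 - \<bar>a\<bar>)"
    using sqrt_double_well_bounds[OF W] by metis
  have th0: "\<theta> 0 = 0" using th(3)[of 0] by simp
  have key: "1 - \<theta> s \<le> exp (- \<kappa> * s)" if "s \<ge> 0" for s
  proof -
    have "(1 - \<theta> 0) * exp (\<kappa> * 0) \<ge> (1 - \<theta> s) * exp (\<kappa> * s)"
    proof (rule DERIV_nonpos_imp_nonincreasing[OF that])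
      fix x assume x: "0 \<le> x" "x \<le> s"
      have "0 \<le> \<theta> x" using monoD[OF th(1) x(1)] th0 by simp
      then have "sqrt (2 * W (\<theta> x)) \<ge> \<kappa> * (1 - \<theta> x)" using lo[of "\<theta> x"] th(2)[of x] by auto
      then have "(\<kappa> * (1 - \<theta> x) - sqrt (2 * W (\<theta> x))) * exp (\<kappa> * x) \<le> 0"
        by (simp add: mult_le_0_iff)
      moreover have "((\<lambda>x. (1 - \<theta> x) * exp (\<kappa> * x)) has_real_derivative
          (\<kappa> * (1 - \<theta> x) - sqrt (2 * W (\<theta> x))) * exp (\<kappa> * x)) (at x)"
        by (auto intro!: derivative_eq_intros th(4) simp: algebra_simps)
      ultimately show "\<exists>y. ((\<lambda>x. (1 - \<theta> x) * exp (\<kappa> * x)) has_real_derivative y) (at x) \<and> y \<le> 0"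
        by blast
    qed
    then have "(1 - \<theta> s) * exp (\<kappa> * s) \<le> 1" using th0 by simp
    then show ?thesis by (simp add: exp_minus field_simps)
  qed
  then have key': "1 - \<theta> s \<le> 2 * exp (- \<kappa> * s)" for s
  proof (cases "s \<ge> 0")
    case False
    then have "1 \<le> exp (- \<kappa> * s)" using \<kappa> by (simp add: mult_nonneg_nonpos)
    then show ?thesis using th(2)[of s] unfolding abs_less_iff by linarith
  next
    case True
    have "0 \<le> exp (- \<kappa> * s)" by simp
    then show ?thesis using key[OF True] by linarith
  qed
  have "\<theta> z + 1 \<le> 2 * exp (\<kappa> * z)" for z
    using key'[of "- z"] th(3)[of z] by simp
  with key' show thesis
    by (intro that[of \<kappa>, OF \<kappa>]) auto
qed


text \<open>\<open>g\<close> sends the value of u to that of \<open>psi\<close>. Being odd with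
  \<open>g 1 - g (- 1) = 2\<close>, it fixes 1 and -1, so its Lipschitz bound reduces the error of
  \<open>psi\<close> to that of u on each side of the interface.\<close>

lemma double_well_primitive:
  assumes W: "standard_double_well W"
  defines "g \<equiv> \<lambda>v. LBINT s=0..ereal v. sqrt (2 * W s)"
  obtains S where "S \<ge> 1"
    "\<And>v. \<bar>v\<bar> \<le> 1 \<Longrightarrow> g (- v) = - g v"
    "\<And>v. \<bar>v\<bar> \<le> 1 \<Longrightarrow> \<bar>g v - 1\<bar> \<le> S * (1 - v)"
    "\<And>v. \<bar>v\<bar> \<le> 1 \<Longrightarrow> \<bar>g v + 1\<bar> \<le> S * (1 + v)"
proof -
  define h where "h = (\<lambda>s. sqrt (2 * W s))"
  have "W differentiable_on UNIV" using W by (simp add: standard_double_well_def)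
  then have conth: "continuous_on A h" for A
    unfolding h_def using differentiable_imp_continuous_on continuous_on_subset
    by (intro continuous_intros) blast
  have heven: "h (- s) = h s" for s using W by (simp add: h_def standard_double_well_def)
  have h0: "h s \<ge> 0" for s using W by (simp add: h_def standard_double_well_def)
  have g: "(g has_real_derivative h v) (at v within {-1..1})" if "\<bar>v\<bar> \<le> 1" for v
    unfolding g_def h_def[symmetric] has_real_derivative_iff_has_vector_derivative
    using that interval_integral_FTC2[of "-1" 0 1 h v] conth by (auto simp: zero_ereal_def)
  have "bounded (h ` {-1..1})"
    by (intro compact_imp_bounded compact_continuous_image conth) auto
  then obtain B where B: "B > 0" "\<And>s. s \<in> {-1..1} \<Longrightarrow> \<bar>h s\<bar> \<le> B"
    by (auto simp: bounded_pos)
  define S where "S = max 1 B"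
  have g0: "g 0 = 0" by (simp add: g_def zero_ereal_def)
  have lip: "\<bar>g a - g b\<bar> \<le> S * \<bar>a - b\<bar>" if "\<bar>a\<bar> \<le> 1" "\<bar>b\<bar> \<le> 1" for a b
  proof -
    have "norm (g a - g b) \<le> S * norm (a - b)"
      by (rule field_differentiable_bound[of "{-1..1}" g h])
        (use that g B(2) in \<open>force simp: S_def\<close>)+
    then show ?thesis by simp
  qed
  have odd: "g (- v) = - g v" if "\<bar>v\<bar> \<le> 1" for v
  proof -
    have gm: "((\<lambda>v. g (- v)) has_real_derivative - h v) (at v within {-1..1})" if "\<bar>v\<bar> \<le> 1" for v
    proof -
      have "(g has_real_derivative h (- v)) (at (- v) within uminus ` {-1..1})"
        using g[of "- v"] that by simp
      moreover have "(uminus has_real_derivative - 1) (at v within {-1..1})"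
        by (auto intro!: derivative_eq_intros)
      ultimately show ?thesis
        using DERIV_image_chain[of g _ uminus v "{-1..1}" "-1"] by (simp add: heven o_def)
    qed
    \<comment> \<open>Oddness by differentiation: the derivatives of the two summands cancel because
      the integrand is even.\<close>
    have "((\<lambda>v. g v + g (- v)) has_derivative (\<lambda>h. 0)) (at x within {-1..1})" if "x \<in> {-1..1}" for x
      using DERIV_add[OF g[of x] gm[of x]] that
      by (simp add: has_field_derivative_def abs_le_iff lambda_zero[symmetric])
    then have "g v + g (- v) = g 0 + g (- 0)"
      using that has_derivative_zero_unique[of "{-1..1}" "\<lambda>v. g v + g (- v)" v 0]
      by (simp add: abs_le_iff)
    then show ?thesis using g0 by simp
  qed
  have int: "(LBINT s=ereal (-1)..0. h s) + (LBINT s=0..ereal 1. h s) = (LBINT s=ereal (-1)..ereal 1. h s)"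
  proof (rule interval_integral_sum)
    have "interval_lebesgue_integrable lborel (ereal (-1)) (ereal 1) h"
      by (intro interval_integrable_continuous_on conth) auto
    then show "interval_lebesgue_integrable lborel (min (ereal (-1)) (min 0 (ereal 1)))
        (max (ereal (-1)) (max 0 (ereal 1))) h"
      by (simp add: min_def max_def zero_ereal_def)
  qed
  have "(LBINT s=ereal (-1)..0. h s) = - g (- 1)"
    unfolding g_def h_def[symmetric] by (subst interval_integral_endpoints_reverse) simp
  moreover have "(LBINT s=ereal (-1)..ereal 1. h s) = 2"
    using W by (simp add: standard_double_well_def h_def one_ereal_def)
  ultimately have "g 1 - g (- 1) = 2"
    using int by (simp add: g_def h_def)
  then have g1: "g 1 = 1" "g (- 1) = - 1" using odd[of 1] by auto
  show thesis
  proof (rule that[of S])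
    show "S \<ge> 1" by (simp add: S_def)
    show "g (- v) = - g v" if "\<bar>v\<bar> \<le> 1" for v using odd that .
    show "\<bar>g v - 1\<bar> \<le> S * (1 - v)" if "\<bar>v\<bar> \<le> 1" for v
      using lip[of v 1] that g1 by auto
    show "\<bar>g v + 1\<bar> \<le> S * (1 + v)" if "\<bar>v\<bar> \<le> 1" for v
      using lip[of v "- 1"] that g1 by (auto simp: add.commute)
  qed
qed

section \<open>Comparison principle\<close>

text \<open>The trace of a derivative that is kept as a function, so that Laplacians are computed
  without passing to matrices.\<close>

definition optrace :: "(real^'n \<Rightarrow> real^'n) \<Rightarrow> real"
  where "optrace A = (\<Sum>i\<in>UNIV. A (axis i 1) $ i)"

lemma trace_matrix_eq_optrace: "trace (matrix A) = optrace A"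
  by (simp add: trace_def matrix_def optrace_def)

lemma optrace_simps:
  shows optrace_add: "optrace (\<lambda>h. A h + B h) = optrace A + optrace B"
    and optrace_scaleR: "optrace (\<lambda>h. c *\<^sub>R A h) = c * optrace A"
    and optrace_ident: "optrace (\<lambda>h. h :: real^'n) = CARD('n)"
    and optrace_zero: "optrace (\<lambda>h. 0 :: real^'n) = 0"
  by (simp_all add: optrace_def sum.distrib sum_distrib_left)

lemma optrace_rank_one: "optrace (\<lambda>h. (c * (v \<bullet> h)) *\<^sub>R w) = c * (v \<bullet> w)"
  by (simp add: optrace_def inner_axis, simp add: inner_vec_def sum_distrib_left mult.assoc)

lemma abs_optrace_le:
  fixes A :: "real^'n \<Rightarrow> real^'n" and K :: real
  assumes "\<And>h. norm (A h) \<le> K * norm h"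
  shows "\<bar>optrace A\<bar> \<le> CARD('n) * K"
proof -
  have "\<bar>A (axis i 1) $ i\<bar> \<le> K" for i
    using component_le_norm_cart[of "A (axis i 1)" i] assms[of "axis i 1"] by simp
  then have "\<bar>optrace A\<bar> \<le> (\<Sum>i\<in>(UNIV :: 'n set). K)"
    unfolding optrace_def by (intro order_trans[OF sum_abs] sum_mono)
  then show ?thesis by simp
qed

text \<open>The gradient exists near the point, but has to be differentiable only at the point
  itself. This is enough for the second derivative test and is preserved by sums and by composition
  with a scalar function.\<close>

definition second_order_at ::
  "(real^'n \<Rightarrow> real) \<Rightarrow> real^'n \<Rightarrow> real^'n \<Rightarrow> (real^'n \<Rightarrow> real^'n) \<Rightarrow> bool"
  where "second_order_at w x g A \<longleftrightarrow>
    (\<exists>m. (\<forall>\<^sub>F y in nhds x. GDERIV w y :> m y) \<and> m x = g \<and> (m has_derivative A) (at x))"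

lemma second_order_at_const: "second_order_at (\<lambda>y. c) x 0 (\<lambda>h. 0)"
  unfolding second_order_at_def by (intro exI[of _ "\<lambda>y. 0"]) (auto simp: gderiv_def)

lemma second_order_at_add:
  assumes "second_order_at v x g A" "second_order_at w x k B"
  shows "second_order_at (\<lambda>y. v y + w y) x (g + k) (\<lambda>h. A h + B h)"
proof -
  obtain m n where
    "\<forall>\<^sub>F y in nhds x. GDERIV v y :> m y" "m x = g" "(m has_derivative A) (at x)"
    "\<forall>\<^sub>F y in nhds x. GDERIV w y :> n y" "n x = k" "(n has_derivative B) (at x)"
    using assms unfolding second_order_at_def by blast
  then show ?thesis
    unfolding second_order_at_def
    by (intro exI[of _ "\<lambda>y. m y + n y"])
      (auto intro: GDERIV_add has_derivative_add elim: eventually_elim2)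
qed

text \<open>The trace of the resulting Hessian is F'' |g|^2 + F' times the Laplacian of
  \<open>w\<close>. For a signed distance |g| = 1, and this is how the equation of the profile
  enters.\<close>

lemma second_order_at_compose:
  assumes w: "second_order_at w x g A"
    and F1: "\<forall>\<^sub>F s in nhds (w x). (F has_real_derivative F1 s) (at s)"
    and F2: "(F1 has_real_derivative F2) (at (w x))"
  shows "second_order_at (\<lambda>y. F (w y)) x (F1 (w x) *\<^sub>R g)
           (\<lambda>h. (F2 * (g \<bullet> h)) *\<^sub>R g + F1 (w x) *\<^sub>R A h)"
proof -
  obtain m where m: "\<forall>\<^sub>F y in nhds x. GDERIV w y :> m y" "m x = g" "(m has_derivative A) (at x)"
    using w unfolding second_order_at_def by blast
  have wx: "GDERIV w x :> g" using eventually_nhds_x_imp_x[OF m(1)] m(2) by simp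
  then have "(w has_derivative (\<lambda>h. g \<bullet> h)) (at x)"
    by (simp add: gderiv_def inner_commute)
  then have "isCont w x" by (rule has_derivative_continuous)
  then have "(w \<longlongrightarrow> w x) (nhds x)" by (simp add: isCont_def tendsto_at_iff_tendsto_nhds)
  from eventually_compose_filterlim[OF F1 this]
  have "\<forall>\<^sub>F y in nhds x. (F has_real_derivative F1 (w y)) (at (w y))" .
  with m(1) have grad: "\<forall>\<^sub>F y in nhds x. GDERIV (\<lambda>y. F (w y)) y :> F1 (w y) *\<^sub>R m y"
    by eventually_elim (use GDERIV_DERIV_compose in blast)
  have F1w: "((\<lambda>y. F1 (w y)) has_derivative (\<lambda>h. F2 * (g \<bullet> h))) (at x)"
    using has_derivative_compose[OF \<open>(w has_derivative (\<lambda>h. g \<bullet> h)) (at x)\<close>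
        F2[unfolded has_field_derivative_def]] by simp
  have "((\<lambda>y. F1 (w y) *\<^sub>R m y) has_derivative
      (\<lambda>h. F1 (w x) *\<^sub>R A h + (F2 * (g \<bullet> h)) *\<^sub>R m x)) (at x)"
    by (rule has_derivative_scaleR[OF F1w m(3)])
  then show ?thesis
    unfolding second_order_at_def using grad m(2)
    by (intro exI[of _ "\<lambda>y. F1 (w y) *\<^sub>R m y"]) (auto simp: add.commute)
qed

lemma second_order_at_cmult:
  assumes "second_order_at w x g A"
  shows "second_order_at (\<lambda>y. c * w y) x (c *\<^sub>R g) (\<lambda>h. c *\<^sub>R A h)"
  using second_order_at_compose[OF assms, of "\<lambda>s. c * s" "\<lambda>s. c" 0]
  by (auto intro!: derivative_eq_intros)

lemma second_order_at_norm_sq: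
  fixes x :: "real^'n"
  shows "second_order_at (\<lambda>y. y \<bullet> y) x (2 *\<^sub>R x) (\<lambda>h. 2 *\<^sub>R h)"
proof -
  have "GDERIV (\<lambda>y. y \<bullet> y) y :> 2 *\<^sub>R y" for y :: "real^'n"
    unfolding gderiv_def
    by (auto intro!: derivative_eq_intros simp: inner_commute algebra_simps)
  then show ?thesis
    unfolding second_order_at_def
    by (intro exI[of _ "\<lambda>y. 2 *\<^sub>R y"]) (auto intro!: derivative_eq_intros)
qed

text \<open>A negative value of A v \<bullet> v would make the derivative along \<open>v\<close>
  negative just after the point, so \<open>w\<close> would drop below its minimum. Only the diagonal
  entries of A are needed for the trace.\<close>

lemma second_order_at_local_min:
  assumes w: "second_order_at w x g A" and min: "\<forall>\<^sub>F y in nhds x. w x \<le> w y"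
  shows "optrace A \<ge> 0"
proof -
  obtain m where m: "\<forall>\<^sub>F y in nhds x. GDERIV w y :> m y" "m x = g" "(m has_derivative A) (at x)"
    using w unfolding second_order_at_def by blast
  obtain r where r: "r > 0" "\<And>y. dist y x < r \<Longrightarrow> GDERIV w y :> m y" "\<And>y. dist y x < r \<Longrightarrow> w x \<le> w y"
    using eventually_conj[OF m(1) min] unfolding eventually_nhds_metric by blast
  have line: "((\<lambda>h. w (x + h *\<^sub>R v)) has_real_derivative m (x + h *\<^sub>R v) \<bullet> v) (at h)"
    if "norm v = 1" "\<bar>h\<bar> < r" for v h
  proof -
    have "dist (x + h *\<^sub>R v) x < r" using that by (simp add: dist_norm)
    then have "(w has_derivative (\<lambda>k. k \<bullet> m (x + h *\<^sub>R v))) (at (x + h *\<^sub>R v))"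
      using r(2) by (simp add: gderiv_def)
    moreover have "((\<lambda>h. x + h *\<^sub>R v) has_derivative (\<lambda>k. k *\<^sub>R v)) (at h)"
      by (auto intro!: derivative_eq_intros)
    ultimately have "((\<lambda>h. w (x + h *\<^sub>R v)) has_derivative (\<lambda>k. (k *\<^sub>R v) \<bullet> m (x + h *\<^sub>R v))) (at h)"
      by (rule has_derivative_compose[rotated])
    then show ?thesis
      by (simp add: has_field_derivative_def inner_commute mult.commute[of _ "_ \<bullet> _"])
  qed
  have "A v \<bullet> v \<ge> 0" if v: "norm v = 1" for v
  proof (rule ccontr)
    assume neg: "\<not> ?thesis"
    have m0: "m x \<bullet> v = 0"
      using DERIV_local_min[OF line[OF v, of 0], of r] r v by (auto simp: dist_norm)
    have "((\<lambda>h. m (x + h *\<^sub>R v)) has_derivative (\<lambda>k. A (k *\<^sub>R v))) (at 0)"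
    proof (rule has_derivative_compose[of "\<lambda>h. x + h *\<^sub>R v" "\<lambda>k. k *\<^sub>R v"])
      show "((\<lambda>h. x + h *\<^sub>R v) has_derivative (\<lambda>k. k *\<^sub>R v)) (at 0)"
        by (auto intro!: derivative_eq_intros)
      show "(m has_derivative A) (at (x + 0 *\<^sub>R v))" using m(3) by simp
    qed
    then have "((\<lambda>h. m (x + h *\<^sub>R v) \<bullet> v) has_derivative (\<lambda>k. A (k *\<^sub>R v) \<bullet> v)) (at 0)"
      by (rule has_derivative_inner_left)
    then have "((\<lambda>h. m (x + h *\<^sub>R v) \<bullet> v) has_real_derivative A v \<bullet> v) (at 0)"
      using linear_scale[OF has_derivative_linear[OF m(3)]]
      by (simp add: has_field_derivative_def mult.commute[of _ "_ \<bullet> _"])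
    from DERIV_neg_dec_right[OF this] neg
    obtain e where e: "e > 0" "\<And>h. 0 < h \<Longrightarrow> h < e \<Longrightarrow> m (x + h *\<^sub>R v) \<bullet> v < 0"
      using m0 by auto
    define h where "h = min e r / 2"
    have h: "0 < h" "h < e" "h < r" using e r by (auto simp: h_def)
    have "\<exists>z. 0 < z \<and> z < h \<and> w (x + h *\<^sub>R v) - w (x + 0 *\<^sub>R v) = (h - 0) * (m (x + z *\<^sub>R v) \<bullet> v)"
      by (rule MVT2) (use h in \<open>auto intro!: line v\<close>)
    then obtain z where z: "0 < z" "z < h" "w (x + h *\<^sub>R v) - w x = h * (m (x + z *\<^sub>R v) \<bullet> v)"
      by auto
    have "w (x + h *\<^sub>R v) - w x < 0"
      using z e(2)[of z] h by (simp add: mult_pos_neg)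
    then show False using r(3)[of "x + h *\<^sub>R v"] h v by (simp add: dist_norm)
  qed
  then show ?thesis
    unfolding optrace_def by (intro sum_nonneg) (metis cart_eq_inner_axis norm_axis_1)
qed

text \<open>Only earlier times are compared. The argument therefore also covers the final time,
  where the derivative is one-sided.\<close>

lemma has_real_derivative_left_min:
  assumes d: "(q has_real_derivative D) (at t within {0..T})" and t: "0 < t" "t \<le> T"
    and min: "\<forall>\<^sub>F s in at t within {0..T}. q t \<le> q s"
  shows "D \<le> (0 :: real)"
proof -
  have sub: "{0..<t} \<subseteq> {0..T}" using t by auto
  have "((\<lambda>s. (q s - q t) / (s - t)) \<longlongrightarrow> D) (at t within {0..T})"
    using d by (simp add: has_field_derivative_iff)
  then have "((\<lambda>s. (q s - q t) / (s - t)) \<longlongrightarrow> D) (at t within {0..<t})"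
    using sub by (rule tendsto_within_subset)
  moreover have "\<forall>\<^sub>F s in at t within {0..<t}. (q s - q t) / (s - t) \<le> 0"
  proof -
    have "\<forall>\<^sub>F s in at t within {0..<t}. q t \<le> q s"
      using min sub filter_leD at_le by metis
    moreover have "\<forall>\<^sub>F s in at t within {0..<t}. s < t"
      by (auto simp: eventually_at_filter)
    ultimately show ?thesis
      by eventually_elim (auto simp: divide_le_0_iff)
  qed
  moreover have "at t within {0..<t} \<noteq> bot"
  proof -
    have "t islimpt {0<..<t}" using t(1) by (simp add: islimpt_greaterThanLessThan2)
    then have "t islimpt {0..<t}" by (rule islimpt_subset) auto
    then show ?thesis by (simp add: trivial_limit_within)
  qed
  ultimately show ?thesis by (metis tendsto_upperbound)
qed

text \<open>The solution notion in the form used by a pointwise maximum argument: the Laplacian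
  appears as a trace and the reaction \<open>f\<close> is arbitrary.\<close>

definition classical_allen_cahn ::
  "(real \<Rightarrow> real) \<Rightarrow> real \<Rightarrow> real \<Rightarrow> (real^'n \<Rightarrow> real \<Rightarrow> real) \<Rightarrow> bool"
  where "classical_allen_cahn f \<epsilon> T u \<longleftrightarrow>
    bounded ((\<lambda>(x, t). u x t) ` (UNIV \<times> {0..T})) \<and>
    continuous_on (UNIV \<times> {0..T}) (\<lambda>(x, t). u x t) \<and>
    (\<forall>x. \<forall>t\<in>{0<..T}. \<exists>g A. second_order_at (\<lambda>y. u y t) x g A \<and>
       ((\<lambda>s. u x s) has_real_derivative optrace A - f (u x t) / \<epsilon>\<^sup>2) (at t within {0..T}))"

text \<open>As in the theory of viscosity solutions, \<open>V\<close> only needs to be touched from above; separate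
  test functions on the space slice and on the time slice suffice for a classical solution
  \<open>u\<close>.\<close>

definition supersolution_at ::
  "(real \<Rightarrow> real) \<Rightarrow> real \<Rightarrow> real \<Rightarrow> (real^'n \<Rightarrow> real \<Rightarrow> real) \<Rightarrow> real^'n \<Rightarrow> real \<Rightarrow> bool"
  where "supersolution_at f \<epsilon> T V x t \<longleftrightarrow>
    (\<exists>P Q g A b. P x = V x t \<and> Q t = V x t \<and>
       (\<forall>\<^sub>F y in nhds x. V y t \<le> P y) \<and> (\<forall>\<^sub>F s in at t within {0..T}. V x s \<le> Q s) \<and>
       second_order_at P x g A \<and> (Q has_real_derivative b) (at t within {0..T}) \<and>
       b - optrace A + f (V x t) / \<epsilon>\<^sup>2 \<ge> 0)"

lemma supersolution_atI:
  assumes "second_order_at P x g A" "(Q has_real_derivative b) (at t within {0..T})"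
    and "P x = V x t" "Q t = V x t"
    and "\<forall>\<^sub>F y in nhds x. V y t \<le> P y" "\<forall>\<^sub>F s in at t within {0..T}. V x s \<le> Q s"
    and "b - optrace A + f (V x t) / \<epsilon>\<^sup>2 \<ge> 0"
  shows "supersolution_at f \<epsilon> T V x t"
  unfolding supersolution_at_def using assms by blast

text \<open>Maximum principle on the whole space. The quadratic penalty makes the weighted
  difference attain a maximum, the exponential weight cancels the Lipschitz constant of the
  reaction, and the linear penalty in time outweighs the Laplacian of the quadratic one. An upper
  bound for u and a lower bound for V suffice, because - M \<le> V < u \<le> M at the
  maximum.\<close>

lemma allen_cahn_comparison:
  fixes u V :: "real^'n \<Rightarrow> real \<Rightarrow> real"
  assumes \<epsilon>: "\<epsilon> > 0" and u: "classical_allen_cahn f \<epsilon> T u"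
    and uM: "\<And>x t. t \<in> {0..T} \<Longrightarrow> u x t \<le> M"
    and VM: "\<And>x t. t \<in> {0..T} \<Longrightarrow> - M \<le> V x t"
    and L: "L \<ge> 0" "\<And>a b. a \<in> {-M..M} \<Longrightarrow> b \<in> {-M..M} \<Longrightarrow> \<bar>f a - f b\<bar> \<le> L * \<bar>a - b\<bar>"
    and V: "continuous_on (UNIV \<times> {0..T}) (\<lambda>(x, t). V x t)"
    and init: "\<And>x. u x 0 \<le> V x 0"
    and super: "\<And>x t. 0 < t \<Longrightarrow> t \<le> T \<Longrightarrow> V x t < u x t \<Longrightarrow> supersolution_at f \<epsilon> T V x t"
    and t: "t \<in> {0..T}"
  shows "u x t \<le> V x t"
proof (rule ccontr)
  assume "\<not> ?thesis"
  then have pos: "u x t - V x t > 0" by simp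
  define \<Lambda> where "\<Lambda> = L / \<epsilon>\<^sup>2"
  have \<Lambda>: "\<Lambda> \<ge> 0" using L by (simp add: \<Lambda>_def)
  \<comment> \<open>Twice the dimension is the Laplacian of \<open>y \<bullet> y\<close>; the extra
    1 produces the strict contradiction at the end.\<close>
  define N where "N = 2 * real CARD('n) + 1"
  have N: "N \<ge> 1" by (simp add: N_def)
  \<comment> \<open>At (x, t) the penalty costs less than half of the weighted gap, so
    \<open>\<Phi>\<close> is still positive there.\<close>
  define \<alpha> where "\<alpha> = exp (- \<Lambda> * t) * (u x t - V x t) / (2 * (x \<bullet> x + N * t + 1))"
  have den: "x \<bullet> x + N * t + 1 > 0" using t N by (simp add: add_nonneg_pos)
  have \<alpha>: "\<alpha> > 0" using pos den by (simp add: \<alpha>_def)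
  define \<Phi> where "\<Phi> = (\<lambda>(y, s). exp (- \<Lambda> * s) * (u y s - V y s) - \<alpha> * (y \<bullet> y + N * s))"
  have \<Phi>x: "\<Phi> (x, t) > 0"
  proof -
    have "\<alpha> * (x \<bullet> x + N * t) < \<alpha> * (2 * (x \<bullet> x + N * t + 1))"
      using \<alpha> t N by (intro mult_strict_left_mono) (auto simp: add_nonneg_pos intro!: add_nonneg_pos add_nonneg_nonneg)
    also have "\<dots> = exp (- \<Lambda> * t) * (u x t - V x t)"
      using den by (simp add: \<alpha>_def)
    finally show ?thesis by (simp add: \<Phi>_def)
  qed
  have M: "M \<ge> 0"
    using uM[OF t, of x] VM[OF t, of x] pos by linarith
  \<comment> \<open>Beyond this radius the penalty exceeds the bound 2 M for the gap, so
    \<open>\<Phi>\<close> is not positive and a maximum over the ball is a global one.\<close>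
  define r where "r = sqrt (2 * M / \<alpha>)"
  have out: "norm y \<le> r" if "\<Phi> (y, s) > 0" "s \<in> {0..T}" for y s
  proof -
    have "exp (- \<Lambda> * s) * (u y s - V y s) \<le> exp (- \<Lambda> * s) * (2 * M)"
      using uM[OF that(2), of y] VM[OF that(2), of y] by (intro mult_left_mono) auto
    also have "\<dots> \<le> 1 * (2 * M)"
      using \<Lambda> that(2) M by (intro mult_right_mono) auto
    finally have "exp (- \<Lambda> * s) * (u y s - V y s) \<le> 2 * M" by simp
    moreover have "0 \<le> \<alpha> * (N * s)" using \<alpha> N that(2) by simp
    ultimately have "\<alpha> * (y \<bullet> y) \<le> 2 * M"
      using that(1) by (simp add: \<Phi>_def algebra_simps)
    then have "(norm y)\<^sup>2 \<le> 2 * M / \<alpha>"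
      using \<alpha> by (simp add: field_simps power2_norm_eq_inner)
    then show ?thesis unfolding r_def by (rule real_le_rsqrt)
  qed
  have cont: "continuous_on (cball 0 r \<times> {0..T}) \<Phi>"
  proof -
    have "continuous_on (UNIV \<times> {0..T}) (\<lambda>(x, t). u x t)"
      using u by (simp add: classical_allen_cahn_def)
    then have "continuous_on (UNIV \<times> {0..T}) \<Phi>"
      using V unfolding \<Phi>_def case_prod_unfold by (intro continuous_intros)
    then show ?thesis by (rule continuous_on_subset) auto
  qed
  have "\<exists>p\<in>cball 0 r \<times> {0..T}. \<forall>q\<in>cball 0 r \<times> {0..T}. \<Phi> q \<le> \<Phi> p"
    by (rule continuous_attains_sup[OF _ _ cont])
      (use order_trans[OF norm_ge_zero out[OF \<Phi>x t]] t in \<open>auto intro!: compact_Times simp: dist_norm\<close>)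
  then obtain y s where ys: "norm y \<le> r" "s \<in> {0..T}"
    and max0: "\<And>q. q \<in> cball 0 r \<times> {0..T} \<Longrightarrow> \<Phi> q \<le> \<Phi> (y, s)"
    by (auto simp: dist_norm)
  have \<Phi>pos: "\<Phi> (y, s) > 0"
    using max0[of "(x, t)"] \<Phi>x out[OF \<Phi>x t] t by simp
  have max: "\<Phi> (z, \<tau>) \<le> \<Phi> (y, s)" if "\<tau> \<in> {0..T}" for z \<tau>
    using max0[of "(z, \<tau>)"] out[of z \<tau>] \<Phi>pos that by force
  define e where "e = exp (- \<Lambda> * s)"
  have e: "e > 0" by (simp add: e_def)
  have "0 \<le> \<alpha> * (y \<bullet> y + N * s)" using \<alpha> N ys by simp
  then have "e * (u y s - V y s) > 0" using \<Phi>pos by (simp add: \<Phi>_def e_def)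
  then have less: "V y s < u y s" using e by (simp add: zero_less_mult_iff)
  have s: "0 < s" "s \<le> T" using less init[of y] ys(2) by (auto simp: less_le)
  obtain P Q g A b where PQ: "P y = V y s" "Q s = V y s" "\<forall>\<^sub>F z in nhds y. V z s \<le> P z"
    "\<forall>\<^sub>F \<tau> in at s within {0..T}. V y \<tau> \<le> Q \<tau>" "second_order_at P y g A"
    "(Q has_real_derivative b) (at s within {0..T})" "b - optrace A + f (V y s) / \<epsilon>\<^sup>2 \<ge> 0"
    using super[OF s less] unfolding supersolution_at_def by blast
  obtain k B where u2: "second_order_at (\<lambda>y. u y s) y k B"
    "((\<lambda>s. u y s) has_real_derivative optrace B - f (u y s) / \<epsilon>\<^sup>2) (at s within {0..T})"
    using u s unfolding classical_allen_cahn_def by (meson greaterThanAtMost_iff)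
  \<comment> \<open>Test in space: P touches V from above at y, so replacing V by P preserves the
    minimum of the penalised difference.\<close>
  have "optrace (\<lambda>h. e *\<^sub>R (A h + (-1) *\<^sub>R B h) + \<alpha> *\<^sub>R (2 *\<^sub>R h)) \<ge> 0"
  proof (rule second_order_at_local_min)
    show "second_order_at (\<lambda>z. e * (P z + (-1) * u z s) + \<alpha> * (z \<bullet> z)) y
        (e *\<^sub>R (g + (-1) *\<^sub>R k) + \<alpha> *\<^sub>R (2 *\<^sub>R y))
        (\<lambda>h. e *\<^sub>R (A h + (-1) *\<^sub>R B h) + \<alpha> *\<^sub>R (2 *\<^sub>R h))"
      by (intro second_order_at_add second_order_at_cmult PQ u2 second_order_at_norm_sq)
    show "\<forall>\<^sub>F z in nhds y. e * (P y + (-1) * u y s) + \<alpha> * (y \<bullet> y) \<le> e * (P z + (-1) * u z s) + \<alpha> * (z \<bullet> z)"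
      using PQ(3)
    proof eventually_elim
      case (elim z)
      have "e * (V z s - u z s) \<le> e * (P z - u z s)" using elim e by simp
      moreover have "e * (V y s - u y s) + \<alpha> * (y \<bullet> y) \<le> e * (V z s - u z s) + \<alpha> * (z \<bullet> z)"
        using max[OF ys(2), of z] by (simp add: \<Phi>_def e_def algebra_simps)
      ultimately show ?case using PQ(1) by simp
    qed
  qed
  then have 1: "e * (optrace A - optrace B) + 2 * real CARD('n) * \<alpha> \<ge> 0"
    by (simp only: optrace_simps) (simp add: algebra_simps)
  have in_int: "\<forall>\<^sub>F \<tau> in at s within {0..T}. \<tau> \<in> {0..T}"
    by (auto simp: eventually_at_filter)
  \<comment> \<open>Test in time, with Q in place of V; the weight contributes the term with
    \<Lambda>, which has a favourable sign because V < u.\<close>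
  have 2: "e * (b - (optrace B - f (u y s) / \<epsilon>\<^sup>2)) - \<Lambda> * e * (Q s - u y s) + \<alpha> * N \<le> 0"
  proof (rule has_real_derivative_left_min[OF _ s])
    show "((\<lambda>\<tau>. exp (- \<Lambda> * \<tau>) * (Q \<tau> - u y \<tau>) + \<alpha> * (N * \<tau>)) has_real_derivative
        e * (b - (optrace B - f (u y s) / \<epsilon>\<^sup>2)) - \<Lambda> * e * (Q s - u y s) + \<alpha> * N) (at s within {0..T})"
      unfolding e_def by (auto intro!: derivative_eq_intros PQ u2)
    show "\<forall>\<^sub>F \<tau> in at s within {0..T}. exp (- \<Lambda> * s) * (Q s - u y s) + \<alpha> * (N * s)
        \<le> exp (- \<Lambda> * \<tau>) * (Q \<tau> - u y \<tau>) + \<alpha> * (N * \<tau>)"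
      using PQ(4) in_int
    proof eventually_elim
      case (elim \<tau>)
      have "exp (- \<Lambda> * \<tau>) * (V y \<tau> - u y \<tau>) \<le> exp (- \<Lambda> * \<tau>) * (Q \<tau> - u y \<tau>)" using elim by simp
      moreover have "exp (- \<Lambda> * s) * (V y s - u y s) + \<alpha> * (N * s)
          \<le> exp (- \<Lambda> * \<tau>) * (V y \<tau> - u y \<tau>) + \<alpha> * (N * \<tau>)"
        using max[of \<tau> y] elim by (simp add: \<Phi>_def algebra_simps)
      ultimately show ?case unfolding PQ(2) by linarith
    qed
  qed
  have "f (u y s) - f (V y s) \<ge> - L * (u y s - V y s)"
    using L(2)[of "u y s" "V y s"] uM[OF ys(2), of y] VM[OF ys(2), of y] less by (auto simp: abs_le_iff)
  then have "(f (u y s) - f (V y s)) / \<epsilon>\<^sup>2 \<ge> - \<Lambda> * (u y s - V y s)"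
    using divide_right_mono[of "- L * (u y s - V y s)" _ "\<epsilon>\<^sup>2"] by (simp add: \<Lambda>_def)
  then have 3: "b - optrace A + (f (u y s) / \<epsilon>\<^sup>2) - \<Lambda> * (Q s - u y s) \<ge> 0"
    using PQ(2,7) by (simp add: diff_divide_distrib algebra_simps)
  have "0 \<le> e * (b - optrace A + (f (u y s) / \<epsilon>\<^sup>2) - \<Lambda> * (Q s - u y s))"
    using 3 e by simp
  then have "\<alpha> * N \<le> 2 * real CARD('n) * \<alpha>"
    using 1 2 by (simp add: algebra_simps)
  then show False using \<alpha> by (simp add: N_def algebra_simps)
qed

section \<open>Signed distance and C2 defining functions\<close>

lemma abs_signed_dist: "\<bar>signed_dist \<Omega> x\<bar> = infdist x (frontier \<Omega>)"
  by (simp add: signed_dist_def infdist_nonneg)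

lemma segment_meets_frontier:
  fixes x y :: "real^'n"
  assumes "x \<in> S" "y \<notin> S"
  obtains z where "z \<in> frontier S" "z \<in> closed_segment x y"
proof -
  have "closed_segment x y \<inter> frontier S \<noteq> {}"
    by (rule connected_Int_frontier) (use assms in auto)
  then show thesis using that by blast
qed

text \<open>For points on different sides the segment between them meets the frontier, so the two
  unsigned distances add up to at most its length.\<close>

lemma signed_dist_lipschitz: "\<bar>signed_dist \<Omega> x - signed_dist \<Omega> y\<bar> \<le> dist x y"
proof -
  have *: "infdist x F \<le> infdist y F + dist x y" for x y :: "real^'n" and F
    using infdist_triangle[of x F y] by simp
  have cross: "infdist x (frontier \<Omega>) + infdist y (frontier \<Omega>) \<le> dist x y"
    if xy: "x \<in> \<Omega>" "y \<notin> \<Omega>" for x y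
  proof -
    obtain z where z: "z \<in> frontier \<Omega>" "z \<in> closed_segment x y"
      using segment_meets_frontier[OF xy] .
    have "dist x y = dist x z + dist z y"
      using z(2) by (simp add: between_mem_segment[symmetric] between)
    then show ?thesis
      using infdist_le[OF z(1), of x] infdist_le[OF z(1), of y] by (simp add: dist_commute)
  qed
  show ?thesis
    using *[of x "frontier \<Omega>" y] *[of y "frontier \<Omega>" x] cross[of x y] cross[of y x]
      infdist_nonneg[of x "frontier \<Omega>"] infdist_nonneg[of y "frontier \<Omega>"]
    by (auto simp: signed_dist_def dist_commute)
qed

lemma open_pos_iff_mem:
  assumes "open \<Omega>" "frontier \<Omega> \<noteq> {}"
  shows "x \<in> \<Omega> \<longleftrightarrow> signed_dist \<Omega> x > 0"
proof
  assume x: "x \<in> \<Omega>"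
  then have "x \<notin> frontier \<Omega>" using assms by (auto simp: frontier_def interior_open)
  then show "signed_dist \<Omega> x > 0"
    using x assms(2) infdist_pos_not_in_closed[OF frontier_closed] by (simp add: signed_dist_def)
next
  assume "0 < signed_dist \<Omega> x"
  then show "x \<in> \<Omega>"
    using infdist_nonneg[of x "frontier \<Omega>"] by (auto simp: signed_dist_def split: if_splits)
qed

text \<open>Smoothness is given through directional derivatives; the gradient field and its
  derivative are assembled from the basis directions. The finitely many second derivatives are
  continuous, hence bounded on a closed ball, which gives one constant for the whole chart.\<close>

lemma higher_differentiable_on_gradient:
  fixes \<phi> :: "'a::euclidean_space \<Rightarrow> real"
  assumes N: "open N" "z0 \<in> N" and \<phi>: "higher_differentiable_on N \<phi> (Suc (Suc 0))"
  obtains H H' r L where "r > 0" "L > 0" "cball z0 r \<subseteq> N"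
    "\<And>z. z \<in> N \<Longrightarrow> (\<phi> has_derivative (\<lambda>h. H z \<bullet> h)) (at z)"
    "\<And>z. z \<in> N \<Longrightarrow> (H has_derivative H' z) (at z)"
    "\<And>z h. z \<in> cball z0 r \<Longrightarrow> norm (H' z h) \<le> L * norm h"
proof -
  define D where "D = (\<lambda>z b. frechet_derivative \<phi> (at z) b)"
  define D2 where "D2 = (\<lambda>z b. frechet_derivative (\<lambda>z. D z b) (at z))"
  have d1: "(\<phi> has_derivative D z) (at z)" if "z \<in> N" for z
    using \<phi> that by (auto simp: D_def frechet_derivative_works)
  have d2: "((\<lambda>z. D z b) has_derivative D2 z b) (at z)" if "z \<in> N" for z b
    using \<phi> that by (auto simp: D2_def D_def frechet_derivative_works)
  have c2: "continuous_on N (\<lambda>z. D2 z b c)" for b c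
    using \<phi> by (auto simp: D2_def D_def)
  define H where "H = (\<lambda>z. \<Sum>b\<in>Basis. D z b *\<^sub>R b)"
  define H' where "H' = (\<lambda>z h. \<Sum>b\<in>Basis. D2 z b h *\<^sub>R b)"
  have lin: "linear (D z)" "linear (D2 z b)" if "z \<in> N" for z b
    using d1[OF that] d2[OF that] by (auto intro: has_derivative_linear)
  have grad: "(\<phi> has_derivative (\<lambda>h. H z \<bullet> h)) (at z)" if "z \<in> N" for z
  proof -
    have "D z h = H z \<bullet> h" for h
      using Linear_Algebra.linear_componentwise[OF lin(1)[OF that], of h 1]
      by (simp add: H_def inner_sum_left inner_commute[of h] mult.commute)
    then have "D z = (\<lambda>h. H z \<bullet> h)" by (rule ext)
    then show ?thesis using d1[OF that] by simp
  qed
  have hess: "(H has_derivative H' z) (at z)" if "z \<in> N" for z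
    unfolding H_def H'_def by (intro derivative_intros d2 that)
  obtain r where r: "r > 0" "cball z0 r \<subseteq> N"
    using N by (meson open_contains_cball)
  have "\<exists>K. \<forall>z\<in>cball z0 r. \<bar>D2 z b c\<bar> \<le> K" for b c
  proof -
    have "bounded ((\<lambda>z. D2 z b c) ` cball z0 r)"
      by (intro compact_imp_bounded compact_continuous_image continuous_on_subset[OF c2 r(2)]) auto
    then show ?thesis by (auto simp: bounded_iff)
  qed
  then obtain K where K: "\<And>b c z. z \<in> cball z0 r \<Longrightarrow> \<bar>D2 z b c\<bar> \<le> K b c" by metis
  define L where "L = 1 + (\<Sum>b\<in>(Basis::'a set). \<Sum>c\<in>(Basis::'a set). \<bar>K b c\<bar>)"
  have bound: "norm (H' z h) \<le> L * norm h" if z: "z \<in> cball z0 r" for z h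
  proof -
    have zN: "z \<in> N" using z r by auto
    have "\<bar>D2 z b h\<bar> \<le> (\<Sum>c\<in>Basis. \<bar>K b c\<bar>) * norm h" for b
    proof -
      have "D2 z b h = (\<Sum>c\<in>Basis. (h \<bullet> c) * D2 z b c)"
        using Linear_Algebra.linear_componentwise[OF lin(2)[OF zN], of b h 1] by simp
      then have "\<bar>D2 z b h\<bar> \<le> (\<Sum>c\<in>Basis. \<bar>(h \<bullet> c) * D2 z b c\<bar>)"
        by (simp add: sum_abs)
      also have "\<dots> \<le> (\<Sum>c\<in>Basis. norm h * \<bar>K b c\<bar>)"
      proof (rule sum_mono)
        fix c :: 'a assume "c \<in> Basis"
        then show "\<bar>(h \<bullet> c) * D2 z b c\<bar> \<le> norm h * \<bar>K b c\<bar>"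
          using K[OF z, of b c] Basis_le_norm[of c h] unfolding abs_mult
          by (intro mult_mono) auto
      qed
      finally show ?thesis by (simp add: sum_distrib_left mult.commute)
    qed
    then have "(\<Sum>b\<in>(Basis::'a set). \<bar>D2 z b h\<bar>) \<le> (\<Sum>b\<in>(Basis::'a set). (\<Sum>c\<in>Basis. \<bar>K b c\<bar>) * norm h)"
      by (intro sum_mono) auto
    moreover have "norm (H' z h) \<le> (\<Sum>b\<in>(Basis::'a set). \<bar>D2 z b h\<bar>)"
      unfolding H'_def by (rule order_trans[OF norm_sum]) (simp add: sum_mono)
    ultimately have "norm (H' z h) \<le> (\<Sum>b\<in>(Basis::'a set). \<Sum>c\<in>(Basis::'a set). \<bar>K b c\<bar>) * norm h"
      by (simp add: sum_distrib_right[symmetric])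
    then show ?thesis using norm_ge_zero[of h] unfolding L_def distrib_right by linarith
  qed
  have "L > 0" unfolding L_def by (intro add_pos_nonneg sum_nonneg) auto
  then show thesis using that[of r L H H'] r grad hess bound by blast
qed

text \<open>Mean value inequality for \<phi> minus its linear part at \<open>z\<close>, whose
  gradient along the segment is at most L times the distance to \<open>z\<close>.\<close>

lemma quadratic_taylor_bound:
  fixes \<phi> :: "'a::real_inner \<Rightarrow> real"
  assumes S: "convex S" "z \<in> S" "w \<in> S"
    and \<phi>: "\<And>z. z \<in> S \<Longrightarrow> (\<phi> has_derivative (\<lambda>h. H z \<bullet> h)) (at z)"
    and H: "\<And>z w. z \<in> S \<Longrightarrow> w \<in> S \<Longrightarrow> norm (H z - H w) \<le> L * norm (z - w)"
    and L: "L \<ge> 0"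
  shows "\<bar>\<phi> w - \<phi> z - H z \<bullet> (w - z)\<bar> \<le> L * (norm (w - z))\<^sup>2"
proof -
  define g where "g = (\<lambda>y. \<phi> y - H z \<bullet> y)"
  have sub: "closed_segment z w \<subseteq> S" using S by (simp add: closed_segment_subset)
  have "norm (g w - g z) \<le> (L * norm (w - z)) * norm (w - z)"
  proof (rule differentiable_bound[of "closed_segment z w" g "\<lambda>y h. (H y - H z) \<bullet> h"])
    fix y assume y: "y \<in> closed_segment z w"
    then have yS: "y \<in> S" using sub by auto
    show "(g has_derivative (\<lambda>h. (H y - H z) \<bullet> h)) (at y within closed_segment z w)"
      unfolding g_def
      by (auto intro!: derivative_eq_intros has_derivative_at_withinI[OF \<phi>[OF yS]] simp: inner_diff_left)
    have "onorm (\<lambda>h. (H y - H z) \<bullet> h) \<le> norm (H y - H z)"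
      by (rule onorm_bound) (auto simp: Cauchy_Schwarz_ineq2)
    also have "\<dots> \<le> L * norm (y - z)" using H yS S by auto
    also have "\<dots> \<le> L * norm (w - z)"
      using segment_bound(1)[OF y] L by (simp add: mult_left_mono norm_minus_commute)
    finally show "onorm (\<lambda>h. (H y - H z) \<bullet> h) \<le> L * norm (w - z)" .
  qed auto
  then show ?thesis by (simp add: g_def inner_diff_right power2_eq_square algebra_simps)
qed

text \<open>A unit field transported along its own normal lines: \<open>m = n \<circ> q\<close> with
  \<open>q y = y - d y * m y\<close>. Differentiating \<open>m + d x * Nn m\<close> instead of \<open>m\<close> avoids any a priori
  differentiability of the foot point map \<open>q\<close>.\<close>

lemma has_derivative_normal_field:
  fixes n m q :: "'a::euclidean_space \<Rightarrow> 'a" and d :: "'a \<Rightarrow> real"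
  assumes n: "(n has_derivative Nn) (at (q x))"
    and m: "\<forall>\<^sub>F y in nhds x. m y = n (q y)" and q: "\<forall>\<^sub>F y in nhds x. q y = y - d y *\<^sub>R m y"
    and d: "(d has_derivative (\<lambda>h. m x \<bullet> h)) (at x)"
    and lip: "\<forall>\<^sub>F y in nhds x. norm (m y - m x) \<le> c * norm (y - x)"
      "\<forall>\<^sub>F y in nhds x. norm (q y - q x) \<le> c * norm (y - x)"
    and K: "\<And>h. norm (Nn h) \<le> K * norm h" "\<bar>d x\<bar> * K \<le> 1 / 2" and m1: "norm (m x) = 1"
  obtains A where "(m has_derivative A) (at x)"
    "\<And>h. A h + d x *\<^sub>R Nn (A h) = Nn (h - (m x \<bullet> h) *\<^sub>R m x)"
    "\<And>h. norm (A h) \<le> 4 * K * norm h"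
proof -
  have linN: "linear Nn" using n by (rule has_derivative_linear)
  have blN: "bounded_linear Nn" using n by (rule has_derivative_bounded_linear)
  define c' where "c' = max c 1"
  have c': "c' > 0" "c \<le> c'" by (auto simp: c'_def)
  have lip': "\<forall>\<^sub>F y in nhds x. norm (m y - m x) \<le> c' * norm (y - x)"
      "\<forall>\<^sub>F y in nhds x. norm (q y - q x) \<le> c' * norm (y - x)"
    by (rule eventually_mono[OF lip(1)], erule order_trans, simp add: mult_right_mono c')
      (rule eventually_mono[OF lip(2)], erule order_trans, simp add: mult_right_mono c')
  \<comment> \<open>Linearising n at \<open>q x\<close> and inserting the formula for q leads to an
    equation m + d x Nn m = F. The left-hand operator differs from the identity by at most 1/2 in
    norm, hence is invertible.\<close>
  define Tm where "Tm = (\<lambda>h. h + d x *\<^sub>R Nn h)"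
  have linT: "linear Tm"
    unfolding Tm_def using linN
    by (auto intro!: linearI simp: linear_add linear_scale algebra_simps)
  have T_lower: "norm h / 2 \<le> norm (Tm h)" for h
  proof -
    have "norm (d x *\<^sub>R Nn h) \<le> \<bar>d x\<bar> * (K * norm h)" using K(1)[of h] by (simp add: mult_left_mono)
    also have "\<dots> = (\<bar>d x\<bar> * K) * norm h" by simp
    also have "\<dots> \<le> 1 / 2 * norm h" by (rule mult_right_mono[OF K(2)]) simp
    finally have "norm (d x *\<^sub>R Nn h) \<le> norm h / 2" by simp
    then show ?thesis using norm_diff_ineq[of h "d x *\<^sub>R Nn h"] by (simp add: Tm_def)
  qed
  have "inj Tm"
    unfolding linear_injective_0[OF linT]
    using T_lower by (metis half_gt_zero_iff norm_le_zero_iff norm_zero order_trans zero_less_norm_iff not_le)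
  then obtain S where S: "linear S" "\<And>h. S (Tm h) = h" "\<And>h. Tm (S h) = h"
    using linear_injective_isomorphism[OF linT] by blast
  have S2: "norm (S h) \<le> 2 * norm h" for h using T_lower[of "S h"] S(3)[of h] by simp
  \<comment> \<open>Taylor remainder of n along q; of higher order because q is Lipschitz at
    x.\<close>
  define E where "E = (\<lambda>y. m y - m x - Nn (q y - q x))"
  have E: "(E has_derivative (\<lambda>h. 0)) (at x)"
    unfolding has_derivative_at_alt
  proof (intro conjI allI impI)
    fix e :: real assume "0 < e"
    then have e: "0 < e / c'" using c' by simp
    obtain \<delta> where \<delta>: "\<delta> > 0"
      "\<And>w. norm (w - q x) < \<delta> \<Longrightarrow> norm (n w - n (q x) - Nn (w - q x)) \<le> e / c' * norm (w - q x)"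
      using n e unfolding has_derivative_at_alt by blast
    have mx: "m x = n (q x)" using eventually_nhds_x_imp_x[OF m] .
    have "\<forall>\<^sub>F y in nhds x. norm (y - x) < \<delta> / c'"
      using \<delta> c' by (auto simp: eventually_nhds_metric dist_norm intro!: exI[of _ "\<delta> / c'"])
    then have "\<forall>\<^sub>F y in nhds x. norm (E y - E x - 0) \<le> e * norm (y - x)"
      using lip'(2) m
    proof eventually_elim
      case (elim y)
      have "norm (q y - q x) < \<delta>"
        using elim(1,2) c' by (simp add: field_simps)
      from \<delta>(2)[OF this] have "norm (E y) \<le> e / c' * norm (q y - q x)"
        using elim(3) mx by (simp add: E_def)
      also have "\<dots> \<le> e / c' * (c' * norm (y - x))"
        using elim(2) e by (intro mult_left_mono) auto
      finally show ?case using c' linear_0[OF linN] by (simp add: E_def)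
    qed
    then show "\<exists>da>0. \<forall>y. norm (y - x) < da \<longrightarrow> norm (E y - E x - 0) \<le> e * norm (y - x)"
      by (simp add: eventually_nhds_metric dist_norm)
  qed simp
  \<comment> \<open>The product of increments left over when \<open>d y *\<^sub>R m y\<close> is
    expanded around x; of higher order because d is continuous and m Lipschitz at x.\<close>
  define R where "R = (\<lambda>y. (d y - d x) *\<^sub>R (m y - m x))"
  have R: "(R has_derivative (\<lambda>h. 0)) (at x)"
    unfolding has_derivative_at_alt
  proof (intro conjI allI impI)
    fix e :: real assume "0 < e"
    have "isCont d x" using d by (rule has_derivative_continuous)
    then have "\<forall>\<^sub>F y in nhds x. dist (d y) (d x) < e / c'"
      using \<open>0 < e\<close> c' tendstoD[of d "d x" "nhds x" "e / c'"]
      by (auto simp: isCont_def tendsto_at_iff_tendsto_nhds)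
    then have "\<forall>\<^sub>F y in nhds x. norm (R y - R x - 0) \<le> e * norm (y - x)"
      using lip'(1)
    proof eventually_elim
      case (elim y)
      have "norm (R y) \<le> (e / c') * (c' * norm (y - x))"
        unfolding R_def norm_scaleR using elim by (intro mult_mono) (auto simp: dist_real_def)
      then show ?case using c' by (simp add: R_def)
    qed
    then show "\<exists>da>0. \<forall>y. norm (y - x) < da \<longrightarrow> norm (R y - R x - 0) \<le> e * norm (y - x)"
      by (simp add: eventually_nhds_metric dist_norm)
  qed simp
  \<comment> \<open>The right-hand side of the equation. The unknown \<open>m y\<close> enters only
    through \<open>E\<close> and \<open>R\<close>, whose derivatives vanish, so the derivative of
    \<open>F\<close> is explicit.\<close>
  define F where "F = (\<lambda>y. m x + E y - Nn (q x) + Nn y - Nn ((d y - d x) *\<^sub>R m x) - Nn (R y))"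
  have "(F has_derivative (\<lambda>h. 0 + 0 - 0 + Nn h - Nn ((m x \<bullet> h - 0) *\<^sub>R m x) - Nn 0)) (at x)"
    unfolding F_def
    by (intro has_derivative_diff has_derivative_add has_derivative_const E
        bounded_linear.has_derivative[OF blN] R has_derivative_scaleR_left d has_derivative_ident)
  then have F: "(F has_derivative (\<lambda>h. Nn (h - (m x \<bullet> h) *\<^sub>R m x))) (at x)"
    by (simp add: linear_diff[OF linN] linear_0[OF linN])
  have "\<forall>\<^sub>F y in nhds x. Tm (m y) = F y"
    using q
  proof eventually_elim
    case (elim y)
    have "Nn (q y) = Nn y - d y *\<^sub>R Nn (m y)"
      using elim by (simp add: linear_diff[OF linN] linear_scale[OF linN])
    then show ?case
      by (simp add: Tm_def F_def E_def R_def linear_diff[OF linN] linear_add[OF linN] linear_scale[OF linN]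
          algebra_simps)
  qed
  then have ev: "\<forall>\<^sub>F y in nhds x. m y = S (F y)"
    by eventually_elim (metis S(2))
  have blS: "bounded_linear S" using S(1) by (simp add: linear_conv_bounded_linear)
  have "((\<lambda>y. S (F y)) has_derivative (\<lambda>h. S (Nn (h - (m x \<bullet> h) *\<^sub>R m x)))) (at x)"
    by (rule bounded_linear.has_derivative[OF blS F])
  then have mA: "(m has_derivative (\<lambda>h. S (Nn (h - (m x \<bullet> h) *\<^sub>R m x)))) (at x)"
    by (rule has_derivative_transform_eventually)
      (use ev eventually_nhds_x_imp_x[OF ev] in \<open>auto simp: eventually_nhds_conv_at eq_commute\<close>)
  show thesis
  proof (rule that[OF mA])
    show "S (Nn (h - (m x \<bullet> h) *\<^sub>R m x)) + d x *\<^sub>R Nn (S (Nn (h - (m x \<bullet> h) *\<^sub>R m x)))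
        = Nn (h - (m x \<bullet> h) *\<^sub>R m x)" for h
      using S(3) by (simp add: Tm_def)
    have K0: "K \<ge> 0" using K(1)[of "m x"] m1 by (metis mult.right_neutral norm_ge_zero order_trans)
    show "norm (S (Nn (h - (m x \<bullet> h) *\<^sub>R m x))) \<le> 4 * K * norm h" for h
    proof -
      have "norm (h - (m x \<bullet> h) *\<^sub>R m x) \<le> norm h + \<bar>m x \<bullet> h\<bar> * norm (m x)"
        by (metis norm_scaleR norm_triangle_ineq4)
      also have "\<dots> \<le> 2 * norm h" using Cauchy_Schwarz_ineq2[of "m x" h] m1 by simp
      finally have "K * norm (h - (m x \<bullet> h) *\<^sub>R m x) \<le> K * (2 * norm h)"
        using K0 by (rule mult_left_mono)
      then show ?thesis
        using S2[of "Nn (h - (m x \<bullet> h) *\<^sub>R m x)"] K(1)[of "h - (m x \<bullet> h) *\<^sub>R m x"] by simp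
    qed
  qed
qed

section \<open>The signed distance near the interface\<close>

text \<open>Stated relative to a set so that it also yields one-sided time derivatives at the ends
  of the interval.\<close>

lemma has_derivative_quadratic:
  assumes D: "bounded_linear D"
    and bound: "\<forall>\<^sub>F y in at x within S. norm (f y - f x - D (y - x)) \<le> K * (norm (y - x))\<^sup>2"
  shows "(f has_derivative D) (at x within S)"
proof -
  have lim: "((\<lambda>y. \<bar>K\<bar> * norm (y - x)) \<longlongrightarrow> 0) (at x within S)"
    by (auto intro!: tendsto_eq_intros)
  have ev: "\<forall>\<^sub>F y in at x within S. norm ((1 / norm (y - x)) *\<^sub>R (f y - f x - D (y - x))) \<le> \<bar>K\<bar> * norm (y - x)"
    using bound
  proof eventually_elim
    case (elim y)
    show ?case
    proof (cases "y = x")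
      case False
      have "norm (f y - f x - D (y - x)) \<le> \<bar>K\<bar> * (norm (y - x))\<^sup>2"
        by (rule order_trans[OF elim]) (simp add: mult_right_mono)
      then show ?thesis using False by (simp add: divide_simps power2_eq_square mult.assoc)
    qed auto
  qed
  have "((\<lambda>y. (1 / norm (y - x)) *\<^sub>R (f y - f x - D (y - x))) \<longlongrightarrow> 0) (at x within S)"
    by (rule Lim_null_comparison[OF ev lim])
  then have "((\<lambda>y. (1 / norm (y - x)) *\<^sub>R (f y - (f x + D (y - x)))) \<longlongrightarrow> 0) (at x within S)"
    by (simp only: diff_diff_eq)
  then show ?thesis
    unfolding has_derivative_within using D by blast
qed

text \<open>The vector a - b makes an acute angle with a and an obtuse one with b unless they
  coincide. Used to identify the direction to a nearest point with the normal.\<close>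

lemma unit_vector_eqI:
  fixes a b :: "'a::real_inner"
  assumes unit: "norm a = 1" "norm b = 1" and half: "\<And>v. v \<bullet> a > 0 \<Longrightarrow> b \<bullet> v \<ge> 0"
  shows "a = b"
proof (rule ccontr)
  assume "a \<noteq> b"
  then have "0 < (a - b) \<bullet> (a - b)" by simp
  moreover have "a \<bullet> a = 1" "b \<bullet> b = 1" using unit by (simp_all add: norm_eq_1)
  ultimately have "a \<bullet> b < 1" by (simp add: inner_diff inner_commute)
  then show False
    using half[of "a - b"] \<open>a \<bullet> a = 1\<close> \<open>b \<bullet> b = 1\<close> by (simp add: inner_diff inner_commute)
qed

text \<open>A space-time ball around an interface point in which the defining function has a
  Lipschitz gradient whose spatial part is bounded away from zero. The ball may reach beyond [0, T];
  there \<phi> keeps its bounds but says nothing about \<open>\<Omega>\<close>.\<close>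

locale interface_chart =
  fixes T :: real and \<Omega> :: "real \<Rightarrow> (real^'n) set" and x0 :: "real^'n" and t0 :: real
    and \<phi> :: "(real^'n) \<times> real \<Rightarrow> real" and H :: "(real^'n) \<times> real \<Rightarrow> (real^'n) \<times> real"
    and H' :: "(real^'n) \<times> real \<Rightarrow> (real^'n) \<times> real \<Rightarrow> (real^'n) \<times> real" and r L \<gamma> :: real
  assumes T: "0 < T" and t0: "t0 \<in> {0..T}" and x0: "x0 \<in> frontier (\<Omega> t0)"
    and open_\<Omega>: "\<And>t. t \<in> {0..T} \<Longrightarrow> open (\<Omega> t)"
    and nonempty: "\<And>t. t \<in> {0..T} \<Longrightarrow> frontier (\<Omega> t) \<noteq> {}"
    and pos: "r > 0" "L > 0" "\<gamma> > 0"
    and \<phi>: "\<And>z. z \<in> cball (x0, t0) r \<Longrightarrow> (\<phi> has_derivative (\<lambda>h. H z \<bullet> h)) (at z)"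
    and H: "\<And>z. z \<in> cball (x0, t0) r \<Longrightarrow> (H has_derivative H' z) (at z)"
    and H': "\<And>z h. z \<in> cball (x0, t0) r \<Longrightarrow> norm (H' z h) \<le> L * norm h"
    and G: "\<And>z. z \<in> cball (x0, t0) r \<Longrightarrow> \<gamma> \<le> norm (fst (H z))"
    and mem: "\<And>x t. (x, t) \<in> cball (x0, t0) r \<Longrightarrow> t \<in> {0..T} \<Longrightarrow> x \<in> \<Omega> t \<longleftrightarrow> \<phi> (x, t) > 0"
    and fron: "\<And>x t. (x, t) \<in> cball (x0, t0) r \<Longrightarrow> t \<in> {0..T} \<Longrightarrow> x \<in> frontier (\<Omega> t) \<longleftrightarrow> \<phi> (x, t) = 0"
begin

section \<open>Normal field and speed of the interface in a chart\<close>

abbreviation Q where "Q \<equiv> cball (x0, t0) r"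
abbreviation d where "d x t \<equiv> signed_dist (\<Omega> t) x"

lemma norm_Pair_le_add: "norm (a, b) \<le> norm a + norm b"
  unfolding norm_Pair by (rule sqrt_sum_squares_le_sum) auto

lemma norm_fst_snd_le: "norm (fst z) \<le> norm z" "norm (snd z) \<le> norm z"
  using norm_fst_le[of "fst z" "snd z"] norm_snd_le[of "snd z" "fst z"] by simp_all

lemma dist_center_le: "dist (x0, t0) (x, t) \<le> norm (x - x0) + \<bar>t - t0\<bar>"
  using norm_Pair_le_add[of "x - x0" "t - t0"] by (metis dist_commute dist_norm diff_Pair real_norm_def)

definition normal :: "(real^'n) \<times> real \<Rightarrow> real^'n"
  where "normal z = fst (H z) /\<^sub>R norm (fst (H z))"

definition normal' :: "(real^'n) \<times> real \<Rightarrow> (real^'n) \<times> real \<Rightarrow> real^'n"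
  where "normal' z h = fst (H' z h) /\<^sub>R norm (fst (H z))
    - ((fst (H z) \<bullet> fst (H' z h)) / norm (fst (H z)) ^ 3) *\<^sub>R fst (H z)"

text \<open>Lipschitz constant of the normal: each of the two terms of the quotient rule contributes
  at most L / \<gamma>.\<close>

definition L1 where "L1 = 2 * L / \<gamma>"

lemma L1: "L1 > 0" using pos by (simp add: L1_def)

lemma fst_H_nonzero: "z \<in> Q \<Longrightarrow> norm (fst (H z)) > 0"
  using G[of z] pos by linarith

lemma norm_normal: "z \<in> Q \<Longrightarrow> norm (normal z) = 1"
  using fst_H_nonzero[of z] by (simp add: normal_def)

lemma H_lipschitz: "z \<in> Q \<Longrightarrow> w \<in> Q \<Longrightarrow> norm (H z - H w) \<le> L * norm (z - w)"
  by (rule differentiable_bound[OF convex_cball has_derivative_at_withinI[OF H]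
        onorm_bound[OF less_imp_le[OF pos(2)] H']])

lemma normal_derivative:
  assumes z: "z \<in> Q"
  shows "(normal has_derivative normal' z) (at z)" "norm (normal' z h) \<le> L1 * norm h"
proof -
  let ?G = "fst (H z)"
  have g: "norm ?G > 0" using fst_H_nonzero[OF z] .
  then have G0: "?G \<noteq> 0" by auto
  have G': "((\<lambda>z. fst (H z)) has_derivative (\<lambda>h. fst (H' z h))) (at z)"
    by (intro derivative_intros H z)
  have "((\<lambda>z. norm (fst (H z))) has_derivative (\<lambda>h. fst (H' z h) \<bullet> sgn ?G)) (at z)"
    using has_derivative_compose[OF G' has_derivative_norm[OF G0]] by (simp add: inner_commute)
  from has_derivative_scaleR[OF Deriv.has_derivative_inverse[OF _ this] G'] g
  have "(normal has_derivative (\<lambda>h. inverse (norm ?G) *\<^sub>R fst (H' z h)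
      + (- (inverse (norm ?G) * (fst (H' z h) \<bullet> sgn ?G) * inverse (norm ?G))) *\<^sub>R ?G)) (at z)"
    by (simp add: normal_def[abs_def])
  moreover have "inverse (norm ?G) * (k \<bullet> sgn ?G) * inverse (norm ?G) = (?G \<bullet> k) / norm ?G ^ 3" for k
    using g by (simp add: sgn_div_norm inner_commute field_simps power3_eq_cube)
  ultimately show "(normal has_derivative normal' z) (at z)"
    by (simp add: normal'_def[abs_def])
  have "norm (((?G \<bullet> k) / norm ?G ^ 3) *\<^sub>R ?G) \<le> norm k / norm ?G" for k
  proof -
    have "norm (((?G \<bullet> k) / norm ?G ^ 3) *\<^sub>R ?G) = \<bar>?G \<bullet> k\<bar> / norm ?G ^ 2"
      using g by (simp add: field_simps power3_eq_cube power2_eq_square)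
    also have "\<dots> \<le> (norm ?G * norm k) / norm ?G ^ 2"
      by (intro divide_right_mono Cauchy_Schwarz_ineq2) auto
    also have "\<dots> = norm k / norm ?G" using g by (simp add: power2_eq_square)
    finally show ?thesis .
  qed
  from this[of "fst (H' z h)"]
  have "norm (normal' z h) \<le> norm (fst (H' z h)) / norm ?G + norm (fst (H' z h)) / norm ?G"
    unfolding normal'_def
    by (intro order_trans[OF norm_triangle_ineq4] add_mono) (simp_all add: divide_inverse mult.commute)
  also have "\<dots> = 2 * norm (fst (H' z h)) / norm ?G" by simp
  also have "\<dots> \<le> 2 * (L * norm h) / \<gamma>"
    using order_trans[OF norm_fst_snd_le(1) H'[OF z, of h]] G[OF z] pos
    by (intro frac_le mult_left_mono mult_nonneg_nonneg) auto
  finally show "norm (normal' z h) \<le> L1 * norm h" by (simp add: L1_def)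
qed

lemma normal_lipschitz: "z \<in> Q \<Longrightarrow> w \<in> Q \<Longrightarrow> norm (normal z - normal w) \<le> L1 * norm (z - w)"
  by (rule differentiable_bound[OF convex_cball has_derivative_at_withinI[OF normal_derivative(1)]
        onorm_bound[OF less_imp_le[OF L1] normal_derivative(2)]])

lemma taylor: "z \<in> Q \<Longrightarrow> w \<in> Q \<Longrightarrow> \<bar>\<phi> w - \<phi> z - H z \<bullet> (w - z)\<bar> \<le> L * (norm (w - z))\<^sup>2"
  by (rule quadratic_taylor_bound[of Q]) (auto intro: \<phi> H_lipschitz less_imp_le[OF pos(2)])

lemma inner_H: "z \<in> Q \<Longrightarrow> H z \<bullet> (v, s) = norm (fst (H z)) * (normal z \<bullet> v) + snd (H z) * s"
  using fst_H_nonzero[of z] by (simp add: normal_def inner_prod_def)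

definition B where "B = norm (H (x0, t0)) + L * r"

lemma H_bound: assumes "z \<in> Q" shows "norm (H z) \<le> B"
proof -
  have "norm (H z) \<le> norm (H (x0, t0)) + norm (H z - H (x0, t0))"
    using norm_triangle_sub by blast
  also have "norm (H z - H (x0, t0)) \<le> L * norm (z - (x0, t0))"
    using assms pos by (intro H_lipschitz) auto
  also have "\<dots> \<le> L * r" using assms pos by (intro mult_left_mono) (auto simp: dist_norm norm_minus_commute)
  finally show ?thesis by (simp add: B_def)
qed

lemma B: "B > 0" using pos by (simp add: B_def add_nonneg_pos)

text \<open>\<open>C\<close> bounds the speed of the interface on time scales below \<open>\<eta>\<close>.\<close>

definition C where "C = (B + 1) / \<gamma>"
definition \<eta> where "\<eta> = min (r / (2 * (C + 1))) (1 / (2 * L * (C + 1)\<^sup>2))"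

lemma C: "C > 0" using B pos by (simp add: C_def)

lemma \<eta>: "\<eta> > 0" using C pos by (auto simp: \<eta>_def intro!: divide_pos_pos mult_pos_pos add_pos_pos)

text \<open>During a time \<sigma> the change of \<phi> in time and the quadratic Taylor error
  together stay below (B + 1) \<sigma>, while a displacement by C \<sigma> along the normal changes
  \<phi> by at least that amount. So \<phi> has opposite signs at the two displaced points, and the
  segment joining them meets the interface.\<close>

lemma frontier_speed:
  assumes z: "(x, t) \<in> cball (x0, t0) (r / 2)" and t: "t \<in> {0..T}" and s: "s \<in> {0..T}" "\<bar>s - t\<bar> \<le> \<eta>"
    and x: "x \<in> frontier (\<Omega> t)"
  shows "infdist x (frontier (\<Omega> s)) \<le> C * \<bar>s - t\<bar>"
proof (cases "s = t")
  case True
  then show ?thesis using x by simp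
next
  case False
  define \<sigma> where "\<sigma> = \<bar>s - t\<bar>"
  have \<sigma>: "\<sigma> > 0" "\<sigma> \<le> \<eta>" using False s by (auto simp: \<sigma>_def)
  have zQ: "(x, t) \<in> Q" using z pos by auto
  have \<phi>0: "\<phi> (x, t) = 0" using fron[OF zQ t] x by simp
  define y where "y = (\<lambda>a. x + (a * C * \<sigma>) *\<^sub>R normal (x, t))"
  have d1: "norm (y a - x, s - t) \<le> (C + 1) * \<sigma>" if "\<bar>a\<bar> = 1" for a
    using norm_Pair_le_add[of "y a - x" "s - t"] norm_normal[OF zQ] that C \<sigma>
    by (simp add: y_def \<sigma>_def abs_mult algebra_simps)
  have "(C + 1) * \<sigma> \<le> (C + 1) * (r / (2 * (C + 1)))"
    using \<sigma> C by (intro mult_left_mono) (auto simp: \<eta>_def)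
  also have "\<dots> = r / 2" using C by (simp add: field_simps)
  finally have Cs: "(C + 1) * \<sigma> \<le> r / 2" .
  have yQ: "(y a, s) \<in> Q" if "\<bar>a\<bar> = 1" for a
  proof -
    have "dist (x0, t0) (y a, s) \<le> dist (x0, t0) (x, t) + dist (x, t) (y a, s)" by (rule dist_triangle)
    also have "dist (x, t) (y a, s) = norm (y a - x, s - t)"
      by (metis dist_commute dist_norm diff_Pair)
    also have "\<dots> \<le> r / 2" using d1[OF that] Cs by simp
    finally show ?thesis using z by simp
  qed
  have main: "\<bar>\<phi> (y a, s) - norm (fst (H (x, t))) * (a * C * \<sigma>)\<bar> < (B + 1) * \<sigma>" if a: "\<bar>a\<bar> = 1" for a
  proof -
    have "\<bar>\<phi> (y a, s) - \<phi> (x, t) - H (x, t) \<bullet> ((y a, s) - (x, t))\<bar> \<le> L * (norm ((y a, s) - (x, t)))\<^sup>2"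
      by (rule taylor[OF zQ yQ[OF a]])
    also have "\<dots> \<le> L * ((C + 1) * \<sigma>)\<^sup>2"
      using d1[OF a] pos by (intro mult_left_mono power_mono) auto
    also have "\<dots> = (L * (C + 1)\<^sup>2 * \<sigma>) * \<sigma>" by (simp add: power2_eq_square algebra_simps)
    also have "\<dots> \<le> (1 / 2) * \<sigma>"
    proof (rule mult_right_mono)
      have "L * (C + 1)\<^sup>2 * \<sigma> \<le> L * (C + 1)\<^sup>2 * (1 / (2 * L * (C + 1)\<^sup>2))"
        using \<sigma> pos by (intro mult_left_mono) (auto simp: \<eta>_def)
      also have "\<dots> = 1 / 2" using pos C by (simp add: field_simps)
      finally show "L * (C + 1)\<^sup>2 * \<sigma> \<le> 1 / 2" .
    qed (use \<sigma> in auto)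
    finally have 1: "\<bar>\<phi> (y a, s) - H (x, t) \<bullet> ((y a, s) - (x, t))\<bar> \<le> \<sigma> / 2" using \<phi>0 by simp
    have "normal (x, t) \<bullet> normal (x, t) = 1"
      using norm_normal[OF zQ] by (simp add: norm_eq_1)
    then have 2: "H (x, t) \<bullet> ((y a, s) - (x, t)) = norm (fst (H (x, t))) * (a * C * \<sigma>) + snd (H (x, t)) * (s - t)"
      using inner_H[OF zQ, of "y a - x" "s - t"] by (simp add: y_def)
    have 3: "\<bar>snd (H (x, t)) * (s - t)\<bar> \<le> B * \<sigma>"
      unfolding abs_mult \<sigma>_def using order_trans[OF norm_fst_snd_le(2) H_bound[OF zQ]]
      by (intro mult_right_mono) auto
    show ?thesis using 1[unfolded 2] 3 \<sigma>(1) unfolding distrib_right mult_1 by linarith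
  qed
  have "\<gamma> * (C * \<sigma>) \<le> norm (fst (H (x, t))) * (C * \<sigma>)"
    using G[OF zQ] C \<sigma> by (intro mult_right_mono) auto
  moreover have "\<gamma> * (C * \<sigma>) = (B + 1) * \<sigma>" using pos by (simp add: C_def)
  ultimately have "\<phi> (y 1, s) > 0" "\<phi> (y (- 1), s) < 0"
    using main[of 1] main[of "-1"] by (auto simp: abs_less_iff algebra_simps)
  then have "y 1 \<in> \<Omega> s" "y (- 1) \<notin> \<Omega> s"
    using mem[OF yQ s(1), of 1] mem[OF yQ s(1), of "-1"] by auto
  then obtain p where p: "p \<in> frontier (\<Omega> s)" "p \<in> closed_segment (y 1) (y (- 1))"
    using segment_meets_frontier by blast
  have "closed_segment (y 1) (y (- 1)) \<subseteq> cball x (C * \<sigma>)"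
    by (rule closed_segment_subset)
      (use norm_normal[OF zQ] C \<sigma> in \<open>auto simp: y_def dist_norm\<close>)
  then have "dist x p \<le> C * \<sigma>" using p(2) by auto
  then show ?thesis using infdist_le[OF p(1), of x] by (simp add: \<sigma>_def)
qed

text \<open>Within this radius time differences stay below \<eta>, foot points stay in the chart,
  and |d| L1 \<le> 1/4, the smallness behind all later absorptions. The factor C + 3 bounds the
  displacement 2 |x - x0| + C |t - t0| of a foot point plus |t - t0|.\<close>

definition \<rho> where "\<rho> = min (min (\<eta> / 2) (r / (4 * (C + 3)))) (1 / (4 * L1 * (C + 3)))"

lemma \<rho>: "\<rho> > 0" "2 * \<rho> \<le> \<eta>" "(C + 3) * \<rho> \<le> r / 4" "(C + 3) * \<rho> * L1 \<le> 1 / 4"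
proof -
  show "\<rho> > 0" using \<eta> pos C L1 by (auto simp: \<rho>_def intro!: divide_pos_pos mult_pos_pos add_pos_pos)
  have "\<rho> \<le> \<eta> / 2" unfolding \<rho>_def by linarith
  then show "2 * \<rho> \<le> \<eta>" by simp
  have "(C + 3) * \<rho> \<le> (C + 3) * (r / (4 * (C + 3)))"
    using C by (intro mult_left_mono) (auto simp: \<rho>_def)
  also have "\<dots> = r / 4" using C by (simp add: field_simps)
  finally show "(C + 3) * \<rho> \<le> r / 4" .
  have "(C + 3) * L1 * \<rho> \<le> (C + 3) * L1 * (1 / (4 * L1 * (C + 3)))"
    using C L1 by (intro mult_left_mono) (auto simp: \<rho>_def)
  also have "\<dots> = 1 / 4" using C L1 by (simp add: divide_simps)
  finally show "(C + 3) * \<rho> * L1 \<le> 1 / 4" by (simp add: mult.assoc mult.commute[of L1])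
qed

section \<open>Nearest points and the expansion of the signed distance\<close>

definition near :: "real^'n \<Rightarrow> real \<Rightarrow> bool"
  where "near x t \<longleftrightarrow> norm (x - x0) \<le> \<rho> \<and> \<bar>t - t0\<bar> \<le> \<rho> \<and> t \<in> {0..T}"

text \<open>An arbitrary nearest point: uniqueness is not known at this stage. That the choice is
  Lipschitz is derived from the decomposition of x along the normal.\<close>

definition foot :: "real^'n \<Rightarrow> real \<Rightarrow> real^'n"
  where "foot x t = (SOME p. p \<in> frontier (\<Omega> t) \<and> infdist x (frontier (\<Omega> t)) = dist x p)"

definition nu where "nu x t = normal (foot x t, t)"

lemma foot: assumes "t \<in> {0..T}" shows "foot x t \<in> frontier (\<Omega> t)" "\<bar>d x t\<bar> = dist x (foot x t)"
proof -
  have "\<exists>p. p \<in> frontier (\<Omega> t) \<and> infdist x (frontier (\<Omega> t)) = dist x p"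
    using infdist_attains_inf[OF frontier_closed nonempty[OF assms], of x] by blast
  from someI_ex[OF this] show "foot x t \<in> frontier (\<Omega> t)" "\<bar>d x t\<bar> = dist x (foot x t)"
    by (auto simp: foot_def abs_signed_dist)
qed

lemma near_Q: assumes "near x t" shows "(x, t) \<in> cball (x0, t0) (r / 2)"
proof -
  have "norm (x - x0) + \<bar>t - t0\<bar> \<le> 2 * \<rho>" using assms by (simp add: near_def)
  also have "\<dots> \<le> (C + 3) * \<rho>" using C \<rho>(1) by (intro mult_right_mono) auto
  finally show ?thesis
    using \<rho>(3) dist_center_le[of x t] pos by simp
qed

lemma center_speed: "s \<in> {0..T} \<Longrightarrow> \<bar>s - t0\<bar> \<le> \<eta> \<Longrightarrow> \<bar>d x0 s\<bar> \<le> C * \<bar>s - t0\<bar>"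
  using frontier_speed[of x0 t0 s] t0 x0 pos by (simp add: abs_signed_dist)

lemma near_foot:
  assumes n: "near x t"
  shows "\<bar>d x t\<bar> \<le> norm (x - x0) + C * \<bar>t - t0\<bar>"
    and "\<bar>d x t\<bar> * L1 \<le> 1 / 4"
    and "norm (foot x t - x0) \<le> 2 * norm (x - x0) + C * \<bar>t - t0\<bar>"
    and "(foot x t, t) \<in> cball (x0, t0) (r / 2)" "(foot x t, t) \<in> Q"
    and "norm (foot x t - x0) + \<bar>t - t0\<bar> \<le> (C + 3) * \<rho>"
proof -
  have t: "t \<in> {0..T}" "\<bar>t - t0\<bar> \<le> \<rho>" "norm (x - x0) \<le> \<rho>" using n by (auto simp: near_def)
  have "\<bar>d x t\<bar> \<le> \<bar>d x0 t\<bar> + dist x x0"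
    using signed_dist_lipschitz[of "\<Omega> t" x x0] by linarith
  then show 1: "\<bar>d x t\<bar> \<le> norm (x - x0) + C * \<bar>t - t0\<bar>"
    using center_speed[OF t(1)] t(2) \<rho>(1,2) by (simp add: dist_norm)
  have "C * \<bar>t - t0\<bar> \<le> C * \<rho>" using t C by (intro mult_left_mono) auto
  then have "\<bar>d x t\<bar> \<le> (C + 3) * \<rho>" using 1 t \<rho>(1) by (simp add: algebra_simps)
  then have "\<bar>d x t\<bar> * L1 \<le> (C + 3) * \<rho> * L1" using L1 by (intro mult_right_mono) auto
  then show "\<bar>d x t\<bar> * L1 \<le> 1 / 4" using \<rho>(4) by simp
  have "norm (foot x t - x0) \<le> dist x (foot x t) + norm (x - x0)"
    using dist_triangle[of "foot x t" x0 x] by (simp add: dist_norm norm_minus_commute)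
  then show 2: "norm (foot x t - x0) \<le> 2 * norm (x - x0) + C * \<bar>t - t0\<bar>"
    using foot(2)[OF t(1), of x] 1 by simp
  then show 3: "norm (foot x t - x0) + \<bar>t - t0\<bar> \<le> (C + 3) * \<rho>"
    using t \<open>C * \<bar>t - t0\<bar> \<le> C * \<rho>\<close> by (simp add: algebra_simps)
  show "(foot x t, t) \<in> cball (x0, t0) (r / 2)"
    using dist_center_le[of "foot x t" t] 3 \<rho>(3) pos by simp
  then show "(foot x t, t) \<in> Q" using pos by auto
qed

text \<open>The ball around \<open>x\<close> that touches the interface at its foot point lies on one side, so
  \<open>\<phi>\<close> has a one-sided extremum over that ball at the foot point.\<close>

lemma foot_decomposition:
  assumes n: "near x t"
  shows "x = foot x t + d x t *\<^sub>R nu x t"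
proof (cases "d x t = 0")
  case True
  then show ?thesis using foot(2)[of t x] n by (simp add: near_def)
next
  case False
  have t: "t \<in> {0..T}" using n by (auto simp: near_def)
  define p where "p = foot x t"
  have pQ: "(p, t) \<in> Q" "(p, t) \<in> cball (x0, t0) (r / 2)" using near_foot[OF n] by (auto simp: p_def)
  have dp: "\<bar>d x t\<bar> = dist x p" using foot(2)[OF t] by (simp add: p_def)
  have \<phi>p: "\<phi> (p, t) = 0" using fron[OF pQ(1) t] foot(1)[OF t] by (simp add: p_def)
  define \<sigma> where "\<sigma> = sgn (d x t)"
  have \<sigma>: "\<bar>\<sigma>\<bar> = 1" "d x t = \<sigma> * dist x p" using False by (simp_all add: \<sigma>_def abs_sgn_eq dp[symmetric] sgn_mult_abs)
  \<comment> \<open>The open ball around x through p contains no interface point; being connected it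
    lies on the side of x, so \<phi> has the sign of d there.\<close>
  have side: "\<sigma> * \<phi> (y, t) > 0" if y: "y \<in> ball x (dist x p)" "(y, t) \<in> Q" for y
  proof -
    have no: "ball x (dist x p) \<inter> frontier (\<Omega> t) = {}"
      using infdist_le[of _ "frontier (\<Omega> t)" x] dp by (force simp: abs_signed_dist)
    have x: "x \<in> ball x (dist x p)" using False dp by auto
    have iff: "y \<in> \<Omega> t \<longleftrightarrow> x \<in> \<Omega> t"
    proof (rule ccontr)
      assume ne: "\<not> ?thesis"
      have "ball x (dist x p) \<inter> frontier (\<Omega> t) \<noteq> {}"
        by (intro connected_Int_frontier connected_ball) (use x y(1) ne in blast)+
      then show False using no by simp
    qed
    have "\<phi> (y, t) \<noteq> 0" using fron[OF y(2) t] no y(1) by auto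
    then show ?thesis
      using iff mem[OF y(2) t] open_pos_iff_mem[OF open_\<Omega>[OF t] nonempty[OF t], of x] False
      by (cases "d x t > 0") (auto simp: \<sigma>_def)
  qed
  have xp: "dist x p > 0" using False dp by auto
  \<comment> \<open>A direction entering the ball cannot decrease \<sigma> \<phi>, which vanishes at
    p. Only the normal direction is then left for x - p.\<close>
  have grad: "\<sigma> * (normal (p, t) \<bullet> v) \<ge> 0" if v: "v \<bullet> (x - p) > 0" for v
  proof (rule ccontr)
    assume neg: "\<not> ?thesis"
    have "((\<lambda>h. \<sigma> * \<phi> (p + h *\<^sub>R v, t)) has_derivative (\<lambda>k. \<sigma> * (H (p, t) \<bullet> (k *\<^sub>R v, 0)))) (at 0)"
    proof -
      have "((\<lambda>h. p + h *\<^sub>R v) has_derivative (\<lambda>k. k *\<^sub>R v)) (at 0)"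
        by (auto intro!: derivative_eq_intros)
      from has_derivative_Pair[OF this has_derivative_const[of t]]
      have line: "((\<lambda>h. (p + h *\<^sub>R v, t)) has_derivative (\<lambda>k. (k *\<^sub>R v, 0))) (at 0)" .
      have "(\<phi> has_derivative (\<lambda>h. H (p, t) \<bullet> h)) (at (p + 0 *\<^sub>R v, t))" using \<phi>[OF pQ(1)] by simp
      from has_derivative_mult_right[OF has_derivative_compose[OF line this]] show ?thesis .
    qed
    moreover have "(\<lambda>k. \<sigma> * (H (p, t) \<bullet> (k *\<^sub>R v, 0)))
        = (*) (norm (fst (H (p, t))) * (\<sigma> * (normal (p, t) \<bullet> v)))"
      by (simp add: fun_eq_iff inner_H[OF pQ(1)])
    ultimately have "((\<lambda>h. \<sigma> * \<phi> (p + h *\<^sub>R v, t)) has_real_derivative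
        norm (fst (H (p, t))) * (\<sigma> * (normal (p, t) \<bullet> v))) (at 0)"
      by (simp add: has_field_derivative_def)
    from DERIV_neg_dec_right[OF this] neg
    obtain e where e: "e > 0" "\<And>h. 0 < h \<Longrightarrow> h < e \<Longrightarrow> \<sigma> * \<phi> (p + h *\<^sub>R v, t) < 0"
      using fst_H_nonzero[OF pQ(1)] \<phi>p by (auto simp: mult_pos_neg not_le)
    have v0: "v \<noteq> 0" using v by auto
    \<comment> \<open>Small enough, in this order, for the sign of the derivative to show, for the
      point to lie in the ball, and for it to stay in the chart.\<close>
    define h where "h = min (e / 2) (min (v \<bullet> (x - p) / (norm v)\<^sup>2) (r / (2 * norm v)))"
    have h: "h > 0" "h \<le> e / 2" "h \<le> v \<bullet> (x - p) / (norm v)\<^sup>2" "h \<le> r / (2 * norm v)"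
      using e v v0 pos unfolding h_def
      by (simp_all only: min.cobounded1 min.coboundedI2[OF min.cobounded1] min.coboundedI2[OF min.cobounded2])
        (simp add: min_less_iff_conj)
    have "(p + h *\<^sub>R v, t) \<in> Q"
    proof -
      have "dist (x0, t0) (p + h *\<^sub>R v, t) \<le> dist (x0, t0) (p, t) + dist (p, t) (p + h *\<^sub>R v, t)"
        by (rule dist_triangle)
      also have "dist (p, t) (p + h *\<^sub>R v, t) = h * norm v"
        using h by (simp add: dist_Pair_Pair dist_norm)
      also have "\<dots> \<le> r / 2" using h(4) v0 by (simp add: field_simps)
      finally show ?thesis using pQ(2) by simp
    qed
    moreover have "p + h *\<^sub>R v \<in> ball x (dist x p)"
    proof -
      have "h * (norm v)\<^sup>2 \<le> v \<bullet> (x - p)" using h(3) v0 by (simp add: field_simps)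
      then have "h * (h * (norm v)\<^sup>2) \<le> h * (v \<bullet> (x - p))" using h(1) by (intro mult_left_mono) auto
      moreover have "h * (v \<bullet> (x - p)) > 0" using h v by simp
      moreover have "(norm (x - (p + h *\<^sub>R v)))\<^sup>2 = (norm (x - p))\<^sup>2 - 2 * (h * (v \<bullet> (x - p))) + h * (h * (norm v)\<^sup>2)"
        by (simp add: power2_norm_eq_inner algebra_simps inner_commute)
      ultimately have "(norm (x - (p + h *\<^sub>R v)))\<^sup>2 < (norm (x - p))\<^sup>2" by linarith
      then have "norm (x - (p + h *\<^sub>R v)) < norm (x - p)" by (rule power_less_imp_less_base) simp
      then show ?thesis by (simp add: dist_norm)
    qed
    ultimately have "\<sigma> * \<phi> (p + h *\<^sub>R v, t) > 0" using side by blast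
    then show False using e(2)[of h] h e(1) by auto
  qed
  have "(x - p) /\<^sub>R dist x p = \<sigma> *\<^sub>R normal (p, t)"
  proof (rule unit_vector_eqI)
    show "norm ((x - p) /\<^sub>R dist x p) = 1" using xp by (simp add: dist_norm)
    show "norm (\<sigma> *\<^sub>R normal (p, t)) = 1" using \<sigma>(1) norm_normal[OF pQ(1)] by simp
    show "(\<sigma> *\<^sub>R normal (p, t)) \<bullet> v \<ge> 0" if "v \<bullet> ((x - p) /\<^sub>R dist x p) > 0" for v
      using grad[of v] that xp by (simp add: zero_less_mult_iff)
  qed
  then have "dist x p *\<^sub>R ((x - p) /\<^sub>R dist x p) = d x t *\<^sub>R normal (p, t)"
    by (simp add: \<sigma>(2) mult.commute)
  then have "x - p = d x t *\<^sub>R normal (p, t)" using xp by simp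
  then show ?thesis by (simp add: nu_def p_def algebra_simps)
qed

text \<open>When the signs agree this is the speed bound at a foot point. When d changes sign,
  \<phi> vanishes at x at some intermediate time, and both distances are estimated from the moment
  at which x lies on the interface.\<close>

lemma time_lipschitz:
  assumes n: "near x t" "near x s"
  shows "\<bar>d x t - d x s\<bar> \<le> C * \<bar>t - s\<bar>"
proof -
  have uns: "\<bar>d x s\<bar> \<le> \<bar>d x t\<bar> + C * \<bar>t - s\<bar>" if "near x t" "near x s" for t s
  proof -
    have ts: "t \<in> {0..T}" "s \<in> {0..T}" "\<bar>s - t\<bar> \<le> \<eta>" using that \<rho>(2) by (auto simp: near_def)
    have "\<bar>d x s\<bar> \<le> infdist (foot x t) (frontier (\<Omega> s)) + dist x (foot x t)"
      using infdist_triangle[of x "frontier (\<Omega> s)" "foot x t"] by (simp add: abs_signed_dist)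
    then show ?thesis
      using frontier_speed[OF near_foot(4)[OF that(1)] ts foot(1)[OF ts(1)]] foot(2)[OF ts(1), of x]
      by (simp add: abs_minus_commute)
  qed
  have cross: "d x t - d x s \<le> C * \<bar>t - s\<bar>" if n: "near x t" "near x s" "d x t > 0" "d x s \<le> 0" for t s
  proof -
    define g where "g = (\<lambda>\<sigma>. \<phi> (x, \<sigma>))"
    have near\<sigma>: "near x \<sigma>" if "\<sigma> \<in> closed_segment t s" for \<sigma>
      using that n(1,2) by (auto simp: near_def closed_segment_eq_real_ivl split: if_splits)
    have Q\<sigma>: "(x, \<sigma>) \<in> Q" if "\<sigma> \<in> closed_segment t s" for \<sigma>
      using near_Q[OF near\<sigma>[OF that]] pos by auto
    have ts: "t \<in> {0..T}" "s \<in> {0..T}" using n by (auto simp: near_def)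
    have "continuous_on Q \<phi>"
      by (meson \<phi> continuous_at_imp_continuous_on has_derivative_continuous)
    then have "continuous_on (closed_segment t s) g"
      unfolding g_def by (rule continuous_on_compose2) (use Q\<sigma> in \<open>auto intro!: continuous_intros simp del: mem_cball\<close>)
    then have conn: "connected (g ` closed_segment t s)"
      by (rule connected_continuous_image) simp
    have "g t > 0" "g s \<le> 0"
      using mem[OF Q\<sigma> ts(1)] mem[OF Q\<sigma> ts(2)] n open_pos_iff_mem[OF open_\<Omega> nonempty] ts
      by (auto simp: g_def not_less[symmetric])
    then have "0 \<in> g ` closed_segment t s"
      using connected_contains_Icc[OF conn, of "g s" "g t"] by auto
    then obtain \<sigma> where \<sigma>: "\<sigma> \<in> closed_segment t s" "\<phi> (x, \<sigma>) = 0" by (auto simp: g_def)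
    have \<sigma>T: "\<sigma> \<in> {0..T}" using near\<sigma>[OF \<sigma>(1)] by (simp add: near_def)
    have x\<sigma>: "x \<in> frontier (\<Omega> \<sigma>)" using fron[OF Q\<sigma>[OF \<sigma>(1)] \<sigma>T] \<sigma>(2) by simp
    have *: "\<bar>d x \<tau>\<bar> \<le> C * \<bar>\<tau> - \<sigma>\<bar>" if "near x \<tau>" for \<tau>
      using frontier_speed[OF near_Q[OF near\<sigma>[OF \<sigma>(1)]] \<sigma>T _ _ x\<sigma>, of \<tau>] that near\<sigma>[OF \<sigma>(1)] \<rho>(2)
      by (auto simp: near_def abs_signed_dist)
    have "d x t - d x s \<le> C * (\<bar>t - \<sigma>\<bar> + \<bar>s - \<sigma>\<bar>)"
      using *[OF n(1)] *[OF n(2)] by (simp add: distrib_left)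
    also have "\<bar>t - \<sigma>\<bar> + \<bar>s - \<sigma>\<bar> = \<bar>t - s\<bar>"
      using \<sigma>(1) by (auto simp: closed_segment_eq_real_ivl split: if_splits)
    finally show ?thesis .
  qed
  show ?thesis
    using uns[OF n] uns[OF n(2,1)] cross[OF n] cross[OF n(2,1)]
    by (cases "d x t > 0"; cases "d x s > 0") (auto simp: abs_minus_commute[of s t])
qed

text \<open>Subtracting the two decompositions expresses q - p through itself, by way of the change
  of the normal. The coefficient is |d| L1 \<le> 1/4, so that term is absorbed on the left.\<close>

lemma foot_lipschitz:
  assumes n: "near x t" "near y s"
  shows "norm (foot y s - foot x t) \<le> (2 * C + 3) * (norm (y - x) + \<bar>s - t\<bar>)"
    and "norm (nu y s - nu x t) \<le> L1 * (2 * C + 4) * (norm (y - x) + \<bar>s - t\<bar>)"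
proof -
  define p q where "p = foot x t" and "q = foot y s"
  have "near x s" using n by (auto simp: near_def)
  then have dd: "\<bar>d y s - d x t\<bar> \<le> norm (y - x) + C * \<bar>s - t\<bar>"
    using time_lipschitz[of x s t] n(1) signed_dist_lipschitz[of "\<Omega> s" y x] by (auto simp: dist_norm)
  have nn: "norm (nu y s - nu x t) \<le> L1 * (norm (q - p) + \<bar>s - t\<bar>)"
  proof -
    have "norm (nu y s - nu x t) \<le> L1 * norm ((q, s) - (p, t))"
      unfolding nu_def p_def q_def by (intro normal_lipschitz near_foot(5) n)
    also have "\<dots> \<le> L1 * (norm (q - p) + \<bar>s - t\<bar>)"
      using norm_Pair_le_add[of "q - p" "s - t"] L1 by (intro mult_left_mono) auto
    finally show ?thesis .
  qed
  have tri: "norm (u - v - w) \<le> norm u + norm v + norm w" for u v w :: "real^'n"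
    using norm_triangle_ineq4[of "u - v" w] norm_triangle_ineq4[of u v] by linarith
  have "q - p = (y - x) - (d y s - d x t) *\<^sub>R nu x t - d y s *\<^sub>R (nu y s - nu x t)"
    using foot_decomposition[OF n(1)] foot_decomposition[OF n(2)]
    unfolding p_def q_def by (simp add: algebra_simps)
  then have "norm (q - p) \<le> norm (y - x) + norm ((d y s - d x t) *\<^sub>R nu x t) + norm (d y s *\<^sub>R (nu y s - nu x t))"
    by (simp only: tri)
  also have "norm ((d y s - d x t) *\<^sub>R nu x t) = \<bar>d y s - d x t\<bar>"
    using norm_normal[OF near_foot(5)[OF n(1)]] by (simp add: nu_def)
  also have "norm (d y s *\<^sub>R (nu y s - nu x t)) \<le> \<bar>d y s\<bar> * (L1 * (norm (q - p) + \<bar>s - t\<bar>))"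
    using nn by (simp add: mult_left_mono)
  also have "\<dots> = (\<bar>d y s\<bar> * L1) * (norm (q - p) + \<bar>s - t\<bar>)" by simp
  also have "\<dots> \<le> 1 / 4 * (norm (q - p) + \<bar>s - t\<bar>)"
    using near_foot(2)[OF n(2)] by (intro mult_right_mono) auto
  finally have 1: "3 * norm (q - p) \<le> 8 * norm (y - x) + (4 * C + 1) * \<bar>s - t\<bar>"
    using dd by (simp add: algebra_simps)
  have aux: "X \<le> (2 * C + 3) * (a + b)" if "3 * X \<le> 8 * a + (4 * C + 1) * b" "0 \<le> a" "0 \<le> b" for X a b
  proof -
    have "0 \<le> C * a" "0 \<le> C * b" using C that by auto
    then show ?thesis using that by (simp add: algebra_simps)
  qed
  show 2: "norm (foot y s - foot x t) \<le> (2 * C + 3) * (norm (y - x) + \<bar>s - t\<bar>)"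
    using aux[OF 1 norm_ge_zero abs_ge_zero] unfolding p_def q_def by simp
  have "(2 * C + 4) * (norm (y - x) + \<bar>s - t\<bar>) = (2 * C + 3) * (norm (y - x) + \<bar>s - t\<bar>) + (norm (y - x) + \<bar>s - t\<bar>)"
    by (simp add: algebra_simps)
  then have "norm (q - p) + \<bar>s - t\<bar> \<le> (2 * C + 4) * (norm (y - x) + \<bar>s - t\<bar>)"
    using 2 norm_ge_zero[of "y - x"] unfolding p_def q_def by linarith
  then have "L1 * (norm (q - p) + \<bar>s - t\<bar>) \<le> L1 * ((2 * C + 4) * (norm (y - x) + \<bar>s - t\<bar>))"
    using L1 by (intro mult_left_mono) auto
  then show "norm (nu y s - nu x t) \<le> L1 * (2 * C + 4) * (norm (y - x) + \<bar>s - t\<bar>)"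
    using nn by simp
qed

text \<open>The time derivative of a signed distance to a moving level set, namely the time
  derivative of \<phi> over the length of its spatial gradient, taken at the foot point.\<close>

definition speed where "speed x t = snd (H (foot x t, t)) / norm (fst (H (foot x t, t)))"

text \<open>The first summand is the Taylor error of \<phi> between two of its zeros, the second the
  turning of the normal. The 1/8 combines |d| L1 \<le> 1/4 with the 1/2 in the formula for the inner
  product of two unit vectors.\<close>

definition K4 where "K4 = L * (2 * C + 4)\<^sup>2 / \<gamma> + L1 * (2 * C + 4)\<^sup>2 / 8"

lemma norm_nu: "near x t \<Longrightarrow> norm (nu x t) = 1"
  unfolding nu_def by (rule norm_normal[OF near_foot(5)])

text \<open>Project \<open>y - x = (q - p) + d y * n q - d x * n p\<close> onto \<open>n p\<close>, where \<open>p\<close>, \<open>q\<close> are the foot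
  points. Since \<open>p\<close> and \<open>q\<close> are zeros of \<open>\<phi>\<close>, the component of \<open>q - p\<close> is known up to a quadratic error,
  and \<open>n q \<bullet> n p = 1 - (norm (n q - n p))\<^sup>2 / 2\<close>.\<close>

lemma signed_dist_expansion:
  assumes n: "near x t" "near y s"
  shows "\<bar>d y s - d x t - nu x t \<bullet> (y - x) - speed x t * (s - t)\<bar> \<le> K4 * (norm (y - x) + \<bar>s - t\<bar>)\<^sup>2"
proof -
  define p q where "p = foot x t" and "q = foot y s"
  define D where "D = norm (y - x) + \<bar>s - t\<bar>"
  have D: "D \<ge> 0" by (simp add: D_def)
  have pQ: "(p, t) \<in> Q" "(q, s) \<in> Q" using near_foot(5) n by (auto simp: p_def q_def)
  have ts: "t \<in> {0..T}" "s \<in> {0..T}" using n by (auto simp: near_def)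
  have zero: "\<phi> (p, t) = 0" "\<phi> (q, s) = 0"
    using fron[OF pQ(1) ts(1)] fron[OF pQ(2) ts(2)] foot(1) ts by (auto simp: p_def q_def)
  define g where "g = norm (fst (H (p, t)))"
  have g: "g \<ge> \<gamma>" "g > 0" using G[OF pQ(1)] pos by (auto simp: g_def)
  have "norm ((q, s) - (p, t)) \<le> norm (q - p) + \<bar>s - t\<bar>"
    using norm_Pair_le_add[of "q - p" "s - t"] by simp
  also have "\<dots> \<le> (2 * C + 3) * D + D"
    using foot_lipschitz(1)[OF n] by (intro add_mono) (auto simp: p_def q_def D_def)
  finally have qp: "norm ((q, s) - (p, t)) \<le> (2 * C + 4) * D" by (simp add: algebra_simps)
  have "\<bar>H (p, t) \<bullet> ((q, s) - (p, t))\<bar> \<le> L * (norm ((q, s) - (p, t)))\<^sup>2"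
    using taylor[OF pQ] zero by simp
  also have "\<dots> \<le> L * ((2 * C + 4) * D)\<^sup>2"
    using qp pos by (intro mult_left_mono power_mono) auto
  finally have "\<bar>g * (nu x t \<bullet> (q - p)) + snd (H (p, t)) * (s - t)\<bar> \<le> L * ((2 * C + 4) * D)\<^sup>2"
    using inner_H[OF pQ(1), of "q - p" "s - t"] by (simp add: nu_def p_def g_def)
  then have "\<bar>g * (nu x t \<bullet> (q - p)) + snd (H (p, t)) * (s - t)\<bar> / g \<le> L * ((2 * C + 4) * D)\<^sup>2 / \<gamma>"
    using g pos by (intro frac_le) auto
  moreover have "\<bar>b\<bar> / g = \<bar>b / g\<bar>" for b using g by simp
  ultimately have "\<bar>(g * (nu x t \<bullet> (q - p)) + snd (H (p, t)) * (s - t)) / g\<bar> \<le> L * ((2 * C + 4) * D)\<^sup>2 / \<gamma>"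
    by (simp only:)
  moreover have "(g * (nu x t \<bullet> (q - p)) + snd (H (p, t)) * (s - t)) / g = nu x t \<bullet> (q - p) + speed x t * (s - t)"
    using g by (simp add: speed_def g_def p_def add_divide_distrib)
  ultimately have 1: "\<bar>nu x t \<bullet> (q - p) + speed x t * (s - t)\<bar> \<le> L * ((2 * C + 4) * D)\<^sup>2 / \<gamma>"
    by (simp only:)
  define a where "a = nu y s \<bullet> nu x t"
  have unit: "nu x t \<bullet> nu x t = 1" "nu y s \<bullet> nu y s = 1"
    using norm_nu n by (auto simp: norm_eq_1)
  have a: "1 - a = (norm (nu y s - nu x t))\<^sup>2 / 2"
    using unit by (simp add: a_def power2_norm_eq_inner inner_diff inner_commute)
  have 2: "\<bar>d y s * (1 - a)\<bar> \<le> L1 * (2 * C + 4)\<^sup>2 / 8 * D\<^sup>2"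
  proof -
    have "(norm (nu y s - nu x t))\<^sup>2 \<le> (L1 * (2 * C + 4) * D)\<^sup>2"
      using foot_lipschitz(2)[OF n] by (intro power_mono) (auto simp: D_def)
    then have "\<bar>d y s * (1 - a)\<bar> \<le> \<bar>d y s\<bar> * ((L1 * (2 * C + 4) * D)\<^sup>2 / 2)"
      unfolding a abs_mult by (intro mult_left_mono) auto
    also have "\<dots> = (\<bar>d y s\<bar> * L1) * (L1 * (2 * C + 4)\<^sup>2 * D\<^sup>2 / 2)"
      by (simp add: power2_eq_square)
    also have "\<dots> \<le> 1 / 4 * (L1 * (2 * C + 4)\<^sup>2 * D\<^sup>2 / 2)"
      using near_foot(2)[OF n(2)] L1 by (intro mult_right_mono) auto
    finally show ?thesis by simp
  qed
  have "y - x = (q - p) + d y s *\<^sub>R nu y s - d x t *\<^sub>R nu x t"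
    using foot_decomposition[OF n(1)] foot_decomposition[OF n(2)]
    unfolding p_def q_def by (simp add: algebra_simps)
  then have "nu x t \<bullet> (y - x) = nu x t \<bullet> (q - p) + d y s * a - d x t"
    using unit by (simp add: inner_add_right inner_diff_right a_def inner_commute)
  then have "d y s - d x t - nu x t \<bullet> (y - x) - speed x t * (s - t)
      = d y s * (1 - a) - (nu x t \<bullet> (q - p) + speed x t * (s - t))"
    by (simp add: algebra_simps)
  also have "\<bar>\<dots>\<bar> \<le> L1 * (2 * C + 4)\<^sup>2 / 8 * D\<^sup>2 + L * ((2 * C + 4) * D)\<^sup>2 / \<gamma>"
    using 1 2 by linarith
  also have "\<dots> = K4 * D\<^sup>2" by (simp add: K4_def power2_eq_square algebra_simps)
  finally show ?thesis by (simp add: D_def)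
qed

text \<open>Read off from the quadratic expansion with time or space frozen: the gradient of d is
  the normal transported from the foot point.\<close>

lemma signed_dist_derivatives:
  assumes x: "norm (x - x0) < \<rho>" and t: "\<bar>t - t0\<bar> < \<rho>" "t \<in> {0..T}"
  shows "GDERIV (\<lambda>y. d y t) x :> nu x t"
    and "((\<lambda>s. d x s) has_real_derivative speed x t) (at t within {0..T})"
proof -
  have n: "near x t" using x t by (simp add: near_def)
  have "\<forall>\<^sub>F y in nhds x. y \<in> ball x0 \<rho>"
    by (rule eventually_nhds_in_open) (use x in \<open>auto simp: dist_norm norm_minus_commute\<close>)
  then have ev: "\<forall>\<^sub>F y in at x. near y t"
    unfolding eventually_at_filter
    by eventually_elim (use t in \<open>auto simp: near_def dist_norm norm_minus_commute\<close>)
  have "((\<lambda>y. d y t) has_derivative (\<lambda>h. h \<bullet> nu x t)) (at x)"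
  proof (rule has_derivative_quadratic[where K = K4])
    show "\<forall>\<^sub>F y in at x. norm (d y t - d x t - (y - x) \<bullet> nu x t) \<le> K4 * (norm (y - x))\<^sup>2"
      using ev by eventually_elim (use signed_dist_expansion[OF n] in \<open>force simp: inner_commute\<close>)
  qed (rule bounded_linear_inner_left)
  then show "GDERIV (\<lambda>y. d y t) x :> nu x t" by (simp add: gderiv_def)
  have "\<forall>\<^sub>F s in nhds t. s \<in> ball t0 \<rho>"
    by (rule eventually_nhds_in_open) (use t in \<open>auto simp: dist_norm abs_minus_commute\<close>)
  then have ev: "\<forall>\<^sub>F s in at t within {0..T}. near x s"
    unfolding eventually_at_filter
    by eventually_elim (use x in \<open>auto simp: near_def dist_norm abs_minus_commute\<close>)
  have "((\<lambda>s. d x s) has_derivative (\<lambda>h. speed x t * h)) (at t within {0..T})"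
  proof (rule has_derivative_quadratic[where K = K4])
    show "\<forall>\<^sub>F s in at t within {0..T}. norm (d x s - d x t - speed x t * (s - t)) \<le> K4 * (norm (s - t))\<^sup>2"
      using ev by eventually_elim (use signed_dist_expansion[OF n] in force)
  qed (rule bounded_linear_mult_right)
  then show "((\<lambda>s. d x s) has_real_derivative speed x t) (at t within {0..T})"
    by (simp add: has_field_derivative_def)
qed

end

section \<open>Uniqueness of derivatives and a volume bound by translation\<close>

lemma gderiv_unique:
  assumes "GDERIV f x :> D" "GDERIV f x :> D'"
  shows "D = D'"
proof -
  have "(\<lambda>h. h \<bullet> D) = (\<lambda>h. h \<bullet> D')"
    using assms unfolding gderiv_def by (rule has_derivative_unique)
  then have "h \<bullet> (D - D') = 0" for h by (metis inner_diff_right right_minus_eq)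
  then show ?thesis by (metis inner_eq_zero_iff right_minus_eq)
qed

lemma gradient_eqI: "GDERIV f x :> D \<Longrightarrow> gradient f x = D"
  unfolding gradient_def by (rule the_equality) (auto intro: gderiv_unique)

lemma divergence_eqI:
  assumes "(m has_derivative A) (at x)"
  shows "divergence m x = optrace A"
  using frechet_derivative_at[OF assms]
  by (simp add: divergence_def jacobian_def trace_matrix_eq_optrace)

lemma emeasure_lborel_translation:
  fixes c :: "'a::euclidean_space"
  assumes S: "S \<in> sets borel"
  shows "(\<lambda>x. x + c) ` S \<in> sets borel" "emeasure lborel ((\<lambda>x. x + c) ` S) = emeasure lborel S"
proof -
  have im: "(\<lambda>x. x + c) ` S = (\<lambda>x. x - c) -` S \<inter> space borel"
    by (auto simp: image_iff) (metis diff_add_cancel)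
  have "(\<lambda>x. x - c) -` S \<inter> space borel \<in> sets borel"
    by (rule measurable_sets[OF _ S]) auto
  then show T: "(\<lambda>x. x + c) ` S \<in> sets borel" using im by simp
  have "emeasure lborel ((\<lambda>x. x + c) ` S) = emeasure (distr lborel borel ((+) c)) ((\<lambda>x. x + c) ` S)"
    by (simp add: lborel_distr_plus)
  also have "\<dots> = emeasure lborel ((+) c -` ((\<lambda>x. x + c) ` S) \<inter> space lborel)"
    using T by (intro emeasure_distr) auto
  also have "(+) c -` ((\<lambda>x. x + c) ` S) \<inter> space lborel = S"
    by (auto simp: image_iff add.commute)
  finally show "emeasure lborel ((\<lambda>x. x + c) ` S) = emeasure lborel S" .
qed

text \<open>The m + 1 copies of E are disjoint, of equal measure, and all inside the ball. With an
  almost normal shift this bounds the volume of a thin layer without straightening the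
  interface.\<close>

lemma emeasure_disjoint_translates:
  fixes v :: "'a::euclidean_space"
  assumes E: "E \<in> sets borel" and sub: "\<And>k. k \<le> m \<Longrightarrow> (\<lambda>x. x + real k *\<^sub>R v) ` E \<subseteq> ball c R"
    and disj: "\<And>x y k. x \<in> E \<Longrightarrow> y \<in> E \<Longrightarrow> 0 < k \<Longrightarrow> x \<noteq> y + real k *\<^sub>R v"
  shows "emeasure lborel E \<le> ennreal (measure lborel (ball c R) / (real m + 1))"
proof -
  define F where "F = (\<lambda>k::nat. (\<lambda>x. x + real k *\<^sub>R v) ` E)"
  have "disjoint_family_on F {..m}"
  proof -
    have lt: "F k \<inter> F l = {}" if "k < l" for k l
    proof (rule ccontr)
      assume "F k \<inter> F l \<noteq> {}"
      then obtain x y where xy: "x \<in> E" "y \<in> E" "x + real k *\<^sub>R v = y + real l *\<^sub>R v"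
        by (auto simp: F_def)
      then have "x = y + (real l - real k) *\<^sub>R v" by (simp add: algebra_simps)
      then have "x = y + real (l - k) *\<^sub>R v" using that by (simp add: of_nat_diff)
      then show False using disj[of x y "l - k"] xy that by simp
    qed
    show ?thesis
      unfolding disjoint_family_on_def
      by (metis lt inf_commute linorder_neqE_nat)
  qed
  then have "(\<Sum>k\<le>m. emeasure lborel (F k)) = emeasure lborel (\<Union>k\<le>m. F k)"
    using emeasure_lborel_translation(1)[OF E] by (intro sum_emeasure) (auto simp: F_def)
  also have "\<dots> \<le> emeasure lborel (ball c R)"
    using sub by (intro emeasure_mono) (auto simp: F_def)
  also have "(\<Sum>k\<le>m. emeasure lborel (F k)) = (\<Sum>k\<le>m. emeasure lborel E)"
    by (simp only: F_def emeasure_lborel_translation(2)[OF E])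
  also have "\<dots> = ennreal (real m + 1) * emeasure lborel E"
    using ennreal_of_nat_eq_real_of_nat[of "Suc m"] by (simp add: add.commute)
  finally have le: "ennreal (real m + 1) * emeasure lborel E \<le> emeasure lborel (ball c R)" .
  have fin: "emeasure lborel (ball c R) = ennreal (measure lborel (ball c R))"
    using emeasure_lborel_ball_finite[of c R] by (intro emeasure_eq_ennreal_measure) auto
  have "E \<subseteq> ball c R" using sub[of 0] by simp
  then have "emeasure lborel E \<le> emeasure lborel (ball c R)" by (intro emeasure_mono) auto
  then have E': "emeasure lborel E = ennreal (measure lborel E)"
    using emeasure_lborel_ball_finite[of c R]
    by (intro emeasure_eq_ennreal_measure) (auto simp: top_unique)
  have "ennreal ((real m + 1) * measure lborel E) \<le> ennreal (measure lborel (ball c R))"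
    using le unfolding E' fin by (subst ennreal_mult) auto
  then have "(real m + 1) * measure lborel E \<le> measure lborel (ball c R)"
    by (simp only: ennreal_le_iff measure_nonneg)
  then show ?thesis unfolding E' by (intro ennreal_leI) (simp add: field_simps)
qed

lemma has_real_derivative_within_unique:
  assumes "(f has_real_derivative a) (at t within {0..T})" "(f has_real_derivative b) (at t within {0..T})"
    and "0 < T" "t \<in> {0..T}"
  shows "a = b"
proof -
  have "at t within {0..T} \<noteq> bot" using assms(3,4) by (simp add: trivial_limit_within)
  then show ?thesis
    using assms(1,2) tendsto_unique unfolding has_field_derivative_iff by blast
qed

section \<open>Curvature, evolution of the distance and volume of layers in a chart\<close>

context interface_chart
begin

text \<open>The divergence of the unit normal of the interface at p. The projection removes the
  variation of \<open>normal\<close> across the level sets of \<phi>, since \<phi> need not be a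
  distance function.\<close>

definition curv where
  "curv p t = optrace (\<lambda>h. normal' (p, t) (h - (normal (p, t) \<bullet> h) *\<^sub>R normal (p, t), 0))"

lemma eventually_ball_nhds: "norm (x - x0) < R \<Longrightarrow> \<forall>\<^sub>F y in nhds x. norm (y - x0) < R"
  using eventually_nhds_in_open[of "ball x0 R" x] by (simp add: dist_norm norm_minus_commute)

text \<open>The derivative A of the transported normal satisfies A + d Nn A = Nn composed with the
  tangential projection. Taking traces gives the Laplacian of d as the curvature at the foot point
  minus d times a bounded trace.\<close>

lemma nu_derivative:
  assumes x: "norm (x - x0) < \<rho>" and t: "\<bar>t - t0\<bar> < \<rho>" "t \<in> {0..T}"
  obtains A where "((\<lambda>y. nu y t) has_derivative A) (at x)"
    "\<bar>optrace A - curv (foot x t) t\<bar> \<le> real CARD('n) * (4 * L1\<^sup>2) * \<bar>d x t\<bar>"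
proof -
  have n: "near x t" using x t by (simp add: near_def)
  have pQ: "(foot x t, t) \<in> Q" by (rule near_foot(5)[OF n])
  define Nn where "Nn = (\<lambda>h. normal' (foot x t, t) (h, 0))"
  have "((\<lambda>y. (y, t)) has_derivative (\<lambda>h. (h, 0))) (at (foot x t))"
    by (intro has_derivative_Pair has_derivative_ident has_derivative_const)
  from has_derivative_compose[OF this normal_derivative(1)[OF pQ]]
  have Nn: "((\<lambda>y. normal (y, t)) has_derivative Nn) (at (foot x t))" by (simp add: Nn_def)
  have Nb: "norm (Nn h) \<le> L1 * norm h" for h
    using normal_derivative(2)[OF pQ, of "(h, 0)"] by (simp add: Nn_def)
  have ev: "\<forall>\<^sub>F y in nhds x. near y t"
    using eventually_ball_nhds[OF x] by eventually_elim (use t in \<open>auto simp: near_def\<close>)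
  define c where "c = max (2 * C + 3) (L1 * (2 * C + 4))"
  have c: "(2 * C + 3) * a \<le> c * a" "L1 * (2 * C + 4) * a \<le> c * a" if "a \<ge> 0" for a
    using that by (auto simp: c_def intro!: mult_right_mono)
  obtain A where A: "((\<lambda>y. nu y t) has_derivative A) (at x)"
    "\<And>h. A h + d x t *\<^sub>R Nn (A h) = Nn (h - (nu x t \<bullet> h) *\<^sub>R nu x t)"
    "\<And>h. norm (A h) \<le> 4 * L1 * norm h"
  proof (rule has_derivative_normal_field[where n = "\<lambda>y. normal (y, t)" and m = "\<lambda>y. nu y t"
        and q = "\<lambda>y. foot y t" and d = "\<lambda>y. d y t" and c = c and x = x, OF Nn])
    show "\<forall>\<^sub>F y in nhds x. nu y t = normal (foot y t, t)" by (simp add: nu_def)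
    show "\<forall>\<^sub>F y in nhds x. foot y t = y - d y t *\<^sub>R nu y t"
      using ev by eventually_elim (use foot_decomposition in \<open>force simp: algebra_simps\<close>)
    show "((\<lambda>y. d y t) has_derivative (\<lambda>h. nu x t \<bullet> h)) (at x)"
      using signed_dist_derivatives(1)[OF x t] by (simp add: gderiv_def inner_commute)
    show "\<forall>\<^sub>F y in nhds x. norm (nu y t - nu x t) \<le> c * norm (y - x)"
      using ev
    proof eventually_elim
      case (elim y)
      show ?case using foot_lipschitz(2)[OF n elim] c(2)[of "norm (y - x)"] by simp
    qed
    show "\<forall>\<^sub>F y in nhds x. norm (foot y t - foot x t) \<le> c * norm (y - x)"
      using ev
    proof eventually_elim
      case (elim y)
      show ?case using foot_lipschitz(1)[OF n elim] c(1)[of "norm (y - x)"] by simp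
    qed
    show "\<bar>d x t\<bar> * L1 \<le> 1 / 2" using near_foot(2)[OF n] by simp
    show "norm (nu x t) = 1" by (rule norm_nu[OF n])
    show "norm (Nn h) \<le> L1 * norm h" for h by (rule Nb)
  qed blast
  have "optrace (\<lambda>h. A h + d x t *\<^sub>R Nn (A h)) = curv (foot x t) t"
    unfolding A(2) by (simp add: curv_def Nn_def nu_def)
  then have "curv (foot x t) t = optrace A + d x t * optrace (\<lambda>h. Nn (A h))"
    by (simp add: optrace_add optrace_scaleR)
  moreover have "\<bar>optrace (\<lambda>h. Nn (A h))\<bar> \<le> real CARD('n) * (4 * L1\<^sup>2)"
  proof (rule abs_optrace_le)
    show "norm (Nn (A h)) \<le> 4 * L1\<^sup>2 * norm h" for h
    proof -
      have "norm (Nn (A h)) \<le> L1 * (4 * L1 * norm h)"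
        using Nb[of "A h"] A(3)[of h] L1 by (meson mult_left_mono order_trans less_imp_le)
      then show ?thesis by (simp add: power2_eq_square algebra_simps)
    qed
  qed
  ultimately have "\<bar>optrace A - curv (foot x t) t\<bar> \<le> \<bar>d x t\<bar> * (real CARD('n) * (4 * L1\<^sup>2))"
    by (simp add: abs_mult mult_left_mono)
  then show thesis using that[OF A(1)] by (simp add: mult.commute)
qed

lemma foot_frontier: "t \<in> {0..T} \<Longrightarrow> p \<in> frontier (\<Omega> t) \<Longrightarrow> d p t = 0 \<and> foot p t = p"
  using foot(2)[of t p] abs_signed_dist[of "\<Omega> t" p] by simp

text \<open>Near p the gradient of the signed distance is \<open>nu\<close>, so the curvature in the
  flow hypothesis is the trace computed in the chart. Hypothesis and chart then give two values of
  the same, possibly one-sided, time derivative.\<close>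

lemma speed_eq_curvature:
  assumes flow: "((\<lambda>s. d p s) has_real_derivative - (mean_curvature (\<Omega> t) p \<bullet> unit_normal (\<Omega> t) p))
      (at t within {0..T})"
    and p: "norm (p - x0) < \<rho>" "p \<in> frontier (\<Omega> t)" and t: "\<bar>t - t0\<bar> < \<rho>" "t \<in> {0..T}"
  shows "speed p t = curv p t"
proof -
  have fp: "d p t = 0" "foot p t = p" using foot_frontier[OF t(2) p(2)] by auto
  obtain A where A: "((\<lambda>y. nu y t) has_derivative A) (at p)" "optrace A = curv p t"
    using nu_derivative[OF p(1) t] fp by auto
  have un: "unit_normal (\<Omega> t) y = nu y t" if "norm (y - x0) < \<rho>" for y
    unfolding unit_normal_def by (rule gradient_eqI[OF signed_dist_derivatives(1)[OF that t]])
  have "(unit_normal (\<Omega> t) has_derivative A) (at p)"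
  proof (rule has_derivative_transform_eventually[OF A(1)])
    show "\<forall>\<^sub>F y in at p. nu y t = unit_normal (\<Omega> t) y"
      using eventually_ball_nhds[OF p(1)] unfolding eventually_at_filter
      by eventually_elim (simp add: un)
  qed (use un p in auto)
  then have "divergence (unit_normal (\<Omega> t)) p = curv p t"
    using divergence_eqI A(2) by metis
  moreover have "nu p t \<bullet> nu p t = 1"
    using norm_nu[of p t] p(1) t by (simp add: near_def norm_eq_1)
  ultimately have "- (mean_curvature (\<Omega> t) p \<bullet> unit_normal (\<Omega> t) p) = curv p t"
    by (simp add: mean_curvature_def un[OF p(1)])
  then show ?thesis
    using has_real_derivative_within_unique[OF signed_dist_derivatives(2)[OF p(1) t] _ T t(2)] flow by simp
qed

text \<open>The time derivative of d depends on the foot point only, and so does its Laplacian up to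
  O(d); at the foot point the flow equates them. The radius \<rho> / (C + 3) keeps the foot point
  within \<rho> of the centre, where the flow equation is available in the chart.\<close>

lemma chart_tube:
  assumes flow: "\<And>t p. t \<in> {0..T} \<Longrightarrow> p \<in> frontier (\<Omega> t) \<Longrightarrow>
      ((\<lambda>s. d p s) has_real_derivative - (mean_curvature (\<Omega> t) p \<bullet> unit_normal (\<Omega> t) p)) (at t within {0..T})"
    and x: "norm (x - x0) < \<rho> / (C + 3)" and t: "\<bar>t - t0\<bar> < \<rho> / (C + 3)" "t \<in> {0..T}"
  shows "\<exists>g A b. second_order_at (\<lambda>y. d y t) x g A \<and> norm g = 1 \<and>
    ((\<lambda>s. d x s) has_real_derivative b) (at t within {0..T}) \<and>
    \<bar>b - optrace A\<bar> \<le> real CARD('n) * (4 * L1\<^sup>2) * \<bar>d x t\<bar>"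
proof -
  have "\<rho> / (C + 3) \<le> \<rho> / 1" using C \<rho>(1) by (intro divide_left_mono) auto
  then have x': "norm (x - x0) < \<rho>" and t': "\<bar>t - t0\<bar> < \<rho>" using x t by auto
  have n: "near x t" using x' t' t by (simp add: near_def)
  have "C * \<bar>t - t0\<bar> \<le> C * (\<rho> / (C + 3))" using t C by (intro mult_left_mono) auto
  moreover have "0 < \<rho> / (C + 3)" using C \<rho>(1) by simp
  ultimately have "2 * norm (x - x0) + C * \<bar>t - t0\<bar> < 3 * (\<rho> / (C + 3)) + C * (\<rho> / (C + 3))"
    using x by linarith
  also have "\<dots> = (C + 3) * (\<rho> / (C + 3))" by (simp only: distrib_right add.commute)
  also have "\<dots> = \<rho>" using C by simp
  finally have p: "norm (foot x t - x0) < \<rho>" using near_foot(3)[OF n] by simp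
  have pf: "foot x t \<in> frontier (\<Omega> t)" by (rule foot(1)[OF t(2)])
  obtain A where A: "((\<lambda>y. nu y t) has_derivative A) (at x)"
    "\<bar>optrace A - curv (foot x t) t\<bar> \<le> real CARD('n) * (4 * L1\<^sup>2) * \<bar>d x t\<bar>"
    using nu_derivative[OF x' t' t(2)] .
  have "speed x t = speed (foot x t) t" using foot_frontier[OF t(2) pf] by (simp add: speed_def)
  also have "\<dots> = curv (foot x t) t" by (rule speed_eq_curvature[OF flow[OF t(2) pf] p pf t' t(2)])
  finally have "\<bar>speed x t - optrace A\<bar> \<le> real CARD('n) * (4 * L1\<^sup>2) * \<bar>d x t\<bar>"
    using A(2) by (simp add: abs_minus_commute)
  moreover have "second_order_at (\<lambda>y. d y t) x (nu x t) A"
    unfolding second_order_at_def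
  proof (intro exI[of _ "\<lambda>y. nu y t"] conjI A(1) refl)
    show "\<forall>\<^sub>F y in nhds x. GDERIV (\<lambda>y. d y t) y :> nu y t"
      using eventually_ball_nhds[OF x'] by eventually_elim (rule signed_dist_derivatives(1)[OF _ t' t(2)])
  qed
  ultimately show ?thesis
    using norm_nu[OF n] signed_dist_derivatives(2)[OF x' t' t(2)] by blast
qed

text \<open>In the chart the gradient of d stays close to the normal at the centre, so their inner
  product is at least 1/2 and d grows at least at this rate along one fixed direction.\<close>

lemma signed_dist_increases:
  assumes x: "norm (x - x0) < \<rho>" "norm (x + h *\<^sub>R normal (x0, t0) - x0) < \<rho>" and h: "h \<ge> 0"
    and t: "\<bar>t - t0\<bar> < \<rho>" "t \<in> {0..T}"
  shows "d (x + h *\<^sub>R normal (x0, t0)) t \<ge> d x t + h / 2"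
proof -
  let ?n = "normal (x0, t0)"
  have zQ: "(x0, t0) \<in> Q" using pos by simp
  define f where "f = (\<lambda>k. d (x + k *\<^sub>R ?n) t - k / 2)"
  have "f 0 \<le> f h"
  proof (rule DERIV_nonneg_imp_nondecreasing[OF h])
    fix k assume k: "0 \<le> k" "k \<le> h"
    have "x + k *\<^sub>R ?n \<in> closed_segment x (x + h *\<^sub>R ?n)"
    proof (cases "h = 0")
      case False
      then show ?thesis using k
        by (auto simp: in_segment intro!: exI[of _ "k / h"] simp: algebra_simps)
    qed (use k in auto)
    moreover have "closed_segment x (x + h *\<^sub>R ?n) \<subseteq> ball x0 \<rho>"
      using x by (intro closed_segment_subset) (auto simp: dist_norm norm_minus_commute)
    ultimately have y: "norm (x + k *\<^sub>R ?n - x0) < \<rho>"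
      by (auto simp: dist_norm norm_minus_commute)
    define y where "y = x + k *\<^sub>R ?n"
    have n: "near y t" using y t by (simp add: near_def y_def)
    have "norm (nu y t - ?n) \<le> L1 * norm ((foot y t, t) - (x0, t0))"
      unfolding nu_def by (rule normal_lipschitz[OF near_foot(5)[OF n] zQ])
    also have "\<dots> \<le> L1 * ((C + 3) * \<rho>)"
      using near_foot(6)[OF n] norm_Pair_le_add[of "foot y t - x0" "t - t0"] L1
      by (intro mult_left_mono) auto
    also have "\<dots> \<le> 1" using \<rho>(4) by (simp add: mult.commute)
    finally have "(norm (nu y t - ?n))\<^sup>2 \<le> 1" by (simp add: power_le_one)
    moreover have "nu y t \<bullet> nu y t = 1" "?n \<bullet> ?n = 1"
      using norm_nu[OF n] norm_normal[OF zQ] by (simp_all add: norm_eq_1)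
    ultimately have ge: "?n \<bullet> nu y t \<ge> 1 / 2"
      by (simp add: power2_norm_eq_inner inner_diff inner_commute)
    have "((\<lambda>k. x + k *\<^sub>R ?n) has_derivative (\<lambda>k. k *\<^sub>R ?n)) (at k)"
      by (auto intro!: derivative_eq_intros)
    moreover have "((\<lambda>y. d y t) has_derivative (\<lambda>h. h \<bullet> nu y t)) (at (x + k *\<^sub>R ?n))"
      using signed_dist_derivatives(1)[OF y t] by (simp add: gderiv_def y_def)
    ultimately have "((\<lambda>k. d (x + k *\<^sub>R ?n) t) has_derivative (\<lambda>h. (h *\<^sub>R ?n) \<bullet> nu y t)) (at k)"
      by (rule has_derivative_compose)
    then have "((\<lambda>k. d (x + k *\<^sub>R ?n) t) has_real_derivative ?n \<bullet> nu y t) (at k)"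
      by (rule has_derivative_imp_has_field_derivative) simp
    then have "(f has_real_derivative ?n \<bullet> nu y t - 1 / 2) (at k)"
      unfolding f_def by (auto intro!: derivative_eq_intros)
    then show "\<exists>D. (f has_real_derivative D) (at k) \<and> 0 \<le> D" using ge by auto
  qed
  then show ?thesis by (simp add: f_def)
qed

text \<open>A shift by 5 s along the central normal raises d by at least 5 s / 2, more than the
  width 2 s of the layer, so the translates are disjoint. About \<rho> / (10 s) shifts add up to at
  most \<rho> / 2 and hence stay in the larger ball.\<close>

lemma chart_volume:
  assumes t: "\<bar>t - t0\<bar> < \<rho>" "t \<in> {0..T}" and s: "s > 0"
  shows "emeasure lborel {x \<in> ball x0 (\<rho> / 2). \<bar>d x t\<bar> \<le> s}
    \<le> ennreal (measure lborel (ball x0 \<rho>) * 10 / \<rho> * s)"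
proof -
  let ?n = "normal (x0, t0)"
  have n1: "norm ?n = 1" using norm_normal[of "(x0, t0)"] pos by simp
  define E where "E = {x \<in> ball x0 (\<rho> / 2). \<bar>d x t\<bar> \<le> s}"
  have cd: "continuous_on UNIV (\<lambda>x. d x t)"
    by (rule lipschitz_on_continuous_on[of 1]) (auto simp: lipschitz_on_def dist_real_def signed_dist_lipschitz)
  have "closed {x. \<bar>d x t\<bar> \<le> s}"
    using cd by (intro closed_Collect_le continuous_intros) auto
  moreover have "E = ball x0 (\<rho> / 2) \<inter> {x. \<bar>d x t\<bar> \<le> s}" by (auto simp: E_def)
  ultimately have E: "E \<in> sets borel" by auto
  define m where "m = nat \<lfloor>\<rho> / (10 * s)\<rfloor>"
  have m: "real m \<le> \<rho> / (10 * s)" "\<rho> / (10 * s) \<le> real m + 1"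
    using \<rho>(1) s by (auto simp: m_def)
  then have m': "real m * (5 * s) \<le> \<rho> / 2" using s by (simp add: field_simps)
  have "emeasure lborel E \<le> ennreal (measure lborel (ball x0 \<rho>) / (real m + 1))"
  proof (rule emeasure_disjoint_translates[OF E, of m "(5 * s) *\<^sub>R ?n"])
    show "(\<lambda>x. x + real k *\<^sub>R (5 * s) *\<^sub>R ?n) ` E \<subseteq> ball x0 \<rho>" if "k \<le> m" for k
    proof
      fix z assume "z \<in> (\<lambda>x. x + real k *\<^sub>R (5 * s) *\<^sub>R ?n) ` E"
      then obtain x where x: "x \<in> E" "z = x + (real k * (5 * s)) *\<^sub>R ?n" by auto
      have "real k * (5 * s) \<le> real m * (5 * s)" using that s by (intro mult_right_mono) auto
      moreover have "norm ((real k * (5 * s)) *\<^sub>R ?n) = real k * (5 * s)" using n1 s by simp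
      ultimately have "norm ((real k * (5 * s)) *\<^sub>R ?n) \<le> \<rho> / 2" using m' by linarith
      moreover have "norm (x - x0) < \<rho> / 2" using x by (simp add: E_def dist_norm norm_minus_commute)
      moreover have "norm (z - x0) \<le> norm (x - x0) + norm ((real k * (5 * s)) *\<^sub>R ?n)"
        using norm_triangle_ineq[of "x - x0" "(real k * (5 * s)) *\<^sub>R ?n"] by (simp add: x(2) algebra_simps)
      ultimately have "norm (z - x0) < \<rho>" by linarith
      then show "z \<in> ball x0 \<rho>" by (simp add: dist_norm norm_minus_commute)
    qed
    show "x \<noteq> y + real k *\<^sub>R (5 * s) *\<^sub>R ?n" if xy: "x \<in> E" "y \<in> E" "0 < k" for x y k
    proof
      assume eq: "x = y + real k *\<^sub>R (5 * s) *\<^sub>R ?n"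
      have b: "norm (y - x0) < \<rho>" "norm (x - x0) < \<rho>" "\<bar>d x t\<bar> \<le> s" "\<bar>d y t\<bar> \<le> s"
        using xy \<rho>(1) by (auto simp: E_def dist_norm norm_minus_commute)
      have "d y t + (real k * (5 * s)) / 2 \<le> d (y + (real k * (5 * s)) *\<^sub>R ?n) t"
        using s b eq by (intro signed_dist_increases t) auto
      moreover have "1 * (5 * s) \<le> real k * (5 * s)" using xy s by (intro mult_right_mono) auto
      moreover have "d (y + (real k * (5 * s)) *\<^sub>R ?n) t \<le> s" "- s \<le> d y t" using eq b by auto
      ultimately show False using s by linarith
    qed
  qed
  also have "measure lborel (ball x0 \<rho>) / (real m + 1) \<le> measure lborel (ball x0 \<rho>) / (\<rho> / (10 * s))"
    using m(2) \<rho>(1) s by (intro divide_left_mono) auto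
  also have "\<dots> = measure lborel (ball x0 \<rho>) * 10 / \<rho> * s" using s by simp
  finally show ?thesis by (simp add: E_def ennreal_leI)
qed

end

section \<open>Uniform tubular neighbourhood\<close>

text \<open>Pointwise form of the two facts on which the barriers rest: the eikonal equation, and
  the heat equation up to an error proportional to the distance.\<close>

definition tube_regular_at ::
  "real \<Rightarrow> (real^'n \<Rightarrow> real \<Rightarrow> real) \<Rightarrow> real \<Rightarrow> real^'n \<Rightarrow> real \<Rightarrow> bool"
  where "tube_regular_at T d K x t \<longleftrightarrow>
    (\<exists>g A b. second_order_at (\<lambda>y. d y t) x g A \<and> norm g = 1 \<and>
       ((\<lambda>s. d x s) has_real_derivative b) (at t within {0..T}) \<and>
       \<bar>b - optrace A\<bar> \<le> K * \<bar>d x t\<bar>)"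

lemma tube_regular_at_mono:
  assumes "tube_regular_at T d K x t" "K \<le> K'" shows "tube_regular_at T d K' x t"
proof -
  have "K * \<bar>d x t\<bar> \<le> K' * \<bar>d x t\<bar>" using assms(2) by (simp add: mult_right_mono)
  then show ?thesis using assms(1) unfolding tube_regular_at_def by (meson order_trans)
qed

text \<open>The constant \<gamma> is the minimum of the continuous, nonvanishing spatial gradient
  length over a closed ball.\<close>

lemma interface_chart_exists:
  fixes \<Omega> :: "real \<Rightarrow> (real^'n) set"
  assumes T: "0 < T" and \<Omega>: "smoothly_evolving_domain T \<Omega>"
    and t0: "t0 \<in> {0..T}" and x0: "x0 \<in> frontier (\<Omega> t0)"
  shows "\<exists>\<phi> H H' r L \<gamma>. interface_chart T \<Omega> x0 t0 \<phi> H H' r L \<gamma>"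
proof -
  obtain N and \<phi> :: "(real^'n) \<times> real \<Rightarrow> real" where N: "open N" "(x0, t0) \<in> N" "smooth_on N \<phi>"
    and grad: "\<And>x t. (x, t) \<in> N \<Longrightarrow> gradient (\<lambda>y. \<phi> (y, t)) x \<noteq> 0"
    and sign: "\<And>x t. (x, t) \<in> N \<Longrightarrow> t \<in> {0..T} \<Longrightarrow>
      (x \<in> \<Omega> t \<longleftrightarrow> \<phi> (x, t) > 0) \<and> (x \<in> frontier (\<Omega> t) \<longleftrightarrow> \<phi> (x, t) = 0)"
    using \<Omega> t0 x0 unfolding smoothly_evolving_domain_def by fast
  obtain H H' r L where r: "r > 0" "L > 0" "cball (x0, t0) r \<subseteq> N"
    and H: "\<And>z. z \<in> N \<Longrightarrow> (\<phi> has_derivative (\<lambda>h. H z \<bullet> h)) (at z)"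
    and H': "\<And>z. z \<in> N \<Longrightarrow> (H has_derivative H' z) (at z)"
      "\<And>z h. z \<in> cball (x0, t0) r \<Longrightarrow> norm (H' z h) \<le> L * norm h"
    using higher_differentiable_on_gradient[OF N(1,2)] N(3) unfolding smooth_on_def by metis
  have G0: "fst (H z) \<noteq> 0" if z: "z \<in> N" for z
  proof -
    obtain x t where xt: "z = (x, t)" by (cases z)
    have "((\<lambda>y. (y, t)) has_derivative (\<lambda>h. (h, 0))) (at x)"
      by (intro has_derivative_Pair has_derivative_ident has_derivative_const)
    from has_derivative_compose[OF this H[of "(x, t)"]] z xt
    have "((\<lambda>y. \<phi> (y, t)) has_derivative (\<lambda>h. H (x, t) \<bullet> (h, 0))) (at x)" by simp
    then have "GDERIV (\<lambda>y. \<phi> (y, t)) x :> fst (H (x, t))"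
      by (simp add: gderiv_def inner_prod_def inner_commute)
    then show ?thesis using gradient_eqI grad[of x t] z xt by metis
  qed
  have "continuous_on (cball (x0, t0) r) H"
    using H'(1) r(3) by (meson continuous_at_imp_continuous_on has_derivative_continuous subsetD)
  then have "continuous_on (cball (x0, t0) r) (\<lambda>z. norm (fst (H z)))"
    by (intro continuous_intros)
  then obtain z where z: "z \<in> cball (x0, t0) r" "\<And>w. w \<in> cball (x0, t0) r \<Longrightarrow> norm (fst (H z)) \<le> norm (fst (H w))"
    using continuous_attains_inf[of "cball (x0, t0) r"] r(1) by (metis compact_cball centre_in_cball empty_iff less_imp_le)
  have "interface_chart T \<Omega> x0 t0 \<phi> H H' r L (norm (fst (H z)))"
  proof unfold_locales
    show "0 < norm (fst (H z))" using G0[OF subsetD[OF r(3) z(1)]] by simp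
    show "open (\<Omega> t)" "frontier (\<Omega> t) \<noteq> {}" if "t \<in> {0..T}" for t
      using \<Omega> that by (auto simp: smoothly_evolving_domain_def)
    show "x \<in> \<Omega> t \<longleftrightarrow> \<phi> (x, t) > 0" "x \<in> frontier (\<Omega> t) \<longleftrightarrow> \<phi> (x, t) = 0"
      if "(x, t) \<in> cball (x0, t0) r" "t \<in> {0..T}" for x t
      using sign[of x t] that r(3) by blast+
  qed (use T t0 x0 r H H' z(2) in blast)+
  then show ?thesis by blast
qed

text \<open>Collects everything local under one radius and one constant, ready for a finite
  subcover. The speed bound concerns the unsigned distance; its sign is treated globally.\<close>

lemma local_tube:
  fixes \<Omega> :: "real \<Rightarrow> (real^'n) set"
  assumes T: "0 < T" and \<Omega>: "smooth_mean_curvature_flow T \<Omega>"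
    and t0: "t0 \<in> {0..T}" and x0: "x0 \<in> frontier (\<Omega> t0)"
  shows "\<exists>\<rho> K. \<rho> > 0 \<and> K \<ge> 0 \<and> (\<forall>t\<in>{0..T}. \<bar>t - t0\<bar> < \<rho> \<longrightarrow>
    (\<forall>x. norm (x - x0) < \<rho> \<longrightarrow> tube_regular_at T (\<lambda>x t. signed_dist (\<Omega> t) x) K x t) \<and>
    (\<forall>x\<in>frontier (\<Omega> t). \<forall>s\<in>{0..T}. norm (x - x0) < \<rho> \<longrightarrow> \<bar>s - t\<bar> < \<rho> \<longrightarrow>
       infdist x (frontier (\<Omega> s)) \<le> K * \<bar>s - t\<bar>) \<and>
    (\<forall>s>0. emeasure lborel {x \<in> ball x0 \<rho>. \<bar>signed_dist (\<Omega> t) x\<bar> \<le> s} \<le> ennreal (K * s)))"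
proof -
  have dom: "smoothly_evolving_domain T \<Omega>" using \<Omega> by (simp add: smooth_mean_curvature_flow_def)
  obtain \<phi> H H' r L \<gamma> where "interface_chart T \<Omega> x0 t0 \<phi> H H' r L \<gamma>"
    using interface_chart_exists[OF T dom t0 x0] by blast
  then interpret interface_chart T \<Omega> x0 t0 \<phi> H H' r L \<gamma> .
  define \<rho>' where "\<rho>' = \<rho> / (C + 3)"
  have \<rho>': "\<rho>' > 0" "\<rho>' \<le> \<rho> / 2"
    unfolding \<rho>'_def by (use C \<rho>(1) in simp) (rule divide_left_mono; use C \<rho>(1) in simp)
  define K1 where "K1 = real CARD('n) * (4 * L1\<^sup>2)"
  define K2 where "K2 = measure lborel (ball x0 \<rho>) * 10 / \<rho>"
  define K where "K = K1 + C + K2"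
  have Ks: "K1 \<ge> 0" "K2 \<ge> 0" using \<rho>(1) by (auto simp: K1_def K2_def)
  have K: "K \<ge> 0" "K1 \<le> K" "C \<le> K" "K2 \<le> K" using Ks C by (auto simp: K_def)
  have flow: "((\<lambda>s. d p s) has_real_derivative - (mean_curvature (\<Omega> t) p \<bullet> unit_normal (\<Omega> t) p)) (at t within {0..T})"
    if "t \<in> {0..T}" "p \<in> frontier (\<Omega> t)" for t p
    using \<Omega> that by (simp add: smooth_mean_curvature_flow_def)
  have tube: "tube_regular_at T (\<lambda>x t. signed_dist (\<Omega> t) x) K x t"
    if "t \<in> {0..T}" "\<bar>t - t0\<bar> < \<rho>'" "norm (x - x0) < \<rho>'" for x t
    using chart_tube[OF flow, of x t] that K(2) unfolding \<rho>'_def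
    by (intro tube_regular_at_mono[of _ _ K1 _ _ K]) (auto simp: tube_regular_at_def K1_def)
  have spd: "infdist x (frontier (\<Omega> s)) \<le> K * \<bar>s - t\<bar>"
    if "t \<in> {0..T}" "\<bar>t - t0\<bar> < \<rho>'" "x \<in> frontier (\<Omega> t)" "s \<in> {0..T}" "norm (x - x0) < \<rho>'" "\<bar>s - t\<bar> < \<rho>'" for x s t
  proof -
    have "near x t" using that \<rho>' \<rho>(1) by (simp add: near_def)
    then have "infdist x (frontier (\<Omega> s)) \<le> C * \<bar>s - t\<bar>"
      using near_Q that \<rho>' \<rho>(1,2) by (intro frontier_speed) auto
    also have "\<dots> \<le> K * \<bar>s - t\<bar>" using K by (intro mult_right_mono) auto
    finally show ?thesis .
  qed
  have vol: "emeasure lborel {x \<in> ball x0 \<rho>'. \<bar>signed_dist (\<Omega> t) x\<bar> \<le> s} \<le> ennreal (K * s)"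
    if "t \<in> {0..T}" "\<bar>t - t0\<bar> < \<rho>'" "s > 0" for s t
  proof -
    have cd: "continuous_on UNIV (\<lambda>x. d x t)"
      by (rule lipschitz_on_continuous_on[of 1]) (auto simp: lipschitz_on_def dist_real_def signed_dist_lipschitz)
    have "closed {x. \<bar>d x t\<bar> \<le> s}"
      using cd by (intro closed_Collect_le continuous_intros) auto
    moreover have "{x \<in> ball x0 (\<rho> / 2). \<bar>d x t\<bar> \<le> s} = ball x0 (\<rho> / 2) \<inter> {x. \<bar>d x t\<bar> \<le> s}" by auto
    ultimately have "{x \<in> ball x0 (\<rho> / 2). \<bar>d x t\<bar> \<le> s} \<in> sets lborel" by auto
    then have "emeasure lborel {x \<in> ball x0 \<rho>'. \<bar>d x t\<bar> \<le> s} \<le> emeasure lborel {x \<in> ball x0 (\<rho> / 2). \<bar>d x t\<bar> \<le> s}"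
      using \<rho>' by (intro emeasure_mono) auto
    also have "\<dots> \<le> ennreal (K2 * s)"
      unfolding K2_def using that \<rho>' by (intro chart_volume) auto
    also have "\<dots> \<le> ennreal (K * s)" using K that by (intro ennreal_leI mult_right_mono) auto
    finally show ?thesis .
  qed
  show ?thesis
    by (rule exI[of _ \<rho>'], rule exI[of _ K]) (use \<rho>' K(1) tube spd vol in blast)
qed

text \<open>Finitely many charts cover the compact space-time track, so the constants become
  uniform. Continuity of the signed distance needs an argument of its own, because far from the
  interface there are no charts to rule out a jump of the sign.\<close>

theorem mean_curvature_flow_tube:
  fixes \<Omega> :: "real \<Rightarrow> (real^'n) set"
  assumes T: "0 < T" and \<Omega>: "smooth_mean_curvature_flow T \<Omega>"
  obtains \<delta> K R where "\<delta> > 0" "K \<ge> 0"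
    "continuous_on (UNIV \<times> {0..T}) (\<lambda>(x, t). signed_dist (\<Omega> t) x)"
    "\<And>t x. t \<in> {0..T} \<Longrightarrow> norm x - R \<le> \<bar>signed_dist (\<Omega> t) x\<bar>"
    "\<And>t x. t \<in> {0..T} \<Longrightarrow> \<bar>signed_dist (\<Omega> t) x\<bar> < \<delta> \<Longrightarrow>
       tube_regular_at T (\<lambda>x t. signed_dist (\<Omega> t) x) K x t"
    "\<And>t s. t \<in> {0..T} \<Longrightarrow> 0 < s \<Longrightarrow> s < \<delta> \<Longrightarrow>
       emeasure lborel {x. \<bar>signed_dist (\<Omega> t) x\<bar> \<le> s} \<le> ennreal (K * s)"
proof -
  define d where "d = (\<lambda>x t. signed_dist (\<Omega> t) x)"
  define \<Gamma> where "\<Gamma> = {(x, t). t \<in> {0..T} \<and> x \<in> frontier (\<Omega> t)}"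
  have dom: "smoothly_evolving_domain T \<Omega>" using \<Omega> by (simp add: smooth_mean_curvature_flow_def)
  have compact: "compact \<Gamma>" and op: "\<And>t. t \<in> {0..T} \<Longrightarrow> open (\<Omega> t)"
    and ne: "\<And>t. t \<in> {0..T} \<Longrightarrow> frontier (\<Omega> t) \<noteq> {}"
    using dom by (auto simp: smoothly_evolving_domain_def \<Gamma>_def)
  have foot: "\<exists>p. (p, t) \<in> \<Gamma> \<and> \<bar>d x t\<bar> = dist x p" if "t \<in> {0..T}" for x t
    using infdist_attains_inf[OF frontier_closed ne[OF that], of x] that
    by (auto simp: d_def abs_signed_dist \<Gamma>_def)
  have pos_iff: "x \<in> \<Omega> t \<longleftrightarrow> d x t > 0" if "t \<in> {0..T}" for x t
    unfolding d_def using open_pos_iff_mem op ne that by blast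
  define P where "P = (\<lambda>z \<rho> K. \<rho> > 0 \<and> K \<ge> 0 \<and> (\<forall>t\<in>{0..T}. \<bar>t - snd z\<bar> < \<rho> \<longrightarrow>
    (\<forall>x. norm (x - fst z) < \<rho> \<longrightarrow> tube_regular_at T d K x t) \<and>
    (\<forall>x\<in>frontier (\<Omega> t). \<forall>s\<in>{0..T}. norm (x - fst z) < \<rho> \<longrightarrow> \<bar>s - t\<bar> < \<rho> \<longrightarrow>
       infdist x (frontier (\<Omega> s)) \<le> K * \<bar>s - t\<bar>) \<and>
    (\<forall>s>0. emeasure lborel {x \<in> ball (fst z) \<rho>. \<bar>d x t\<bar> \<le> s} \<le> ennreal (K * s))))"
  have "\<exists>\<rho> K. P z \<rho> K" if "z \<in> \<Gamma>" for z
    using local_tube[OF T \<Omega>, of "snd z" "fst z"] that unfolding P_def d_def \<Gamma>_def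
    by (auto simp: case_prod_unfold)
  then obtain \<rho> \<kappa> where P: "\<And>z. z \<in> \<Gamma> \<Longrightarrow> P z (\<rho> z) (\<kappa> z)" by metis
  have \<rho>: "\<rho> z > 0" "\<kappa> z \<ge> 0" if "z \<in> \<Gamma>" for z using P[OF that] by (auto simp: P_def)
  \<comment> \<open>Half radii, so that every point within \<delta> of an interface point still lies
    in a chart of full size.\<close>
  obtain F where F: "F \<subseteq> \<Gamma>" "finite F" "\<Gamma> \<subseteq> (\<Union>z\<in>F. ball z (\<rho> z / 2))"
  proof (rule compactE_image[OF compact, of \<Gamma> "\<lambda>z. ball z (\<rho> z / 2)"])
    show "\<Gamma> \<subseteq> (\<Union>z\<in>\<Gamma>. ball z (\<rho> z / 2))" using \<rho> by force
  qed auto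
  define \<delta> where "\<delta> = Min (insert 1 ((\<lambda>z. \<rho> z / 2) ` F))"
  \<comment> \<open>A sum rather than a maximum: it dominates every single constant and also adds up
    the volumes of the charts.\<close>
  define K where "K = (\<Sum>z\<in>F. \<kappa> z)"
  have \<delta>: "\<delta> > 0" "\<And>z. z \<in> F \<Longrightarrow> \<delta> \<le> \<rho> z / 2"
  proof -
    show "\<delta> > 0" using F(1,2) \<rho>(1) by (auto simp: \<delta>_def)
    show "\<delta> \<le> \<rho> z / 2" if "z \<in> F" for z
      unfolding \<delta>_def by (rule Min_le) (use F(2) that in auto)
  qed
  have K: "K \<ge> 0" "\<And>z. z \<in> F \<Longrightarrow> \<kappa> z \<le> K"
    using F \<rho>(2) by (auto simp: K_def intro!: sum_nonneg member_le_sum)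
  have cover: "\<exists>z\<in>F. norm (p - fst z) < \<rho> z / 2 \<and> \<bar>t - snd z\<bar> < \<rho> z / 2" if pt: "(p, t) \<in> \<Gamma>" for p t
  proof -
    obtain z where z: "z \<in> F" "dist z (p, t) < \<rho> z / 2" using F(3) pt by auto
    have "norm (p - fst z) \<le> dist z (p, t)" "\<bar>t - snd z\<bar> \<le> dist z (p, t)"
      using dist_fst_le[of z "(p, t)"] dist_snd_le[of z "(p, t)"]
      by (auto simp: dist_norm norm_minus_commute abs_minus_commute)
    then show ?thesis using z by force
  qed
  have tube: "tube_regular_at T d K x t" if x: "t \<in> {0..T}" "\<bar>d x t\<bar> < \<delta>" for x t
  proof -
    obtain p where p: "(p, t) \<in> \<Gamma>" "\<bar>d x t\<bar> = dist x p" using foot[OF x(1)] by blast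
    obtain z where z: "z \<in> F" "norm (p - fst z) < \<rho> z / 2" "\<bar>t - snd z\<bar> < \<rho> z / 2" using cover[OF p(1)] by blast
    have "norm (x - fst z) < \<rho> z"
      using norm_triangle_ineq[of "x - p" "p - fst z"] p(2) x(2) \<delta>(2)[OF z(1)] z(2) by (simp add: dist_norm)
    then have "tube_regular_at T d (\<kappa> z) x t"
      using P[of z] z F(1) x(1) by (auto simp: P_def)
    then show ?thesis by (rule tube_regular_at_mono[OF _ K(2)[OF z(1)]])
  qed
  \<comment> \<open>The foot point at time t is within K |s - t| of the interface at time s; no
    restriction on the distance of x is involved.\<close>
  have unsigned: "\<bar>d x s\<bar> \<le> \<bar>d x t\<bar> + K * \<bar>s - t\<bar>" if ts: "t \<in> {0..T}" "s \<in> {0..T}" "\<bar>s - t\<bar> < \<delta>" for x s t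
  proof -
    obtain p where p: "(p, t) \<in> \<Gamma>" "\<bar>d x t\<bar> = dist x p" using foot[OF ts(1)] by blast
    obtain z where z: "z \<in> F" "norm (p - fst z) < \<rho> z / 2" "\<bar>t - snd z\<bar> < \<rho> z / 2" using cover[OF p(1)] by blast
    have "infdist p (frontier (\<Omega> s)) \<le> \<kappa> z * \<bar>s - t\<bar>"
      using P[of z] z F(1) ts \<delta>(2)[OF z(1)] p(1) by (auto simp: P_def \<Gamma>_def)
    also have "\<dots> \<le> K * \<bar>s - t\<bar>" using K(2)[OF z(1)] by (intro mult_right_mono) auto
    finally show ?thesis
      using infdist_triangle[of x "frontier (\<Omega> s)" p] p(2) by (simp add: d_def abs_signed_dist)
  qed
  have vol: "emeasure lborel {x. \<bar>d x t\<bar> \<le> s} \<le> ennreal (K * s)" if ts: "t \<in> {0..T}" "0 < s" "s < \<delta>" for t s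
  proof -
    define F' where "F' = {z \<in> F. \<bar>t - snd z\<bar> < \<rho> z}"
    have F': "finite F'" "F' \<subseteq> F" using F by (auto simp: F'_def)
    have cd: "continuous_on UNIV (\<lambda>x. d x t)" unfolding d_def
      by (rule lipschitz_on_continuous_on[of 1]) (auto simp: lipschitz_on_def dist_real_def signed_dist_lipschitz)
    have cl: "closed {x. \<bar>d x t\<bar> \<le> s}"
      using cd by (intro closed_Collect_le continuous_intros) auto
    have "{x \<in> ball y r. \<bar>d x t\<bar> \<le> s} = ball y r \<inter> {x. \<bar>d x t\<bar> \<le> s}" for y r by auto
    then have meas: "{x \<in> ball y r. \<bar>d x t\<bar> \<le> s} \<in> sets lborel" for y r using cl by auto
    have "{x. \<bar>d x t\<bar> \<le> s} \<subseteq> (\<Union>z\<in>F'. {x \<in> ball (fst z) (\<rho> z). \<bar>d x t\<bar> \<le> s})"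
    proof
      fix x assume x: "x \<in> {x. \<bar>d x t\<bar> \<le> s}"
      obtain p where p: "(p, t) \<in> \<Gamma>" "\<bar>d x t\<bar> = dist x p" using foot[OF ts(1)] by blast
      obtain z where z: "z \<in> F" "norm (p - fst z) < \<rho> z / 2" "\<bar>t - snd z\<bar> < \<rho> z / 2" using cover[OF p(1)] by blast
      have "norm (x - fst z) < \<rho> z"
        using norm_triangle_ineq[of "x - p" "p - fst z"] p(2) x ts(3) \<delta>(2)[OF z(1)] z(2) by (simp add: dist_norm)
      moreover have "z \<in> F'" using z \<rho>(1)[of z] F(1) by (auto simp: F'_def)
      ultimately show "x \<in> (\<Union>z\<in>F'. {x \<in> ball (fst z) (\<rho> z). \<bar>d x t\<bar> \<le> s})"
        using x by (auto simp: dist_norm norm_minus_commute)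
    qed
    then have "emeasure lborel {x. \<bar>d x t\<bar> \<le> s} \<le> emeasure lborel (\<Union>z\<in>F'. {x \<in> ball (fst z) (\<rho> z). \<bar>d x t\<bar> \<le> s})"
      using meas F' by (intro emeasure_mono sets.finite_UN) auto
    also have "\<dots> \<le> (\<Sum>z\<in>F'. emeasure lborel {x \<in> ball (fst z) (\<rho> z). \<bar>d x t\<bar> \<le> s})"
      using meas F' by (intro emeasure_subadditive_finite) auto
    also have "\<dots> \<le> (\<Sum>z\<in>F'. ennreal (\<kappa> z * s))"
    proof (rule sum_mono)
      fix z assume "z \<in> F'"
      then have "P z (\<rho> z) (\<kappa> z)" "\<bar>t - snd z\<bar> < \<rho> z" using P[of z] F(1) by (auto simp: F'_def)
      then show "emeasure lborel {x \<in> ball (fst z) (\<rho> z). \<bar>d x t\<bar> \<le> s} \<le> ennreal (\<kappa> z * s)"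
        using ts by (simp add: P_def)
    qed
    also have "\<dots> = ennreal (\<Sum>z\<in>F'. \<kappa> z * s)"
      using F' F(1) \<rho>(2) ts(2) by (intro sum_ennreal) auto
    also have "\<dots> \<le> ennreal (K * s)"
    proof (rule ennreal_leI)
      have "(\<Sum>z\<in>F'. \<kappa> z) \<le> K" unfolding K_def using F' F \<rho>(2) by (intro sum_mono2) auto
      then show "(\<Sum>z\<in>F'. \<kappa> z * s) \<le> K * s"
        using ts(2) by (simp add: sum_distrib_right[symmetric] mult_right_mono)
    qed
    finally show ?thesis .
  qed
  have small: "\<forall>\<^sub>F s in at t within {0..T}. s \<in> {0..T} \<and> K * \<bar>s - t\<bar> < e \<and> \<bar>s - t\<bar> < \<delta>" if "e > 0" for e t
  proof -
    have "((\<lambda>s. K * \<bar>s - t\<bar>) \<longlongrightarrow> K * \<bar>t - t\<bar>) (at t within {0..T})"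
      "((\<lambda>s. \<bar>s - t\<bar>) \<longlongrightarrow> \<bar>t - t\<bar>) (at t within {0..T})"
      by (intro tendsto_intros)+
    then have "\<forall>\<^sub>F s in at t within {0..T}. K * \<bar>s - t\<bar> < e" "\<forall>\<^sub>F s in at t within {0..T}. \<bar>s - t\<bar> < \<delta>"
      using order_tendstoD(2)[of _ "K * \<bar>t - t\<bar>" _ e] order_tendstoD(2)[of _ "\<bar>t - t\<bar>" _ \<delta>] that \<delta>(1) by simp_all
    moreover have "\<forall>\<^sub>F s in at t within {0..T}. s \<in> {0..T}" by (auto simp: eventually_at_filter)
    ultimately show ?thesis by eventually_elim auto
  qed
  text \<open>The sign of \<open>d\<close> at \<open>x\<close> cannot jump in time: it agrees with the sign at a point \<open>y\<close> of the
    tube, where \<open>d\<close> is continuous in time, because the segment from \<open>y\<close> to \<open>x\<close> stays away from the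
    interface.\<close>
  have sign: "\<forall>\<^sub>F s in at t within {0..T}. x \<in> \<Omega> s \<longleftrightarrow> x \<in> \<Omega> t" if t: "t \<in> {0..T}" and x: "d x t \<noteq> 0" for x t
  proof -
    obtain p where p: "(p, t) \<in> \<Gamma>" "\<bar>d x t\<bar> = dist x p" using foot[OF t] by blast
    have xp: "dist x p > 0" using x p by auto
    \<comment> \<open>Places y on the segment from the foot point to x, inside the tube but off the
      interface.\<close>
    define h where "h = min 1 (\<delta> / (2 * dist x p))"
    have h: "0 < h" "h \<le> 1" "h * dist x p < \<delta>"
    proof -
      show "0 < h" "h \<le> 1" using xp \<delta> by (auto simp: h_def)
      have "h * dist x p \<le> \<delta> / (2 * dist x p) * dist x p" by (intro mult_right_mono) (auto simp: h_def)
      also have "\<dots> < \<delta>" using xp \<delta> by simp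
      finally show "h * dist x p < \<delta>" .
    qed
    define y where "y = p + h *\<^sub>R (x - p)"
    have seg: "\<bar>d w t\<bar> \<ge> h * dist x p" if w: "w \<in> closed_segment y x" for w
    proof -
      obtain u where u: "0 \<le> u" "u \<le> 1" "w = (1 - u) *\<^sub>R y + u *\<^sub>R x" using w by (auto simp: in_segment)
      have "x - w = ((1 - u) * (1 - h)) *\<^sub>R (x - p)" by (simp add: u(3) y_def algebra_simps)
      then have "dist x w = (1 - u) * (1 - h) * dist x p" using u h by (simp add: dist_norm abs_mult)
      also have "\<dots> \<le> (1 - h) * dist x p" using u h by (intro mult_right_mono) (auto simp: mult_left_le_one_le)
      finally have "dist x w \<le> (1 - h) * dist x p" .
      moreover have "\<bar>d x t\<bar> - dist x w \<le> \<bar>d w t\<bar>"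
        using signed_dist_lipschitz[of "\<Omega> t" x w] by (simp add: d_def)
      ultimately show ?thesis using p(2) by (simp add: algebra_simps)
    qed
    have no_cross: "x \<in> \<Omega> s \<longleftrightarrow> y \<in> \<Omega> s" if "\<And>w. w \<in> closed_segment y x \<Longrightarrow> d w s \<noteq> 0" for s
    proof (rule ccontr)
      assume "\<not> ?thesis"
      then obtain w where "w \<in> frontier (\<Omega> s)" "w \<in> closed_segment y x"
        using segment_meets_frontier[of x "\<Omega> s" y] segment_meets_frontier[of y "\<Omega> s" x]
        by (metis closed_segment_commute)
      then show False using that[of w] abs_signed_dist[of "\<Omega> s" w] by (simp add: d_def)
    qed
    have yd: "\<bar>d y t\<bar> < \<delta>"
    proof -
      have "p \<in> frontier (\<Omega> t)" using p(1) by (simp add: \<Gamma>_def)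
      then have "\<bar>d y t\<bar> \<le> dist y p" by (simp add: d_def abs_signed_dist infdist_le)
      also have "\<dots> = h * dist x p" using h by (simp add: y_def dist_norm)
      finally show ?thesis using h by simp
    qed
    have hxp: "0 < h * dist x p" using h(1) xp by (rule mult_pos_pos)
    have y0: "d y t \<noteq> 0" using seg[of y] hxp by auto
    obtain b where "((\<lambda>s. d y s) has_real_derivative b) (at t within {0..T})"
      using tube[OF t yd] by (auto simp: tube_regular_at_def)
    then have "continuous (at t within {0..T}) (\<lambda>s. d y s)" by (rule DERIV_continuous)
    then have lim: "((\<lambda>s. d y s) \<longlongrightarrow> d y t) (at t within {0..T})" by (simp add: continuous_within)
    have "\<forall>\<^sub>F s in at t within {0..T}. (d y s > 0) = (d y t > 0)"
    proof (cases "d y t > 0")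
      case True
      then show ?thesis using order_tendstoD(1)[OF lim True] by simp
    next
      case False
      then have "d y t < 0" using y0 by simp
      from order_tendstoD(2)[OF lim this] show ?thesis by eventually_elim (use False in auto)
    qed
    then show ?thesis
      using small[OF hxp, of t]
    proof eventually_elim
      case s: (elim s)
      have "d w s \<noteq> 0" if "w \<in> closed_segment y x" for w
        using unsigned[of s t w] seg[OF that] s t by (auto simp: abs_minus_commute)
      then have "x \<in> \<Omega> s \<longleftrightarrow> y \<in> \<Omega> s" by (rule no_cross)
      moreover have "x \<in> \<Omega> t \<longleftrightarrow> y \<in> \<Omega> t" using seg hxp by (intro no_cross) force
      ultimately show ?case using pos_iff s t by auto
    qed
  qed
  have time: "((\<lambda>s. d x s) \<longlongrightarrow> d x t) (at t within {0..T})" if t: "t \<in> {0..T}" for x t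
  proof (rule tendstoI)
    fix e :: real assume e: "e > 0"
    have "\<forall>\<^sub>F s in at t within {0..T}. d x t = 0 \<or> (x \<in> \<Omega> s \<longleftrightarrow> x \<in> \<Omega> t)"
      using sign[OF t, of x] by (cases "d x t = 0") auto
    with small[OF e, of t] show "\<forall>\<^sub>F s in at t within {0..T}. dist (d x s) (d x t) < e"
    proof eventually_elim
      case (elim s)
      have "\<bar>d x s\<bar> \<le> \<bar>d x t\<bar> + K * \<bar>s - t\<bar>" "\<bar>d x t\<bar> \<le> \<bar>d x s\<bar> + K * \<bar>s - t\<bar>"
        using unsigned[of t s x] unsigned[of s t x] t elim by (auto simp: abs_minus_commute)
      then show ?case
        using elim pos_iff[of t x] pos_iff[of s x] t by (auto simp: dist_real_def)
    qed
  qed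
  \<comment> \<open>Continuity in time at fixed x, combined with the Lipschitz bound in space, which
    is uniform in time.\<close>
  have cont: "continuous_on (UNIV \<times> {0..T}) (\<lambda>(x, t). d x t)"
    unfolding continuous_on_def
  proof (intro ballI, clarify)
    fix x t assume t: "t \<in> {0..T}"
    have lt: "((\<lambda>s. d x s) \<longlongrightarrow> d x t) (at t within {0..T})" by (rule time[OF t])
    have fst_lim: "(fst \<longlongrightarrow> x) (at (x, t) within UNIV \<times> {0..T})" and snd_lim: "(snd \<longlongrightarrow> t) (at (x, t) within UNIV \<times> {0..T})"
      using tendsto_fst[OF tendsto_ident_at] tendsto_snd[OF tendsto_ident_at] by fastforce+
    have "continuous (at t within {0..T}) (\<lambda>s. d x s)" using lt by (simp add: continuous_within)
    then have "((\<lambda>z. d x (snd z)) \<longlongrightarrow> d x t) (at (x, t) within UNIV \<times> {0..T})"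
      by (rule continuous_within_tendsto_compose[OF _ _ snd_lim]) (auto simp: eventually_at_filter mem_Times_iff)
    moreover have "((\<lambda>z. d (fst z) (snd z) - d x (snd z)) \<longlongrightarrow> 0) (at (x, t) within UNIV \<times> {0..T})"
    proof (rule Lim_null_comparison)
      show "\<forall>\<^sub>F z in at (x, t) within UNIV \<times> {0..T}. norm (d (fst z) (snd z) - d x (snd z)) \<le> dist (fst z) x"
        by (simp add: d_def signed_dist_lipschitz)
      show "((\<lambda>z. dist (fst z) x) \<longlongrightarrow> 0) (at (x, t) within UNIV \<times> {0..T})"
        using fst_lim tendsto_dist_iff by blast
    qed
    ultimately have "((\<lambda>z. (d (fst z) (snd z) - d x (snd z)) + d x (snd z)) \<longlongrightarrow> 0 + d x t) (at (x, t) within UNIV \<times> {0..T})"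
      by (intro tendsto_add)
    then show "((\<lambda>(x, t). d x t) \<longlongrightarrow> d x t) (at (x, t) within UNIV \<times> {0..T})"
      by (simp add: case_prod_unfold)
  qed
  obtain R where R: "\<And>z. z \<in> \<Gamma> \<Longrightarrow> norm z \<le> R"
    using compact_imp_bounded[OF compact] by (auto simp: bounded_iff)
  have far: "norm x - R \<le> \<bar>d x t\<bar>" if t: "t \<in> {0..T}" for x t
  proof -
    obtain p where p: "(p, t) \<in> \<Gamma>" "\<bar>d x t\<bar> = dist x p" using foot[OF t] by blast
    have "norm p \<le> R" using R[OF p(1)] norm_fst_le[of p t] by simp
    then show ?thesis using p(2) norm_triangle_sub[of x p] by (simp add: dist_norm)
  qed
  show thesis
    by (rule that[of \<delta> K R])
      (use \<delta>(1) K(1) cont far tube vol in \<open>simp_all add: d_def\<close>)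
qed

section \<open>Barriers\<close>

text \<open>A smooth substitute for the norm, so that its exponentials can serve as test functions
  at the origin too.\<close>

definition japanese :: "real^'n \<Rightarrow> real"
  where "japanese x = sqrt (1 + x \<bullet> x)"

lemma japanese_bounds: "norm x \<le> japanese x" "japanese x \<le> 1 + norm x" "1 \<le> japanese x"
proof -
  show "norm x \<le> japanese x" by (simp add: japanese_def norm_eq_sqrt_inner)
  have "1 + x \<bullet> x \<le> (1 + norm x)\<^sup>2"
    by (simp add: power2_eq_square algebra_simps power2_norm_eq_inner[symmetric])
  then have "sqrt (1 + x \<bullet> x) \<le> sqrt ((1 + norm x)\<^sup>2)" by (simp only: real_sqrt_le_iff)
  then show "japanese x \<le> 1 + norm x" by (simp add: japanese_def)
  show "1 \<le> japanese x" by (simp add: japanese_def)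
qed

lemma continuous_on_japanese [continuous_intros]:
  "continuous_on S f \<Longrightarrow> continuous_on S (\<lambda>x. japanese (f x))"
  unfolding japanese_def by (intro continuous_intros) auto

text \<open>Computed as a function F of \<open>x \<bullet> x\<close>. The term carrying the
  dimension is a positive multiple of F' \<le> 0 and is dropped, which makes the bound independent
  of the dimension.\<close>

lemma second_order_at_exp_japanese:
  fixes x :: "real^'n"
  assumes \<mu>: "\<mu> \<ge> 0"
  obtains g A where "second_order_at (\<lambda>y. exp (- \<mu> * japanese y)) x g A"
    "optrace A \<le> (\<mu>\<^sup>2 + \<mu>) * exp (- \<mu> * japanese x)"
proof -
  define F where "F = (\<lambda>q. exp (- \<mu> * sqrt (1 + q)))"
  define F1 where "F1 = (\<lambda>q. - (\<mu> / 2) * (inverse (sqrt (1 + q)) * F q))"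
  define q where "q = x \<bullet> x"
  define r where "r = sqrt (1 + q)"
  have q: "q \<ge> 0" by (simp add: q_def)
  have r: "r \<ge> 1" "r\<^sup>2 = 1 + q" using q by (auto simp: r_def)
  define F2 where "F2 = (\<mu> / (4 * r ^ 3) + \<mu>\<^sup>2 / (4 * r\<^sup>2)) * F q"
  have sq: "((\<lambda>q. sqrt (1 + q)) has_real_derivative inverse (sqrt (1 + s)) / 2) (at s)" if "s > - 1" for s
  proof -
    have "1 + s > 0" using that by simp
    then show ?thesis by (auto intro!: derivative_eq_intros)
  qed
  have F1: "(F has_real_derivative F1 s) (at s)" if "s > - 1" for s
    unfolding F_def F1_def
    by (rule DERIV_cong[OF DERIV_chain2[OF DERIV_exp DERIV_cmult[OF sq[OF that]]]]) (simp add: algebra_simps)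
  have "(F1 has_real_derivative - (\<mu> / 2) * (- (inverse r * (inverse r / 2) * inverse r) * F q + F1 q * inverse r)) (at q)"
  proof -
    have "((\<lambda>q. inverse (sqrt (1 + q))) has_real_derivative - (inverse r * (inverse r / 2) * inverse r)) (at q)"
      unfolding r_def by (rule DERIV_inverse'[OF sq]) (use q in auto)
    from DERIV_mult[OF this F1[of q]] q
    have "((\<lambda>q. inverse (sqrt (1 + q)) * F q) has_real_derivative
        - (inverse r * (inverse r / 2) * inverse r) * F q + F1 q * inverse r) (at q)"
      by (simp add: r_def)
    from DERIV_cmult[OF this, of "- (\<mu> / 2)"] show ?thesis by (simp only: F1_def)
  qed
  moreover have "- (\<mu> / 2) * (- (inverse r * (inverse r / 2) * inverse r) * F q + F1 q * inverse r) = F2"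
  proof -
    have ring: "- (\<mu> / 2) * (- (i * (i / 2) * i) * a + - (\<mu> / 2) * (i * a) * i) = (\<mu> / 4 * i ^ 3 + \<mu>\<^sup>2 / 4 * i\<^sup>2) * a"
      for i a :: real by (simp add: power2_eq_square power3_eq_cube algebra_simps)
    have "F1 q = - (\<mu> / 2) * (inverse r * F q)" by (simp add: F1_def r_def)
    moreover have "F2 = (\<mu> / 4 * inverse r ^ 3 + \<mu>\<^sup>2 / 4 * (inverse r)\<^sup>2) * F q"
      by (simp add: F2_def inverse_eq_divide power_divide)
    ultimately show ?thesis using ring[of "inverse r" "F q"] by (simp only:)
  qed
  ultimately have F2: "(F1 has_real_derivative F2) (at q)" by simp
  have ev: "\<forall>\<^sub>F s in nhds (x \<bullet> x). (F has_real_derivative F1 s) (at s)"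
  proof -
    have "\<forall>\<^sub>F s in nhds (x \<bullet> x). s \<in> {-1<..}"
      using q by (intro eventually_nhds_in_open) (simp_all add: q_def less_le_trans[of "-1" 0])
    then show ?thesis by eventually_elim (simp add: F1)
  qed
  have so: "second_order_at (\<lambda>y. F (y \<bullet> y)) x (F1 (x \<bullet> x) *\<^sub>R (2 *\<^sub>R x))
      (\<lambda>h. (F2 * ((2 *\<^sub>R x) \<bullet> h)) *\<^sub>R (2 *\<^sub>R x) + F1 (x \<bullet> x) *\<^sub>R (2 *\<^sub>R h))"
    by (rule second_order_at_compose[OF second_order_at_norm_sq ev F2[unfolded q_def]])
  have "optrace (\<lambda>h. (F2 * ((2 *\<^sub>R x) \<bullet> h)) *\<^sub>R (2 *\<^sub>R x) + F1 (x \<bullet> x) *\<^sub>R (2 *\<^sub>R h))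
      = F2 * (4 * q) + F1 q * (2 * real CARD('n))"
    by (simp only: optrace_add optrace_rank_one optrace_scaleR optrace_ident) (simp add: q_def)
  also have "\<dots> \<le> F2 * (4 * q)"
    using \<mu> q by (simp add: F1_def F_def mult_nonneg_nonneg)
  also have "\<dots> = (\<mu> * (q / r ^ 3) + \<mu>\<^sup>2 * (q / r\<^sup>2)) * F q"
    by (simp add: F2_def field_simps)
  also have "\<dots> \<le> (\<mu> * 1 + \<mu>\<^sup>2 * 1) * F q"
  proof -
    have "q \<le> r\<^sup>2" using r(2) by linarith
    moreover have "r\<^sup>2 \<le> r ^ 3" using r(1) by (intro power_increasing) auto
    ultimately have "q \<le> r ^ 3" "q \<le> r\<^sup>2" by auto
    moreover have "0 < r ^ 3" "0 < r\<^sup>2" using r(1) by (auto intro: zero_less_power)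
    ultimately have "q / r ^ 3 \<le> 1" "q / r\<^sup>2 \<le> 1" by (simp_all only: divide_le_eq_1_pos)
    then show ?thesis using \<mu> by (intro mult_right_mono add_mono mult_left_mono) (auto simp: F_def)
  qed
  finally show thesis
    using that[OF so[unfolded F_def, folded japanese_def]] by (simp add: F_def q_def japanese_def add.commute)
qed

text \<open>The corrector \<open>\<epsilon>\<^sup>2 k\<close> absorbs the curvature error \<open>K \<theta>' \<bar>z\<bar>\<close> where \<open>W''\<close> is positive; in
  between, \<open>\<theta>'\<close> is bounded below and the drift \<open>p' = B p\<close> does.\<close>

lemma profile_residual_nonneg:
  fixes a \<theta>p k k1 k2 b \<tau> s p z \<epsilon> :: real
  assumes \<epsilon>: "\<epsilon> > 0" and z: "s = \<epsilon> * z - p" and p: "p \<ge> \<epsilon>"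
    and err: "\<bar>b - \<tau>\<bar> \<le> K * \<bar>s\<bar>" and s: "\<bar>s\<bar> \<le> \<delta>" and K: "K \<ge> 0"
    and \<theta>p: "\<theta>p \<ge> 0" "\<theta>p * \<bar>z\<bar> \<le> C1"
    and k: "q0 \<le> k" "k \<le> 9 * q0" "q0 \<ge> 0" and k12: "K * \<delta> * \<bar>k1\<bar> + k2 \<le> q0 * C2"
    and cond: "\<epsilon>\<^sup>2 * C2 \<le> c / 2" "K * C1 \<le> c * q0 / 2" "K \<le> B"
      "K * C1 + c * q0 / 2 + 9 * L * q0 \<le> c1 * (B - K)" "L \<ge> 0"
    and cases: "f (a + \<epsilon>\<^sup>2 * k) - f a \<ge> c * (\<epsilon>\<^sup>2 * k) \<or> (\<theta>p \<ge> c1 \<and> f (a + \<epsilon>\<^sup>2 * k) - f a \<ge> - L * (\<epsilon>\<^sup>2 * k))"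
    and c: "c \<ge> 0"
  shows "(\<theta>p / \<epsilon> + \<epsilon>\<^sup>2 * k1) * b + \<theta>p * (B * p / \<epsilon>) - ((f a / \<epsilon>\<^sup>2 + \<epsilon>\<^sup>2 * k2) + (\<theta>p / \<epsilon> + \<epsilon>\<^sup>2 * k1) * \<tau>)
    + f (a + \<epsilon>\<^sup>2 * k) / \<epsilon>\<^sup>2 \<ge> 0"
proof -
  have p0: "p > 0" using p \<epsilon> by simp
  have "\<bar>s\<bar> \<le> \<epsilon> * \<bar>z\<bar> + p" using z \<epsilon> p0 abs_triangle_ineq4[of "\<epsilon> * z" p] by (simp add: abs_mult)
  then have "K * \<bar>s\<bar> \<le> K * (\<epsilon> * \<bar>z\<bar> + p)" using K by (rule mult_left_mono)
  then have "b - \<tau> \<ge> - (K * (\<epsilon> * \<bar>z\<bar> + p))" using err by linarith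
  then have "(\<theta>p / \<epsilon>) * (b - \<tau>) \<ge> (\<theta>p / \<epsilon>) * (- (K * (\<epsilon> * \<bar>z\<bar> + p)))"
    using \<theta>p \<epsilon> by (intro mult_left_mono) auto
  also have "(\<theta>p / \<epsilon>) * (- (K * (\<epsilon> * \<bar>z\<bar> + p))) = - (K * (\<theta>p * \<bar>z\<bar>)) - K * \<theta>p * (p / \<epsilon>)"
    using \<epsilon> by (simp add: field_simps)
  finally have 1: "(\<theta>p / \<epsilon>) * (b - \<tau>) \<ge> - (K * C1) - K * \<theta>p * (p / \<epsilon>)"
    using mult_left_mono[OF \<theta>p(2) K] by linarith
  have "\<bar>k1 * (b - \<tau>)\<bar> \<le> \<bar>k1\<bar> * (K * \<delta>)"
    unfolding abs_mult using order_trans[OF err mult_left_mono[OF s K]] by (intro mult_left_mono) auto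
  then have "k1 * (b - \<tau>) - k2 \<ge> - (q0 * C2)" using k12 by (simp add: abs_le_iff algebra_simps)
  then have "\<epsilon>\<^sup>2 * (k1 * (b - \<tau>) - k2) \<ge> \<epsilon>\<^sup>2 * (- (q0 * C2))" by (intro mult_left_mono) auto
  moreover have "q0 * (\<epsilon>\<^sup>2 * C2) \<le> q0 * (c / 2)" using cond(1) k(3) by (rule mult_left_mono)
  ultimately have 2: "\<epsilon>\<^sup>2 * (k1 * (b - \<tau>) - k2) \<ge> - (c * q0 / 2)" by (simp add: algebra_simps)
  have pe: "p / \<epsilon> \<ge> 1" using p \<epsilon> by simp
  have drift: "(B - K) * \<theta>p * (p / \<epsilon>) \<ge> (B - K) * \<theta>p * 1"
    using pe cond(3) \<theta>p by (intro mult_left_mono) auto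
  \<comment> \<open>Near the wells the corrector gains c k \<ge> c q0. Between them the surplus
    drift, at least c1 (B - K), covers the same amount and the possible loss L k.\<close>
  have main: "(B - K) * \<theta>p + (f (a + \<epsilon>\<^sup>2 * k) - f a) / \<epsilon>\<^sup>2 \<ge> K * C1 + c * q0 / 2"
    using cases
  proof
    assume "f (a + \<epsilon>\<^sup>2 * k) - f a \<ge> c * (\<epsilon>\<^sup>2 * k)"
    then have "(f (a + \<epsilon>\<^sup>2 * k) - f a) / \<epsilon>\<^sup>2 \<ge> c * (\<epsilon>\<^sup>2 * k) / \<epsilon>\<^sup>2" by (rule divide_right_mono) simp
    also have "c * (\<epsilon>\<^sup>2 * k) / \<epsilon>\<^sup>2 = c * k" using \<epsilon> by simp
    finally have "(f (a + \<epsilon>\<^sup>2 * k) - f a) / \<epsilon>\<^sup>2 \<ge> c * q0" using mult_left_mono[OF k(1) c] by linarith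
    moreover have "(B - K) * \<theta>p \<ge> 0" using cond(3) \<theta>p by simp
    ultimately show ?thesis using cond(2) by linarith
  next
    assume *: "\<theta>p \<ge> c1 \<and> f (a + \<epsilon>\<^sup>2 * k) - f a \<ge> - L * (\<epsilon>\<^sup>2 * k)"
    then have "(f (a + \<epsilon>\<^sup>2 * k) - f a) / \<epsilon>\<^sup>2 \<ge> - L * (\<epsilon>\<^sup>2 * k) / \<epsilon>\<^sup>2" by (intro divide_right_mono) auto
    also have "- L * (\<epsilon>\<^sup>2 * k) / \<epsilon>\<^sup>2 = - (L * k)" using \<epsilon> by simp
    finally have "(f (a + \<epsilon>\<^sup>2 * k) - f a) / \<epsilon>\<^sup>2 \<ge> - (9 * L * q0)"
      using mult_left_mono[OF k(2) cond(5)] by linarith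
    moreover have "(B - K) * \<theta>p \<ge> (B - K) * c1" using * cond(3) by (intro mult_left_mono) auto
    ultimately show ?thesis using cond(4) by (simp add: mult.commute)
  qed
  \<comment> \<open>The leading terms \<open>f a / \<epsilon>\<^sup>2\<close> cancel, because the
    second derivative of the profile is the reaction; the remaining groups are those just
    estimated.\<close>
  have "(\<theta>p / \<epsilon> + \<epsilon>\<^sup>2 * k1) * b + \<theta>p * (B * p / \<epsilon>) - ((f a / \<epsilon>\<^sup>2 + \<epsilon>\<^sup>2 * k2) + (\<theta>p / \<epsilon> + \<epsilon>\<^sup>2 * k1) * \<tau>)
      + f (a + \<epsilon>\<^sup>2 * k) / \<epsilon>\<^sup>2
    = ((\<theta>p / \<epsilon>) * (b - \<tau>) + K * \<theta>p * (p / \<epsilon>)) + \<epsilon>\<^sup>2 * (k1 * (b - \<tau>) - k2) + (B - K) * \<theta>p * (p / \<epsilon>)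
      + (f (a + \<epsilon>\<^sup>2 * k) - f a) / \<epsilon>\<^sup>2"
    by (simp add: diff_divide_distrib algebra_simps)
  then show ?thesis using 1 2 drift main by linarith
qed

text \<open>The constant 1 is a solution because W'(1) = 0. Boundedness of u by some M provides the
  range on which a Lipschitz constant for W' is taken.\<close>

lemma allen_cahn_upper_one:
  fixes u :: "real^'n \<Rightarrow> real \<Rightarrow> real"
  assumes W: "standard_double_well W" and \<epsilon>: "\<epsilon> > 0" and u: "classical_allen_cahn (deriv W) \<epsilon> T u"
    and init: "\<And>x. u x 0 \<le> 1" and t: "t \<in> {0..T}"
  shows "u x t \<le> 1"
proof -
  have "bounded ((\<lambda>(x, t). u x t) ` (UNIV \<times> {0..T}))" using u by (simp add: classical_allen_cahn_def)
  then obtain M where M: "\<And>x t. t \<in> {0..T} \<Longrightarrow> \<bar>u x t\<bar> \<le> M" by (fastforce simp: bounded_iff)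
  define M' where "M' = max M 1"
  obtain L where L: "L \<ge> 0"
    "\<And>a b. a \<in> {-M'..M'} \<Longrightarrow> b \<in> {-M'..M'} \<Longrightarrow> \<bar>deriv W a - deriv W b\<bar> \<le> L * \<bar>a - b\<bar>"
    using double_well_deriv_lipschitz[OF W] by blast
  show ?thesis
  proof (rule allen_cahn_comparison[OF \<epsilon> u _ _ L(1), of M' "\<lambda>x t. 1"])
    show "u x t \<le> M'" if "t \<in> {0..T}" for x t using M[OF that, of x] by (simp add: M'_def)
    show "supersolution_at (deriv W) \<epsilon> T (\<lambda>x t. 1) x t" for x t
      unfolding supersolution_at_def
      by (rule exI[of _ "\<lambda>y. 1"], rule exI[of _ "\<lambda>y. 1"], rule exI[of _ 0], rule exI[of _ "\<lambda>h. 0"], rule exI[of _ 0])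
        (auto simp: second_order_at_const optrace_zero double_well_deriv_one[OF W])
  qed (use L(2) init t in \<open>auto simp: M'_def\<close>)
qed

lemma has_real_derivative_corrector:
  assumes "(f has_real_derivative D) (at x within S)" and c: "c \<noteq> (0::real)"
  shows "((\<lambda>s. q * (1 + 8 * (f s)\<^sup>2 / c)) has_real_derivative q * (16 * f x / c) * D) (at x within S)"
  using c by (auto intro!: derivative_eq_intros assms(1) simp: power2_eq_square)

text \<open>Interface-free part of the hypotheses, invariant under \<open>d \<mapsto> - d\<close>, \<open>u \<mapsto> - u\<close>; hence upper barriers
  suffice.\<close>

locale tube =
  fixes T \<delta> K R :: real and d :: "real^'n \<Rightarrow> real \<Rightarrow> real" and W \<theta> :: "real \<Rightarrow> real"
  assumes T: "0 < T" and \<delta>: "0 < \<delta>" and K: "0 \<le> K"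
    and d_cont: "continuous_on (UNIV \<times> {0..T}) (\<lambda>(x, t). d x t)"
    and d_far: "\<And>t x. t \<in> {0..T} \<Longrightarrow> norm x - R \<le> \<bar>d x t\<bar>"
    and d_vol: "\<And>t s. t \<in> {0..T} \<Longrightarrow> 0 < s \<Longrightarrow> s < \<delta> \<Longrightarrow> emeasure lborel {x. \<bar>d x t\<bar> \<le> s} \<le> ennreal (K * s)"
    and d_tube: "\<And>t x. t \<in> {0..T} \<Longrightarrow> \<bar>d x t\<bar> < \<delta> \<Longrightarrow> tube_regular_at T d K x t"
    and W: "standard_double_well W" and \<theta>: "equilibrium_profile W \<theta>"
begin

definition solution :: "real \<Rightarrow> (real^'n \<Rightarrow> real \<Rightarrow> real) \<Rightarrow> bool"
  where "solution \<epsilon> u \<longleftrightarrow> classical_allen_cahn (deriv W) \<epsilon> T u \<and> (\<forall>x. u x 0 = \<theta> (d x 0 / \<epsilon>)) \<and>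
    (\<forall>x. \<forall>t\<in>{0..T}. \<bar>u x t\<bar> \<le> 1)"

lemma d_cont_space: "t \<in> {0..T} \<Longrightarrow> continuous_on UNIV (\<lambda>x. d x t)"
  by (rule continuous_on_compose2[OF d_cont, of _ "\<lambda>x. (x, t)", simplified]) (auto intro!: continuous_intros)

lemma d_cont_time: "continuous_on {0..T} (\<lambda>t. d x t)"
  by (rule continuous_on_compose2[OF d_cont, of _ "\<lambda>t. (x, t)", simplified]) (auto intro!: continuous_intros)

text \<open>Lets one branch of a piecewise barrier act as a test function near a point, separately
  in space and in time.\<close>

lemma d_less_nearby:
  assumes "t \<in> {0..T}" "d x t < c"
  shows "\<forall>\<^sub>F y in nhds x. d y t < c" "\<forall>\<^sub>F s in at t within {0..T}. d x s < c"
proof -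
  have "isCont (\<lambda>x. d x t) x"
    using d_cont_space[OF assms(1)] by (simp add: continuous_on_eq_continuous_at)
  then have "((\<lambda>y. d y t) \<longlongrightarrow> d x t) (nhds x)"
    unfolding isCont_def by (rule tendsto_at_iff_tendsto_nhds[THEN iffD1])
  then show "\<forall>\<^sub>F y in nhds x. d y t < c" using assms(2) by (rule order_tendstoD)
  have "((\<lambda>s. d x s) \<longlongrightarrow> d x t) (at t within {0..T})"
    using d_cont_time assms(1) by (simp add: continuous_on_def)
  then show "\<forall>\<^sub>F s in at t within {0..T}. d x s < c" using assms(2) by (rule order_tendstoD)
qed

lemma lipschitz_deriv_W:
  obtains L where "L \<ge> 0"
    "\<And>a b. \<bar>a\<bar> \<le> 2 \<Longrightarrow> \<bar>b\<bar> \<le> 2 \<Longrightarrow> \<bar>deriv W a - deriv W b\<bar> \<le> L * \<bar>a - b\<bar>"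
proof -
  obtain L where "L \<ge> 0"
    "\<And>a b. a \<in> {-2..2} \<Longrightarrow> b \<in> {-2..2} \<Longrightarrow> \<bar>deriv W a - deriv W b\<bar> \<le> L * \<bar>a - b\<bar>"
    using double_well_deriv_lipschitz[OF W] by blast
  then show thesis by (intro that[of L]) (auto simp: abs_le_iff)
qed

text \<open>Since u \<le> 1, a barrier is examined only where it lies below 1; this keeps the
  profile barrier from being used beyond the inner edge of the tube.\<close>

lemma comparison:
  assumes \<epsilon>: "\<epsilon> > 0" and u: "solution \<epsilon> u"
    and V1: "\<And>x t. t \<in> {0..T} \<Longrightarrow> - 1 \<le> V x t"
    and V: "continuous_on (UNIV \<times> {0..T}) (\<lambda>(x, t). V x t)"
    and init: "\<And>x. \<theta> (d x 0 / \<epsilon>) \<le> V x 0"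
    and super: "\<And>x t. 0 < t \<Longrightarrow> t \<le> T \<Longrightarrow> V x t < 1 \<Longrightarrow> supersolution_at (deriv W) \<epsilon> T V x t"
    and t: "t \<in> {0..T}"
  shows "u x t \<le> V x t"
proof -
  obtain L where L: "L \<ge> 0"
    "\<And>a b. \<bar>a\<bar> \<le> 2 \<Longrightarrow> \<bar>b\<bar> \<le> 2 \<Longrightarrow> \<bar>deriv W a - deriv W b\<bar> \<le> L * \<bar>a - b\<bar>"
    using lipschitz_deriv_W by blast
  have u1: "u x t \<le> 1" if "t \<in> {0..T}" for x t using u that by (auto simp: solution_def abs_le_iff)
  show ?thesis
  proof (rule allen_cahn_comparison[OF \<epsilon> _ _ _ L(1), where T = T and u = u and M = 2 and V = V])
    show "classical_allen_cahn (deriv W) \<epsilon> T u" using u by (simp add: solution_def)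
    show "u x t \<le> 2" if "t \<in> {0..T}" for x t using u1[OF that, of x] by simp
    show "- 2 \<le> V x t" if "t \<in> {0..T}" for x t using V1[OF that, of x] by simp
    show "u x 0 \<le> V x 0" for x using u init by (simp add: solution_def)
    show "supersolution_at (deriv W) \<epsilon> T V x t" if "0 < t" "t \<le> T" "V x t < u x t" for x t
      using super[of t x] u1[of t x] that by auto
  qed (use L(2) V t in auto)
qed

text \<open>The corrected profile moves with an exponentially growing shift; it is only used where
  \<open>- \<delta> < d\<close>, the flat barrier only where \<open>d < - \<delta>/2\<close>. The quadratic part of the corrector makes the two
  cross in between.\<close>

definition upper where
  "upper B q0 \<epsilon> s t = \<theta> ((s + \<epsilon> * exp (B * t)) / \<epsilon>) + \<epsilon>\<^sup>2 * (q0 * (1 + 8 * s\<^sup>2 / \<delta>\<^sup>2))"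

text \<open>Equal to 1 on a ball that contains the tube at all times and exponentially small far
  out, so that an excess of order \<epsilon>^2 becomes integrable.\<close>

definition cutoff :: "real^'n \<Rightarrow> real"
  where "cutoff x = min 1 (exp (R + \<delta> + 1 - japanese x))"

text \<open>The factor 4 lies between the values 3 and 9 that 1 + 8 s^2 / \<delta>^2 takes at s = -
  \<delta>/2 and s = - \<delta>, and leaves one unit at the former for the tail of the
  profile.\<close>

definition flat :: "real \<Rightarrow> real \<Rightarrow> real^'n \<Rightarrow> real"
  where "flat q0 \<epsilon> x = - 1 + 4 * \<epsilon>\<^sup>2 * q0 * cutoff x"

definition barrier where
  "barrier B q0 \<epsilon> x t = (if d x t \<le> - (\<delta> / 2) then min (upper B q0 \<epsilon> (d x t) t) (flat q0 \<epsilon> x)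
     else upper B q0 \<epsilon> (d x t) t)"

text \<open>V lies below the corrected profile and touches it at the point considered, so the
  corrected profile is the test function; this is what admits minima of barriers. The constants C1,
  c1, q0, B, \<epsilon>0 are fixed in this order, each from earlier ones.\<close>

lemma upper_supersolution:
  obtains B q0 \<epsilon>0 where "B \<ge> 0" "q0 \<ge> 1" "\<epsilon>0 > 0"
    "\<And>\<epsilon> V x t. 0 < \<epsilon> \<Longrightarrow> \<epsilon> \<le> \<epsilon>0 \<Longrightarrow> \<epsilon> \<le> 1 \<Longrightarrow> t \<in> {0..T} \<Longrightarrow> \<bar>d x t\<bar> < \<delta> \<Longrightarrow> V x t = upper B q0 \<epsilon> (d x t) t \<Longrightarrow>
       (\<And>y s. s \<in> {0..T} \<Longrightarrow> V y s \<le> upper B q0 \<epsilon> (d y s) s) \<Longrightarrow> supersolution_at (deriv W) \<epsilon> T V x t"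
proof -
  note th = equilibrium_profile_bounds[OF W \<theta>]
  obtain c \<eta> where c: "c > 0" "0 < \<eta>" "\<eta> \<le> 1/4"
    "\<And>a q. \<bar>a\<bar> \<le> 1 \<Longrightarrow> 1 - \<eta> \<le> \<bar>a\<bar> \<Longrightarrow> 0 \<le> q \<Longrightarrow> q \<le> \<eta> \<Longrightarrow> deriv W (a + q) - deriv W a \<ge> c * q"
    using double_well_convex_near_wells[OF W] by blast
  obtain \<kappa>' M where M: "\<kappa>' > 0" "M > 0"
    "\<And>a. \<bar>a\<bar> \<le> 1 \<Longrightarrow> \<kappa>' * (1 - \<bar>a\<bar>) \<le> sqrt (2 * W a)"
    "\<And>a. \<bar>a\<bar> \<le> 1 \<Longrightarrow> sqrt (2 * W a) \<le> M * (1 - \<bar>a\<bar>)"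
    using sqrt_double_well_bounds[OF W] by metis
  obtain \<kappa> where \<kappa>: "\<kappa> > 0" "\<And>z. 1 - \<theta> z \<le> 2 * exp (- \<kappa> * z)" "\<And>z. \<theta> z + 1 \<le> 2 * exp (\<kappa> * z)"
    using equilibrium_profile_decay[OF W \<theta>] by metis
  obtain L where L: "L \<ge> 0"
    "\<And>a b. \<bar>a\<bar> \<le> 2 \<Longrightarrow> \<bar>b\<bar> \<le> 2 \<Longrightarrow> \<bar>deriv W a - deriv W b\<bar> \<le> L * \<bar>a - b\<bar>"
    using lipschitz_deriv_W by blast
  define C1 where "C1 = M * 2 / \<kappa>"
  have C1: "C1 \<ge> 0" using M \<kappa> by (simp add: C1_def)
  \<comment> \<open>\<theta>' decays like exp (- \<kappa> |z|), while \<kappa> |z| is at most exp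
    (\<kappa> |z|).\<close>
  have tail: "sqrt (2 * W (\<theta> z)) * \<bar>z\<bar> \<le> C1" for z
  proof -
    have "1 - \<bar>\<theta> z\<bar> \<le> 2 * exp (- \<kappa> * \<bar>z\<bar>)"
      using \<kappa>(2)[of z] \<kappa>(3)[of z] by (cases "z \<ge> 0") auto
    then have "1 - \<bar>\<theta> z\<bar> \<le> 2 * inverse (exp (\<kappa> * \<bar>z\<bar>))" by (simp add: exp_minus)
    moreover have "\<kappa> * \<bar>z\<bar> \<le> exp (\<kappa> * \<bar>z\<bar>)" using exp_ge_add_one_self[of "\<kappa> * \<bar>z\<bar>"] by linarith
    ultimately have "(1 - \<bar>\<theta> z\<bar>) * (\<kappa> * \<bar>z\<bar>) \<le> (2 * inverse (exp (\<kappa> * \<bar>z\<bar>))) * exp (\<kappa> * \<bar>z\<bar>)"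
      using \<kappa>(1) by (intro mult_mono) auto
    also have "\<dots> = 2" by simp
    finally have "(1 - \<bar>\<theta> z\<bar>) * (\<kappa> * \<bar>z\<bar>) \<le> 2" .
    then have "(1 - \<bar>\<theta> z\<bar>) * \<bar>z\<bar> \<le> 2 / \<kappa>"
      using \<kappa>(1) by (simp add: pos_le_divide_eq mult_ac)
    then have "M * ((1 - \<bar>\<theta> z\<bar>) * \<bar>z\<bar>) \<le> C1"
      using mult_left_mono[of _ _ M] M(2) by (fastforce simp: C1_def)
    moreover have "sqrt (2 * W (\<theta> z)) * \<bar>z\<bar> \<le> M * (1 - \<bar>\<theta> z\<bar>) * \<bar>z\<bar>"
      using M(4)[of "\<theta> z"] th(2)[of z] by (intro mult_right_mono) auto
    ultimately show ?thesis by simp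
  qed
  \<comment> \<open>Lower bound for \<theta>' where |\<theta>| < 1 - \<eta>, the range in which W''
    may be negative.\<close>
  define c1 where "c1 = \<kappa>' * \<eta>"
  have c1: "c1 > 0" using M c by (simp add: c1_def)
  \<comment> \<open>Gives c q0 / 2 \<ge> K C1: half of the convexity gain pays for the bounded part
    of the curvature error, the other half for the derivatives of the corrector.\<close>
  define q0 where "q0 = 1 + 2 * K * C1 / c"
  have q0: "q0 \<ge> 1" using K C1 c by (simp add: q0_def)
  \<comment> \<open>The drift surplus must cover both errors and the loss 9 L q0 where convexity
    fails; 9 q0 bounds the corrector in the tube.\<close>
  define B where "B = K + (K * C1 + c * q0 / 2 + 9 * L * q0) / c1"
  have B: "K \<le> B" "c1 * (B - K) = K * C1 + c * q0 / 2 + 9 * L * q0"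
    using K C1 c q0 L(1) c1 by (auto simp: B_def intro!: divide_nonneg_pos add_nonneg_nonneg)
  define C2 where "C2 = 16 * K + 16 / \<delta>\<^sup>2"
  have C2: "C2 > 0" using K \<delta> by (auto simp: C2_def intro!: add_nonneg_pos)
  \<comment> \<open>The first term keeps the corrector inside the convexity window \<eta>, the
    second keeps the cost of its derivatives below c q0 / 2.\<close>
  define \<epsilon>0 where "\<epsilon>0 = min (\<eta> / (9 * q0)) (c / (2 * C2))"
  have \<epsilon>0: "\<epsilon>0 > 0" using c q0 C2 by (simp add: \<epsilon>0_def)
  have Wnn: "W s \<ge> 0" for s using W by (auto simp: standard_double_well_def)
  show thesis
  proof (rule that[of B q0 \<epsilon>0])
    show "B \<ge> 0" "q0 \<ge> 1" "\<epsilon>0 > 0" using K B q0 \<epsilon>0 by auto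
    fix \<epsilon> V x t
    assume \<epsilon>: "0 < \<epsilon>" "\<epsilon> \<le> \<epsilon>0" "\<epsilon> \<le> (1::real)" and t: "t \<in> {0..T}" and x: "\<bar>d x t\<bar> < \<delta>"
      and V: "V x t = upper B q0 \<epsilon> (d x t) t" "\<And>y s. s \<in> {0..T} \<Longrightarrow> V y s \<le> upper B q0 \<epsilon> (d y s) s"
    have \<epsilon>sq: "\<epsilon>\<^sup>2 \<le> \<epsilon>" using \<epsilon> by (simp add: power2_eq_square mult_left_le)
    obtain g A b where g: "second_order_at (\<lambda>y. d y t) x g A" "norm g = 1"
      "((\<lambda>s. d x s) has_real_derivative b) (at t within {0..T})" "\<bar>b - optrace A\<bar> \<le> K * \<bar>d x t\<bar>"
      using d_tube[OF t x] unfolding tube_regular_at_def by blast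
    define p where "p = \<epsilon> * exp (B * t)"
    define F1 where "F1 = (\<lambda>s. sqrt (2 * W (\<theta> ((s + p) / \<epsilon>))) / \<epsilon> + \<epsilon>\<^sup>2 * (q0 * (16 * s / \<delta>\<^sup>2)))"
    define s where "s = d x t"
    define z where "z = (s + p) / \<epsilon>"
    define F2 where "F2 = deriv W (\<theta> z) / \<epsilon>\<^sup>2 + \<epsilon>\<^sup>2 * (16 * q0 / \<delta>\<^sup>2)"
    have lin: "((\<lambda>s. (s + p) / \<epsilon>) has_real_derivative 1 / \<epsilon>) (at s)" for s
      using \<epsilon>(1) by (auto intro!: derivative_eq_intros)
    have dF1: "((\<lambda>s. upper B q0 \<epsilon> s t) has_real_derivative F1 s) (at s)" for s
      unfolding upper_def F1_def p_def[symmetric]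
      by (rule DERIV_cong[OF DERIV_add[OF DERIV_chain2[OF th(4) lin]
            DERIV_cmult[OF has_real_derivative_corrector[OF DERIV_ident]]]]) (use \<delta> in auto)
    have dF2: "(F1 has_real_derivative F2) (at s)"
      unfolding F1_def F2_def z_def
      by (rule DERIV_cong[OF DERIV_add[OF DERIV_cdivide[OF DERIV_chain2[OF th(5) lin]]
            DERIV_cmult[of "\<lambda>s. q0 * (16 * s / \<delta>\<^sup>2)" "16 * q0 / \<delta>\<^sup>2"]]])
        (use \<delta> in \<open>auto intro!: derivative_eq_intros simp: power2_eq_square\<close>)
    have so: "second_order_at (\<lambda>y. upper B q0 \<epsilon> (d y t) t) x (F1 (d x t) *\<^sub>R g)
        (\<lambda>h. (F2 * (g \<bullet> h)) *\<^sub>R g + F1 (d x t) *\<^sub>R A h)"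
      by (rule second_order_at_compose[OF g(1)]) (use dF1 dF2 in \<open>auto simp: s_def\<close>)
    have tr: "optrace (\<lambda>h. (F2 * (g \<bullet> h)) *\<^sub>R g + F1 (d x t) *\<^sub>R A h) = F2 + F1 s * optrace A"
      using g(2) by (simp only: optrace_add optrace_rank_one optrace_scaleR) (simp add: s_def norm_eq_1)
    have shift: "((\<lambda>\<tau>. (d x \<tau> + \<epsilon> * exp (B * \<tau>)) / \<epsilon>) has_real_derivative (b + B * p) / \<epsilon>) (at t within {0..T})"
      unfolding p_def using \<epsilon>(1) by (auto intro!: derivative_eq_intros g(3))
    have quad: "((\<lambda>\<tau>. \<epsilon>\<^sup>2 * (q0 * (1 + 8 * (d x \<tau>)\<^sup>2 / \<delta>\<^sup>2))) has_real_derivative \<epsilon>\<^sup>2 * (q0 * (16 * s / \<delta>\<^sup>2)) * b) (at t within {0..T})"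
      by (rule DERIV_cong[OF DERIV_cmult[OF has_real_derivative_corrector[OF g(3)]]]) (use \<delta> in \<open>auto simp: s_def\<close>)
    have time: "((\<lambda>\<tau>. upper B q0 \<epsilon> (d x \<tau>) \<tau>) has_real_derivative
        F1 s * b + sqrt (2 * W (\<theta> z)) * (B * p / \<epsilon>)) (at t within {0..T})"
      unfolding upper_def
      by (rule DERIV_cong[OF DERIV_add[OF DERIV_chain2[OF th(4) shift] quad]])
        (simp add: F1_def z_def s_def p_def add_divide_distrib algebra_simps)
    define k where "k = q0 * (1 + 8 * s\<^sup>2 / \<delta>\<^sup>2)"
    have "s\<^sup>2 \<le> \<delta>\<^sup>2" using x by (intro abs_le_square_iff[THEN iffD1]) (auto simp: s_def)
    then have "8 * s\<^sup>2 / \<delta>\<^sup>2 \<le> 8" "8 * s\<^sup>2 / \<delta>\<^sup>2 \<ge> 0" using \<delta> by (auto simp: field_simps)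
    then have k: "q0 \<le> k" "k \<le> 9 * q0"
      using mult_left_mono[of 1 "1 + 8 * s\<^sup>2 / \<delta>\<^sup>2" q0] mult_left_mono[of "1 + 8 * s\<^sup>2 / \<delta>\<^sup>2" 9 q0] q0
      by (auto simp: k_def)
    have Vk: "V x t = \<theta> z + \<epsilon>\<^sup>2 * k" unfolding V(1) upper_def k_def z_def p_def s_def by simp
    have "\<epsilon>\<^sup>2 * k \<le> \<epsilon>0 * (9 * q0)" using \<epsilon>sq \<epsilon> k q0 by (intro mult_mono) auto
    also have "\<dots> \<le> \<eta> / (9 * q0) * (9 * q0)" using q0 by (intro mult_right_mono) (auto simp: \<epsilon>0_def)
    finally have k\<eta>: "\<epsilon>\<^sup>2 * k \<le> \<eta>" using q0 by simp
    have k0: "\<epsilon>\<^sup>2 * k \<ge> 0" using k q0 by simp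
    have "0 \<le> (F1 s) * b + sqrt (2 * W (\<theta> z)) * (B * p / \<epsilon>) - (F2 + F1 s * optrace A) + deriv W (\<theta> z + \<epsilon>\<^sup>2 * k) / \<epsilon>\<^sup>2"
      unfolding F1_def F2_def z_def[symmetric]
    proof (rule profile_residual_nonneg[where K = K and \<delta> = \<delta> and ?C1.0 = C1 and ?C2.0 = C2 and c = c
          and ?q0.0 = q0 and L = L and ?c1.0 = c1 and z = z and s = s])
      show "s = \<epsilon> * z - p" using \<epsilon> by (simp add: z_def)
      have "exp (B * t) \<ge> 1" using K B t by simp
      then show "\<epsilon> \<le> p" using \<epsilon> by (simp add: p_def)
      show "\<bar>b - optrace A\<bar> \<le> K * \<bar>s\<bar>" using g(4) by (simp add: s_def)
      have "K * \<delta> * \<bar>q0 * (16 * s / \<delta>\<^sup>2)\<bar> = 16 * K * q0 * (\<bar>s\<bar> / \<delta>)"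
        using q0 \<delta> by (simp add: abs_mult power2_eq_square)
      also have "\<dots> \<le> 16 * K * q0 * 1"
        using x \<delta> K q0 by (intro mult_left_mono) (auto simp: s_def)
      finally show "K * \<delta> * \<bar>q0 * (16 * s / \<delta>\<^sup>2)\<bar> + 16 * q0 / \<delta>\<^sup>2 \<le> q0 * C2"
        by (simp add: C2_def algebra_simps)
      have "\<epsilon>\<^sup>2 * C2 \<le> c / (2 * C2) * C2"
        using \<epsilon>sq \<epsilon> C2 by (intro mult_right_mono) (auto simp: \<epsilon>0_def)
      then show "\<epsilon>\<^sup>2 * C2 \<le> c / 2" using C2 by simp
      show "K * C1 \<le> c * q0 / 2" using c by (simp add: q0_def field_simps)
      show "deriv W (\<theta> z + \<epsilon>\<^sup>2 * k) - deriv W (\<theta> z) \<ge> c * (\<epsilon>\<^sup>2 * k) \<or>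
        (sqrt (2 * W (\<theta> z)) \<ge> c1 \<and> deriv W (\<theta> z + \<epsilon>\<^sup>2 * k) - deriv W (\<theta> z) \<ge> - L * (\<epsilon>\<^sup>2 * k))"
      proof (cases "1 - \<eta> \<le> \<bar>\<theta> z\<bar>")
        case True
        then show ?thesis using c(4)[of "\<theta> z" "\<epsilon>\<^sup>2 * k"] th(2)[of z] k\<eta> k0 by auto
      next
        case False
        have "\<kappa>' * \<eta> \<le> \<kappa>' * (1 - \<bar>\<theta> z\<bar>)" using False M by (intro mult_left_mono) auto
        then have "sqrt (2 * W (\<theta> z)) \<ge> c1" using M(3)[of "\<theta> z"] th(2)[of z] by (simp add: c1_def)
        moreover have "\<bar>deriv W (\<theta> z + \<epsilon>\<^sup>2 * k) - deriv W (\<theta> z)\<bar> \<le> L * \<bar>\<theta> z + \<epsilon>\<^sup>2 * k - \<theta> z\<bar>"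
          using th(2)[of z] k\<eta> k0 c(3) by (intro L(2)) (auto simp: abs_le_iff abs_less_iff)
        ultimately show ?thesis using k0 by (auto simp: abs_le_iff)
      qed
    qed (use \<epsilon> x K tail k q0 B L c Wnn in \<open>auto simp: s_def\<close>)
    then show "supersolution_at (deriv W) \<epsilon> T V x t"
      by (intro supersolution_atI[OF so time]) (use V t Vk tr in \<open>auto simp: eventually_at_filter\<close>)
  qed
qed

section \<open>The flat barrier and the pointwise bounds for u\<close>

lemma cutoff_bounds: "0 \<le> cutoff x" "cutoff x \<le> 1" "cutoff x \<le> exp (R + \<delta> + 1 - japanese x)"
  by (auto simp: cutoff_def)

lemma cutoff_tube: assumes "t \<in> {0..T}" "\<bar>d x t\<bar> \<le> \<delta>" shows "cutoff x = 1"
  using d_far[OF assms(1), of x] assms(2) japanese_bounds(2)[of x] by (simp add: cutoff_def)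

text \<open>\<open>cutoff\<close> is a minimum, so at each point one of its smooth branches touches
  it from above: the constant, or the exponential, whose Laplacian is at most twice its value. The
  reaction near -1, divided by \<epsilon>^2, beats this once 2 \<epsilon>^2 \<le> c.\<close>

lemma flat_supersolution:
  assumes c: "c > 0" "0 < \<eta>" "\<And>q. 0 \<le> q \<Longrightarrow> q \<le> \<eta> \<Longrightarrow> deriv W (- 1 + q) \<ge> c * q"
    and \<epsilon>: "0 < \<epsilon>" "4 * \<epsilon>\<^sup>2 * q0 \<le> \<eta>" "2 * \<epsilon>\<^sup>2 \<le> c" and q0: "q0 \<ge> 0"
    and t: "t \<in> {0..T}" and x: "d x t < - (\<delta> / 2)" and V: "V x t = flat q0 \<epsilon> x"
    and V': "\<And>y s. s \<in> {0..T} \<Longrightarrow> d y s < - (\<delta> / 2) \<Longrightarrow> V y s \<le> flat q0 \<epsilon> y"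
  shows "supersolution_at (deriv W) \<epsilon> T V x t"
proof -
  define a where "a = 4 * \<epsilon>\<^sup>2 * q0"
  have a: "0 \<le> a" "a \<le> \<eta>" using q0 \<epsilon> by (auto simp: a_def)
  have flat: "flat q0 \<epsilon> y = - 1 + a * cutoff y" for y by (simp add: flat_def a_def)
  have Vs: "\<forall>\<^sub>F y in nhds x. V y t \<le> - 1 + a * cutoff y"
    using d_less_nearby(1)[OF t x] by eventually_elim (use V'[OF t] in \<open>simp add: flat\<close>)
  have "\<forall>\<^sub>F s in at t within {0..T}. s \<in> {0..T}" by (auto simp: eventually_at_filter)
  with d_less_nearby(2)[OF t x] have Vt: "\<forall>\<^sub>F s in at t within {0..T}. V x s \<le> V x t"
    by eventually_elim (use V' V in simp)
  show ?thesis
  proof (cases "japanese x \<le> R + \<delta> + 1")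
    case True
    then have cx: "cutoff x = 1" by (simp add: cutoff_def)
    have "\<forall>\<^sub>F y in nhds x. V y t \<le> - 1 + a"
      using Vs by eventually_elim (use mult_left_le[OF cutoff_bounds(2) a(1)] in \<open>force intro: order_trans\<close>)
    moreover have "deriv W (- 1 + a) \<ge> 0"
      using c(3)[OF a] a c(1) by (meson mult_nonneg_nonneg less_imp_le order_trans)
    ultimately show ?thesis
      by (intro supersolution_atI[OF second_order_at_const[of "- 1 + a"] DERIV_const[of "V x t"]])
        (use Vt V in \<open>auto simp: flat cx optrace_zero\<close>)
  next
    case False
    define b where "b = a * exp (R + \<delta> + 1)"
    have "cutoff x = exp (R + \<delta> + 1 - japanese x)" using False by (simp add: cutoff_def)
    then have cx: "a * cutoff x = b * exp (- 1 * japanese x)"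
      by (simp add: b_def exp_diff exp_minus divide_inverse)
    have cle: "a * cutoff y \<le> b * exp (- 1 * japanese y)" for y
      using mult_left_mono[OF cutoff_bounds(3) a(1), of y] by (simp add: b_def exp_diff exp_minus divide_inverse)
    have b: "b \<ge> 0" using a by (simp add: b_def)
    obtain g A where A: "second_order_at (\<lambda>y. exp (- 1 * japanese y)) x g A"
      "optrace A \<le> (1\<^sup>2 + 1) * exp (- 1 * japanese x)"
      using second_order_at_exp_japanese[of 1 x] by auto
    define y where "y = a * cutoff x"
    have y: "0 \<le> y" "y \<le> \<eta>" using a mult_left_le[OF cutoff_bounds(2)[of x] a(1)] cutoff_bounds(1)[of x] by (auto simp: y_def)
    have so: "second_order_at (\<lambda>y. - 1 + b * exp (- 1 * japanese y)) x (0 + b *\<^sub>R g) (\<lambda>h. 0 + b *\<^sub>R A h)"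
      by (intro second_order_at_add second_order_at_const second_order_at_cmult A(1))
    have tr: "optrace (\<lambda>h. 0 + b *\<^sub>R A h) \<le> 2 * y"
      using mult_left_mono[OF A(2) b] cx by (simp add: optrace_scaleR y_def)
    have "2 * y * \<epsilon>\<^sup>2 \<le> c * y" using mult_right_mono[OF \<epsilon>(3) y(1)] by (simp add: mult_ac)
    then have "2 * y * \<epsilon>\<^sup>2 \<le> deriv W (- 1 + y)" using c(3)[OF y] by simp
    then have "2 * y \<le> deriv W (- 1 + y) / \<epsilon>\<^sup>2" using \<epsilon>(1) by (simp add: pos_le_divide_eq)
    then have res: "0 - optrace (\<lambda>h. 0 + b *\<^sub>R A h) + deriv W (V x t) / \<epsilon>\<^sup>2 \<ge> 0"
      using tr V by (simp add: flat y_def)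
    have "\<forall>\<^sub>F y in nhds x. V y t \<le> - 1 + b * exp (- 1 * japanese y)"
      using Vs by eventually_elim (use cle in \<open>smt (verit)\<close>)
    then show ?thesis
      by (intro supersolution_atI[OF so DERIV_const[of "V x t"]]) (use V Vt res cx in \<open>auto simp: flat\<close>)
  qed
qed

text \<open>The third power turns exponential smallness in 1 / \<epsilon> into \<epsilon>^3, one
  order better than the corrector, so that a small \<epsilon> absorbs the constant.\<close>

lemma exp_tail:
  assumes "y > (0::real)" shows "exp (- y) \<le> (3 / y) ^ 3"
proof -
  have "(y / 3) ^ 3 \<le> exp (y / 3) ^ 3"
    using assms exp_ge_add_one_self[of "y / 3"] by (intro power_mono) linarith+
  also have "exp (y / 3) ^ 3 = exp y" by (simp add: exp_of_nat_mult[symmetric])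
  finally have "inverse (exp y) \<le> inverse ((y / 3) ^ 3)" using assms by (intro le_imp_inverse_le) auto
  then show ?thesis by (simp add: exp_minus power_inverse[symmetric])
qed

lemma upper_bound_small:
  obtains \<epsilon>0 C \<kappa> where "\<epsilon>0 > 0" "C \<ge> 0" "\<kappa> > 0"
    "\<And>\<epsilon> u x t. 0 < \<epsilon> \<Longrightarrow> \<epsilon> \<le> \<epsilon>0 \<Longrightarrow> \<epsilon> \<le> 1 \<Longrightarrow> solution \<epsilon> u \<Longrightarrow> t \<in> {0..T} \<Longrightarrow> d x t \<le> 0 \<Longrightarrow>
       u x t + 1 \<le> C * (\<epsilon>\<^sup>2 * cutoff x + (if \<bar>d x t\<bar> \<le> \<delta> / 2 then exp (- (\<kappa> * \<bar>d x t\<bar> / \<epsilon>)) else 0))"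
proof -
  note th = equilibrium_profile_bounds[OF W \<theta>]
  obtain c \<eta> where c: "c > 0" "0 < \<eta>" "\<eta> \<le> 1/4"
    "\<And>a q. \<bar>a\<bar> \<le> 1 \<Longrightarrow> 1 - \<eta> \<le> \<bar>a\<bar> \<Longrightarrow> 0 \<le> q \<Longrightarrow> q \<le> \<eta> \<Longrightarrow> deriv W (a + q) - deriv W a \<ge> c * q"
    using double_well_convex_near_wells[OF W] by blast
  have c': "deriv W (- 1 + q) \<ge> c * q" if "0 \<le> q" "q \<le> \<eta>" for q
    using c(4)[of "- 1" q] that c(2) double_well_deriv_one[OF W] by simp
  obtain \<kappa> where \<kappa>: "\<kappa> > 0" "\<And>z. 1 - \<theta> z \<le> 2 * exp (- \<kappa> * z)" "\<And>z. \<theta> z + 1 \<le> 2 * exp (\<kappa> * z)"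
    using equilibrium_profile_decay[OF W \<theta>] by metis
  obtain B q0 \<epsilon>1 where up: "B \<ge> 0" "q0 \<ge> 1" "\<epsilon>1 > 0"
    "\<And>\<epsilon> V x t. 0 < \<epsilon> \<Longrightarrow> \<epsilon> \<le> \<epsilon>1 \<Longrightarrow> \<epsilon> \<le> 1 \<Longrightarrow> t \<in> {0..T} \<Longrightarrow> \<bar>d x t\<bar> < \<delta> \<Longrightarrow> V x t = upper B q0 \<epsilon> (d x t) t \<Longrightarrow>
       (\<And>y s. s \<in> {0..T} \<Longrightarrow> V y s \<le> upper B q0 \<epsilon> (d y s) s) \<Longrightarrow> supersolution_at (deriv W) \<epsilon> T V x t"
    using upper_supersolution by blast
  \<comment> \<open>In order: the profile is a supersolution; the reaction beats the Laplacian of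
    the flat barrier; that barrier stays in the convexity window; the shift is at most \<delta>/4;
    the tail of the profile is below \<epsilon>^2 q0; and half of the initial decay rate, \<kappa> /
    (2 \<epsilon>), is at least 1.\<close>
  define \<epsilon>0 where "\<epsilon>0 = Min {\<epsilon>1, c / 2, \<eta> / (4 * q0), \<delta> / (4 * exp (B * T)), q0 * (\<kappa> * \<delta> / 12) ^ 3 / 2, \<kappa> / 2}"
  have \<epsilon>0: "\<epsilon>0 > 0" unfolding \<epsilon>0_def using up c \<delta> \<kappa> by simp
  have \<epsilon>0': "\<epsilon>0 \<le> \<epsilon>1" "\<epsilon>0 \<le> c / 2" "\<epsilon>0 \<le> \<eta> / (4 * q0)" "\<epsilon>0 \<le> \<delta> / (4 * exp (B * T))"
    "\<epsilon>0 \<le> q0 * (\<kappa> * \<delta> / 12) ^ 3 / 2" "\<epsilon>0 \<le> \<kappa> / 2"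
    unfolding \<epsilon>0_def by (intro Min_le; simp)+
  define C where "C = 2 * exp (\<kappa> * exp (B * T)) + 4 * q0"
  have C: "4 * q0 \<le> C" "2 * exp (\<kappa> * exp (B * T)) \<le> C" using up by (auto simp: C_def)
  show thesis
  proof (rule that[of \<epsilon>0 C \<kappa>])
    show "\<epsilon>0 > 0" "\<kappa> > 0" by fact+
    show "C \<ge> 0" using C up by simp
    fix \<epsilon> u x t
    assume \<epsilon>: "0 < \<epsilon>" "\<epsilon> \<le> \<epsilon>0" "\<epsilon> \<le> 1" and u: "solution \<epsilon> u" and t: "t \<in> {0..T}" and x: "d x t \<le> 0"
    have \<epsilon>sq: "\<epsilon>\<^sup>2 \<le> \<epsilon>" "\<epsilon>\<^sup>2 > 0" using \<epsilon> by (auto simp: power2_eq_square mult_left_le)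
    define Y where "Y = \<epsilon>\<^sup>2 * q0"
    have Y: "Y > 0" using \<epsilon>sq up by (simp add: Y_def)
    have tail: "2 * exp (- (\<kappa> * \<delta> / (4 * \<epsilon>))) \<le> Y"
    proof -
      have "2 * exp (- (\<kappa> * \<delta> / (4 * \<epsilon>))) \<le> 2 * (3 / (\<kappa> * \<delta> / (4 * \<epsilon>))) ^ 3"
        using \<kappa> \<delta> \<epsilon> by (intro mult_left_mono exp_tail) auto
      also have "\<dots> = \<epsilon>\<^sup>2 * (2 * \<epsilon> / (\<kappa> * \<delta> / 12) ^ 3)"
        using \<kappa> \<delta> \<epsilon> by (simp add: field_simps power2_eq_square power3_eq_cube)
      also have "2 * \<epsilon> / (\<kappa> * \<delta> / 12) ^ 3 \<le> q0"
      proof -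
        have "2 * \<epsilon> \<le> q0 * (\<kappa> * \<delta> / 12) ^ 3" using \<epsilon>(2) \<epsilon>0'(5) by linarith
        then show ?thesis using \<kappa> \<delta> by (subst pos_divide_le_eq) auto
      qed
      finally show ?thesis using \<epsilon>sq by (simp add: Y_def mult_left_mono)
    qed
    have p: "\<epsilon> * exp (B * s) \<le> \<delta> / 4" "exp (B * s) \<le> exp (B * T)" "1 \<le> exp (B * s)" if "s \<in> {0..T}" for s
    proof -
      show e: "exp (B * s) \<le> exp (B * T)" "1 \<le> exp (B * s)" using that up(1) by (auto simp: mult_left_mono)
      have "\<epsilon> * exp (B * s) \<le> \<delta> / (4 * exp (B * T)) * exp (B * T)"
        using e \<epsilon> \<epsilon>0'(4) \<delta> by (intro mult_mono) auto
      then show "\<epsilon> * exp (B * s) \<le> \<delta> / 4" by simp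
    qed
    have up_ge: "upper B q0 \<epsilon> a s \<ge> \<theta> (a / \<epsilon>) + Y" for a s
    proof -
      have "\<theta> (a / \<epsilon>) \<le> \<theta> ((a + \<epsilon> * exp (B * s)) / \<epsilon>)"
        using \<epsilon> by (intro monoD[OF th(1)] divide_right_mono) auto
      moreover have "Y * 1 \<le> Y * (1 + 8 * a\<^sup>2 / \<delta>\<^sup>2)" using Y by (intro mult_left_mono) auto
      ultimately show ?thesis by (simp add: upper_def Y_def mult.assoc)
    qed
    have up_le: "upper B q0 \<epsilon> a s \<le> - 1 + 2 * exp (\<kappa> * (a + \<epsilon> * exp (B * s)) / \<epsilon>) + 3 * Y"
      if "\<bar>a\<bar> \<le> \<delta> / 2" for a s
    proof -
      have "a\<^sup>2 \<le> (\<delta> / 2)\<^sup>2" using that \<delta> by (intro abs_le_square_iff[THEN iffD1]) auto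
      then have "8 * a\<^sup>2 / \<delta>\<^sup>2 \<le> 2" using \<delta> by (simp add: field_simps power2_eq_square)
      then have "Y * (1 + 8 * a\<^sup>2 / \<delta>\<^sup>2) \<le> Y * 3" using Y by (intro mult_left_mono) auto
      then show ?thesis using \<kappa>(3)[of "(a + \<epsilon> * exp (B * s)) / \<epsilon>"] by (simp add: upper_def Y_def mult.assoc)
    qed
    \<comment> \<open>The shift leaves a distance of at least \<delta>/4 to the centre of the
      profile: 3 Y from the corrector and Y from the tail against 4 Y.\<close>
    have F1: "upper B q0 \<epsilon> (d y s) s \<le> flat q0 \<epsilon> y" if "d y s = - (\<delta> / 2)" "s \<in> {0..T}" for y s
    proof -
      have "cutoff y = 1" using that \<delta> by (intro cutoff_tube[of s]) auto
      have "\<kappa> * (d y s + \<epsilon> * exp (B * s)) / \<epsilon> \<le> \<kappa> * (- (\<delta> / 4)) / \<epsilon>"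
        using p(1)[OF that(2)] that \<kappa> \<epsilon> by (intro divide_right_mono mult_left_mono) auto
      then have "exp (\<kappa> * (d y s + \<epsilon> * exp (B * s)) / \<epsilon>) \<le> exp (- (\<kappa> * \<delta> / (4 * \<epsilon>)))"
        by simp
      moreover have "\<bar>d y s\<bar> \<le> \<delta> / 2" using that \<delta> by simp
      ultimately have "upper B q0 \<epsilon> (d y s) s \<le> - 1 + 4 * Y" using up_le[of "d y s" s] tail by linarith
      then show ?thesis using \<open>cutoff y = 1\<close> by (simp add: flat_def Y_def)
    qed
    have F2: "upper B q0 \<epsilon> a s \<ge> 1" if "a \<ge> \<delta>" for a s
    proof -
      have "\<kappa> * \<delta> / (4 * \<epsilon>) \<le> \<kappa> * (a / \<epsilon>)" using that \<kappa> \<epsilon> \<delta> by (simp add: field_simps)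
      then have "exp (- \<kappa> * (a / \<epsilon>)) \<le> exp (- (\<kappa> * \<delta> / (4 * \<epsilon>)))" by simp
      then show ?thesis using up_ge[of a s] \<kappa>(2)[of "a / \<epsilon>"] tail by linarith
    qed
    have F3: "flat q0 \<epsilon> y < upper B q0 \<epsilon> a s" if "a \<le> - \<delta>" for y a s
    proof -
      have "\<delta>\<^sup>2 \<le> a\<^sup>2" using that \<delta> by (intro abs_le_square_iff[THEN iffD1]) auto
      then have "9 \<le> 1 + 8 * a\<^sup>2 / \<delta>\<^sup>2" using \<delta> by (simp add: field_simps)
      then have "Y * 9 \<le> Y * (1 + 8 * a\<^sup>2 / \<delta>\<^sup>2)" using Y by (intro mult_left_mono) auto
      moreover have "- 1 < \<theta> ((a + \<epsilon> * exp (B * s)) / \<epsilon>)" using th(2) by (simp add: abs_less_iff minus_less_iff)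
      ultimately have "- 1 + 9 * Y < upper B q0 \<epsilon> a s" by (simp add: upper_def Y_def mult.assoc)
      moreover have "4 * Y * cutoff y \<le> 4 * Y * 1" using Y cutoff_bounds(2)[of y] by (intro mult_left_mono) auto
      then have "flat q0 \<epsilon> y \<le> - 1 + 4 * Y" by (simp add: flat_def Y_def)
      ultimately show ?thesis using Y by simp
    qed
    \<comment> \<open>The exponential is split into two equal factors: one is small of order Y, the
      other decays in space at least as fast as the cutoff.\<close>
    have init_flat: "\<theta> (d y 0 / \<epsilon>) \<le> flat q0 \<epsilon> y" if dy: "d y 0 \<le> - (\<delta> / 2)" for y
    proof -
      have "\<kappa> * d y 0 / (2 * \<epsilon>) \<le> \<kappa> * (- (\<delta> / 2)) / (2 * \<epsilon>)"
        using dy \<kappa> \<epsilon> by (intro divide_right_mono mult_left_mono) auto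
      then have 1: "exp (\<kappa> * d y 0 / (2 * \<epsilon>)) \<le> exp (- (\<kappa> * \<delta> / (4 * \<epsilon>)))" by simp
      have dneg: "d y 0 \<le> 0" using dy \<delta> by simp
      have "1 \<le> \<kappa> / (2 * \<epsilon>)" using \<epsilon> \<epsilon>0'(6) by (simp add: pos_le_divide_eq)
      then have "\<kappa> / (2 * \<epsilon>) * d y 0 \<le> 1 * d y 0" using dneg by (rule mult_right_mono_neg)
      then have le: "\<kappa> * d y 0 / (2 * \<epsilon>) \<le> d y 0" by simp
      have "norm y - R \<le> \<bar>d y 0\<bar>" using d_far[of 0 y] T by simp
      then have "d y 0 \<le> R + \<delta> + 1 - japanese y" using dneg japanese_bounds(2)[of y] \<delta> by linarith
      then have 2: "exp (\<kappa> * d y 0 / (2 * \<epsilon>)) \<le> cutoff y" using le dneg by (simp add: cutoff_def)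
      have "\<theta> (d y 0 / \<epsilon>) + 1 \<le> 2 * exp (\<kappa> * d y 0 / (2 * \<epsilon>) + \<kappa> * d y 0 / (2 * \<epsilon>))"
        using \<kappa>(3)[of "d y 0 / \<epsilon>"] by simp
      also have "\<dots> = (2 * exp (\<kappa> * d y 0 / (2 * \<epsilon>))) * exp (\<kappa> * d y 0 / (2 * \<epsilon>))" by (simp only: exp_add)
      also have "\<dots> \<le> Y * cutoff y"
        by (rule mult_mono) (use 1 2 tail Y in \<open>linarith | simp\<close>)+
      also have "\<dots> \<le> (4 * Y) * cutoff y" using Y cutoff_bounds(1)[of y] by (intro mult_right_mono) auto
      finally show ?thesis by (simp add: flat_def Y_def mult.assoc)
    qed
    define V where "V = barrier B q0 \<epsilon>"
    have Vup: "V y s \<le> upper B q0 \<epsilon> (d y s) s" for y s by (simp add: V_def barrier_def)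
    have Vflat: "V y s \<le> flat q0 \<epsilon> y" if "d y s < - (\<delta> / 2)" for y s using that by (simp add: V_def barrier_def)
    have "u x t \<le> V x t"
    proof (rule comparison[OF \<epsilon>(1) u _ _ _ _ t])
      show "- 1 \<le> V y s" for y s
      proof -
        have "- 1 \<le> \<theta> (d y s / \<epsilon>)" using th(2)[of "d y s / \<epsilon>"] by (simp add: abs_less_iff)
        then have "- 1 \<le> upper B q0 \<epsilon> (d y s) s" using up_ge[of "d y s" s] Y by linarith
        moreover have "0 \<le> 4 * Y * cutoff y" using cutoff_bounds(1)[of y] Y by (intro mult_nonneg_nonneg) auto
        then have "- 1 \<le> flat q0 \<epsilon> y" by (simp add: flat_def Y_def)
        ultimately show ?thesis by (simp add: V_def barrier_def)
      qed
      show "\<theta> (d y 0 / \<epsilon>) \<le> V y 0" for y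
        using up_ge[of "d y 0" 0] Y init_flat[of y] by (auto simp: V_def barrier_def)
      have "continuous_on UNIV \<theta>"
        using th(4) by (intro DERIV_continuous_on) (auto intro: has_field_derivative_at_within)
      then have th_cont: "continuous_on S (\<lambda>z. \<theta> (h z))" if "continuous_on S h" for S and h :: "(real^'n) \<times> real \<Rightarrow> real"
        using continuous_on_compose2[OF _ that] by auto
      have dc: "continuous_on (UNIV \<times> {0..T}) (\<lambda>z. d (fst z) (snd z))"
        using d_cont by (simp add: case_prod_unfold)
      have uc: "continuous_on (UNIV \<times> {0..T}) (\<lambda>z. upper B q0 \<epsilon> (d (fst z) (snd z)) (snd z))"
        unfolding upper_def using \<epsilon> \<delta> by (intro continuous_intros th_cont dc) auto
      have fc: "continuous_on (UNIV \<times> {0..T}) (\<lambda>z. flat q0 \<epsilon> (fst z))"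
        unfolding flat_def cutoff_def by (intro continuous_intros)
      have "continuous_on (UNIV \<times> {0..T}) (\<lambda>z. if d (fst z) (snd z) \<le> - (\<delta> / 2)
          then min (upper B q0 \<epsilon> (d (fst z) (snd z)) (snd z)) (flat q0 \<epsilon> (fst z))
          else upper B q0 \<epsilon> (d (fst z) (snd z)) (snd z))"
      proof (rule continuous_on_cases_le)
        show "continuous_on {z \<in> UNIV \<times> {0..T}. d (fst z) (snd z) \<le> - (\<delta> / 2)}
            (\<lambda>z. min (upper B q0 \<epsilon> (d (fst z) (snd z)) (snd z)) (flat q0 \<epsilon> (fst z)))"
          by (rule continuous_on_subset[OF continuous_on_min[OF uc fc]]) auto
        show "continuous_on {z \<in> UNIV \<times> {0..T}. - (\<delta> / 2) \<le> d (fst z) (snd z)}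
            (\<lambda>z. upper B q0 \<epsilon> (d (fst z) (snd z)) (snd z))"
          by (rule continuous_on_subset[OF uc]) auto
      qed (use dc F1 in \<open>auto simp: min_def\<close>)
      then show "continuous_on (UNIV \<times> {0..T}) (\<lambda>(x, t). V x t)"
        by (simp add: V_def barrier_def case_prod_unfold)
      show "supersolution_at (deriv W) \<epsilon> T V y s" if s: "0 < s" "s \<le> T" and V1: "V y s < 1" for y s
      proof -
        have sT: "s \<in> {0..T}" using s by simp
        consider (up) "V y s = upper B q0 \<epsilon> (d y s) s" "\<bar>d y s\<bar> < \<delta>"
          | (flat) "V y s = flat q0 \<epsilon> y" "d y s < - (\<delta> / 2)"
        proof (cases "d y s \<le> - (\<delta> / 2)")
          case True
          show ?thesis
          proof (cases "upper B q0 \<epsilon> (d y s) s \<le> flat q0 \<epsilon> y")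
            case le: True
            have "d y s > - \<delta>" using F3[of "d y s" y s] le by linarith
            then show ?thesis using True le \<delta> by (intro up) (auto simp: V_def barrier_def)
          next
            case gt: False
            then have "d y s \<noteq> - (\<delta> / 2)" using F1[OF _ sT] by auto
            then show ?thesis using True gt by (intro flat) (auto simp: V_def barrier_def)
          qed
        next
          case False
          then have V: "V y s = upper B q0 \<epsilon> (d y s) s" by (simp add: V_def barrier_def)
          then have "d y s < \<delta>" using F2[of "d y s" s] V1 by linarith
          then show ?thesis using V False \<delta> by (intro up) auto
        qed
        then show ?thesis
        proof cases
          case up': up
          show ?thesis
            using \<epsilon> \<epsilon>0'(1) by (intro up(4)[where V = V, OF \<epsilon>(1) _ \<epsilon>(3) sT up'(2,1)] Vup) auto
        next
          case flat
          show ?thesis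
          proof (rule flat_supersolution[where V = V, OF c(1,2) c' \<epsilon>(1) _ _ _ sT flat(2,1)])
            have "\<epsilon>\<^sup>2 * (4 * q0) \<le> \<eta> / (4 * q0) * (4 * q0)"
              using \<epsilon>sq \<epsilon> \<epsilon>0'(3) up by (intro mult_right_mono) auto
            then show "4 * \<epsilon>\<^sup>2 * q0 \<le> \<eta>" using up by (simp add: mult_ac)
            show "2 * \<epsilon>\<^sup>2 \<le> c" using \<epsilon>sq \<epsilon> \<epsilon>0'(2) by linarith
            show "0 \<le> q0" using up by simp
          qed (use Vflat in auto)
        qed
      qed
    qed
    moreover have "V x t + 1 \<le> C * (\<epsilon>\<^sup>2 * cutoff x + (if \<bar>d x t\<bar> \<le> \<delta> / 2 then exp (- (\<kappa> * \<bar>d x t\<bar> / \<epsilon>)) else 0))"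
    proof (cases "\<bar>d x t\<bar> \<le> \<delta> / 2")
      case True
      have cx: "cutoff x = 1" using True \<delta> by (intro cutoff_tube[OF t]) auto
      have "\<kappa> * (d x t + \<epsilon> * exp (B * t)) / \<epsilon> = - (\<kappa> * \<bar>d x t\<bar> / \<epsilon>) + \<kappa> * exp (B * t)"
        using x \<epsilon> by (simp add: field_simps)
      then have "exp (\<kappa> * (d x t + \<epsilon> * exp (B * t)) / \<epsilon>) = exp (- (\<kappa> * \<bar>d x t\<bar> / \<epsilon>)) * exp (\<kappa> * exp (B * t))"
        by (simp only: exp_add)
      also have "\<dots> \<le> exp (- (\<kappa> * \<bar>d x t\<bar> / \<epsilon>)) * exp (\<kappa> * exp (B * T))"
        using p(2)[OF t] \<kappa> by (intro mult_left_mono) auto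
      finally have "V x t + 1 \<le> 2 * (exp (- (\<kappa> * \<bar>d x t\<bar> / \<epsilon>)) * exp (\<kappa> * exp (B * T))) + 3 * Y"
        using Vup[of x t] up_le[OF True, of t] by linarith
      also have "\<dots> \<le> exp (- (\<kappa> * \<bar>d x t\<bar> / \<epsilon>)) * C + \<epsilon>\<^sup>2 * C"
      proof (rule add_mono)
        show "2 * (exp (- (\<kappa> * \<bar>d x t\<bar> / \<epsilon>)) * exp (\<kappa> * exp (B * T))) \<le> exp (- (\<kappa> * \<bar>d x t\<bar> / \<epsilon>)) * C"
          using mult_left_mono[OF C(2), of "exp (- (\<kappa> * \<bar>d x t\<bar> / \<epsilon>))"] by (simp add: mult_ac)
        show "3 * Y \<le> \<epsilon>\<^sup>2 * C"
          using mult_left_mono[OF C(1), of "\<epsilon>\<^sup>2"] Y by (simp add: Y_def mult_ac)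
      qed
      finally show ?thesis using True cx by (simp add: algebra_simps)
    next
      case False
      then have "V x t + 1 \<le> 4 * Y * cutoff x" using Vflat[of x t] x by (simp add: flat_def Y_def mult.assoc)
      also have "\<dots> = 4 * q0 * (\<epsilon>\<^sup>2 * cutoff x)" by (simp add: Y_def)
      also have "\<dots> \<le> C * (\<epsilon>\<^sup>2 * cutoff x)" using C(1) cutoff_bounds(1)[of x] by (intro mult_right_mono) auto
      finally show ?thesis using False by simp
    qed
    ultimately show "u x t + 1 \<le> C * (\<epsilon>\<^sup>2 * cutoff x + (if \<bar>d x t\<bar> \<le> \<delta> / 2 then exp (- (\<kappa> * \<bar>d x t\<bar> / \<epsilon>)) else 0))"
      by linarith
  qed
qed

text \<open>For \<epsilon> \<ge> \<epsilon>0 a bound independent of \<epsilon> is enough. The growth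
  rate \<Lambda> absorbs the Laplacian and the reaction, whose Lipschitz constant is at most L /
  \<epsilon>0^2.\<close>

lemma upper_bound_large:
  assumes \<epsilon>0: "\<epsilon>0 > 0"
  obtains C \<kappa> where "C \<ge> 0" "\<kappa> > 0"
    "\<And>\<epsilon> u x t. \<epsilon>0 \<le> \<epsilon> \<Longrightarrow> \<epsilon> \<le> 1 \<Longrightarrow> solution \<epsilon> u \<Longrightarrow> t \<in> {0..T} \<Longrightarrow> d x t \<le> 0 \<Longrightarrow>
       u x t + 1 \<le> C * exp (- \<kappa> * japanese x)"
proof -
  note th = equilibrium_profile_bounds[OF W \<theta>]
  obtain \<kappa> where \<kappa>: "\<kappa> > 0" "\<And>z. 1 - \<theta> z \<le> 2 * exp (- \<kappa> * z)" "\<And>z. \<theta> z + 1 \<le> 2 * exp (\<kappa> * z)"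
    using equilibrium_profile_decay[OF W \<theta>] by metis
  obtain L where L: "L \<ge> 0"
    "\<And>a b. \<bar>a\<bar> \<le> 2 \<Longrightarrow> \<bar>b\<bar> \<le> 2 \<Longrightarrow> \<bar>deriv W a - deriv W b\<bar> \<le> L * \<bar>a - b\<bar>"
    using lipschitz_deriv_W by blast
  define \<Lambda> where "\<Lambda> = \<kappa>\<^sup>2 + \<kappa> + L / \<epsilon>0\<^sup>2"
  have \<Lambda>: "\<Lambda> \<ge> 0" using \<kappa> L by (simp add: \<Lambda>_def)
  define M where "M = 2 * exp (\<kappa> * (R + 2))"
  have M: "M > 0" by (simp add: M_def)
  define E where "E = (\<lambda>x :: real^'n. exp (- \<kappa> * japanese x))"
  have near: "2 \<le> M * E x" if "norm x \<le> R + 1" for x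
  proof -
    have "\<kappa> * japanese x \<le> \<kappa> * (R + 2)" using that japanese_bounds(2)[of x] \<kappa> by (intro mult_left_mono) auto
    then have "2 * 1 \<le> 2 * exp (\<kappa> * (R + 2) + - \<kappa> * japanese x)" by (intro mult_left_mono) auto
    then show ?thesis by (simp only: M_def E_def exp_add)
  qed
  show thesis
  proof (rule that[of "M * exp (\<Lambda> * T)" \<kappa>])
    show "M * exp (\<Lambda> * T) \<ge> 0" "\<kappa> > 0" using M \<kappa> by auto
    fix \<epsilon> u x t
    assume \<epsilon>: "\<epsilon>0 \<le> \<epsilon>" "\<epsilon> \<le> (1::real)" and u: "solution \<epsilon> u" and t: "t \<in> {0..T}" and x: "d x t \<le> 0"
    have \<epsilon>p: "\<epsilon> > 0" using \<epsilon> \<epsilon>0 by simp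
    define G where "G = (\<lambda>y t. M * exp (\<Lambda> * t) * E y)"
    \<comment> \<open>For d \<ge> 0 the last term lifts the barrier to at least 1, and for - 1 \<le>
      d < 0 the choice of \<open>M\<close> does. The supersolution property is thus checked only for
      d < - 1, where the last term vanishes.\<close>
    define V where "V = (\<lambda>y t. - 1 + G y t + 2 * max 0 (d y t + 1))"
    have G_ge: "M * E y \<le> G y s" if "s \<ge> 0" for y s
      using mult_right_mono[of 1 "exp (\<Lambda> * s)" "M * E y"] that \<Lambda> M by (simp add: G_def E_def mult_ac)
    have G0: "G y s \<ge> 0" for y s using M by (simp add: G_def E_def)
    have V1: "1 \<le> V y s" if "s \<in> {0..T}" "d y s \<ge> - 1" for y s
    proof (cases "d y s \<ge> 0")
      case True
      then show ?thesis using G0[of y s] by (simp add: V_def)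
    next
      case False
      then have "norm y \<le> R + 1" using d_far[OF that(1), of y] that(2) by auto
      then show ?thesis using near[of y] G_ge[of s y] that by (simp add: V_def)
    qed
    have "u x t \<le> V x t"
    proof (rule comparison[OF \<epsilon>p u _ _ _ _ t])
      show "- 1 \<le> V y s" for y s using G0[of y s] by (simp add: V_def)
      have "continuous_on (UNIV \<times> {0..T}) (\<lambda>z. d (fst z) (snd z))"
        using d_cont by (simp add: case_prod_unfold)
      then have "continuous_on (UNIV \<times> {0..T}) (\<lambda>z. V (fst z) (snd z))"
        unfolding V_def G_def E_def by (intro continuous_intros)
      then show "continuous_on (UNIV \<times> {0..T}) (\<lambda>(x, t). V x t)" by (simp add: case_prod_unfold)
      show "\<theta> (d y 0 / \<epsilon>) \<le> V y 0" for y
      proof (cases "d y 0 \<ge> - 1")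
        case True
        then show ?thesis using V1[of 0 y] th(2)[of "d y 0 / \<epsilon>"] T by (simp add: abs_less_iff)
      next
        case False
        have "norm y - R \<le> - d y 0" using d_far[of 0 y] T False by simp
        then have "d y 0 \<le> R + 2 - japanese y" using japanese_bounds(2)[of y] by linarith
        moreover have "d y 0 / \<epsilon> \<le> d y 0" using False \<epsilon> \<epsilon>p by (simp add: divide_le_eq mult_le_cancel_left1)
        ultimately have "\<kappa> * (d y 0 / \<epsilon>) \<le> \<kappa> * (R + 2 - japanese y)" using \<kappa> by (intro mult_left_mono) auto
        then have "\<theta> (d y 0 / \<epsilon>) + 1 \<le> 2 * exp (\<kappa> * (R + 2) + - \<kappa> * japanese y)"
          using \<kappa>(3)[of "d y 0 / \<epsilon>"] by (smt (verit) exp_le_cancel_iff right_diff_distrib mult_minus_left)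
        moreover have "max 0 (d y 0 + 1) = 0" using False by simp
        ultimately show ?thesis by (simp add: V_def G_def E_def M_def exp_add[symmetric] mult.assoc)
      qed
      show "supersolution_at (deriv W) \<epsilon> T V y s" if s: "0 < s" "s \<le> T" and Vlt: "V y s < 1" for y s
      proof -
        have sT: "s \<in> {0..T}" using s by simp
        have dy: "d y s < - 1" using V1[OF sT, of y] Vlt by linarith
        have Veq: "V z \<tau> = - 1 + G z \<tau>" if "d z \<tau> < - 1" for z \<tau> using that by (simp add: V_def)
        have G2: "G y s \<le> 2" "G y s \<ge> 0" using Vlt Veq[OF dy] G0 by auto
        obtain g A where A: "second_order_at E y g A" "optrace A \<le> (\<kappa>\<^sup>2 + \<kappa>) * E y"
          using second_order_at_exp_japanese[of \<kappa> y] \<kappa> by (auto simp: E_def)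
        define m where "m = M * exp (\<Lambda> * s)"
        have so: "second_order_at (\<lambda>z. - 1 + m * E z) y (0 + m *\<^sub>R g) (\<lambda>h. 0 + m *\<^sub>R A h)"
          by (intro second_order_at_add second_order_at_const second_order_at_cmult A(1))
        have tr: "optrace (\<lambda>h. 0 + m *\<^sub>R A h) \<le> (\<kappa>\<^sup>2 + \<kappa>) * G y s"
          using mult_left_mono[OF A(2), of m] M by (simp add: optrace_scaleR m_def G_def mult_ac)
        have "\<bar>deriv W (- 1 + G y s) - deriv W (- 1)\<bar> \<le> L * \<bar>- 1 + G y s - (- 1)\<bar>"
          using G2 by (intro L(2)) auto
        then have "- (L * G y s) \<le> deriv W (- 1 + G y s)"
          using double_well_deriv_one[OF W] G2 by (simp add: abs_le_iff)
        then have r1: "- (L * G y s) / \<epsilon>\<^sup>2 \<le> deriv W (- 1 + G y s) / \<epsilon>\<^sup>2" by (intro divide_right_mono) auto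
        have r2: "L * G y s / \<epsilon>\<^sup>2 \<le> L * G y s / \<epsilon>0\<^sup>2"
          using \<epsilon> \<epsilon>0 G2 L by (intro divide_left_mono power_mono mult_nonneg_nonneg) auto
        have res: "\<Lambda> * G y s - optrace (\<lambda>h. 0 + m *\<^sub>R A h) + deriv W (V y s) / \<epsilon>\<^sup>2 \<ge> 0"
        proof -
          have "\<Lambda> * G y s = (\<kappa>\<^sup>2 + \<kappa>) * G y s + L * G y s / \<epsilon>0\<^sup>2" by (simp add: \<Lambda>_def distrib_right)
          moreover have "- (L * G y s) / \<epsilon>\<^sup>2 = - (L * G y s / \<epsilon>\<^sup>2)" by simp
          ultimately show ?thesis using tr r1 r2 unfolding Veq[OF dy] by linarith
        qed
        have time: "((\<lambda>\<tau>. - 1 + G y \<tau>) has_real_derivative \<Lambda> * G y s) (at s within {0..T})"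
          unfolding G_def by (auto intro!: derivative_eq_intros)
        have ev: "\<forall>\<^sub>F z in nhds y. V z s \<le> - 1 + m * E z"
          using d_less_nearby(1)[OF sT dy] by eventually_elim (simp add: Veq G_def m_def)
        have ev': "\<forall>\<^sub>F \<tau> in at s within {0..T}. V y \<tau> \<le> - 1 + G y \<tau>"
          using d_less_nearby(2)[OF sT dy] by eventually_elim (simp add: Veq)
        show ?thesis
          by (rule supersolution_atI[where V = V and f = "deriv W", OF so time _ _ ev ev' res]) (simp_all add: Veq[OF dy] G_def m_def)
      qed
    qed
    moreover have "V x t + 1 \<le> M * exp (\<Lambda> * T) * E x" if "d x t < - 1"
    proof -
      have "exp (\<Lambda> * t) \<le> exp (\<Lambda> * T)" using t \<Lambda> by (simp add: mult_left_mono)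
      then have "M * exp (\<Lambda> * t) * E x \<le> M * exp (\<Lambda> * T) * E x"
        using M by (intro mult_right_mono mult_left_mono) (auto simp: E_def)
      then show ?thesis using that by (simp add: V_def G_def)
    qed
    moreover have "2 \<le> M * exp (\<Lambda> * T) * E x" if "d x t \<ge> - 1"
    proof -
      have "norm x \<le> R + 1" using d_far[OF t, of x] that x by auto
      then have "2 \<le> M * E x" by (rule near)
      also have "\<dots> \<le> G x T" using T by (intro G_ge) auto
      finally show ?thesis by (simp add: G_def)
    qed
    moreover have "u x t \<le> 1" using u t by (auto simp: solution_def abs_le_iff)
    ultimately have "u x t + 1 \<le> M * exp (\<Lambda> * T) * E x" by (cases "d x t < - 1") auto
    then show "u x t + 1 \<le> M * exp (\<Lambda> * T) * exp (- \<kappa> * japanese x)" by (simp only: E_def)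
  qed
qed

end

section \<open>Integration of the barriers\<close>

text \<open>With k the integer part of h, exp (- h) is at most exp (- k) on the sublevel set h \<le>
  k + 1. Sublevel sets instead of shells avoid subtracting measures.\<close>

lemma nn_integral_exp_layers:
  fixes h :: "'a::euclidean_space \<Rightarrow> real"
  assumes h[measurable]: "h \<in> borel_measurable borel" and S[measurable]: "S \<in> sets borel"
    and pos: "\<And>x. x \<in> S \<Longrightarrow> h x \<ge> 0"
    and vol: "\<And>k. emeasure lborel {x \<in> S. h x \<le> real k + 1} \<le> ennreal (v k)"
    and v: "\<And>k. v k \<ge> 0" and summable: "summable (\<lambda>k. exp (- real k) * v k)"
  shows "(\<integral>\<^sup>+ x. ennreal (if x \<in> S then exp (- h x) else 0) \<partial>lborel) \<le> ennreal (\<Sum>k. exp (- real k) * v k)"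
proof -
  define f where "f = (\<lambda>k x. ennreal (exp (- real k)) * indicator {x \<in> S. h x \<le> real k + 1} x)"
  have meas[measurable]: "{x \<in> S. h x \<le> real k + 1} \<in> sets borel" for k
  proof -
    have "{x \<in> S. h x \<le> real k + 1} = S \<inter> {x \<in> space borel. h x \<le> real k + 1}" by auto
    also have "\<dots> \<in> sets borel" by measurable
    finally show ?thesis .
  qed
  have f[measurable]: "f k \<in> borel_measurable lborel" for k unfolding f_def by measurable
  have "ennreal (if x \<in> S then exp (- h x) else 0) \<le> (\<Sum>k. f k x)" for x
  proof (cases "x \<in> S")
    case True
    define k where "k = nat \<lfloor>h x\<rfloor>"
    have k: "real k \<le> h x" "h x \<le> real k + 1" using pos[OF True] unfolding k_def by linarith+
    have "ennreal (exp (- h x)) \<le> f k x" using k True by (simp add: f_def ennreal_leI)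
    also have "\<dots> \<le> (\<Sum>k. f k x)" using sum_le_suminf[OF summableI, of "{k}" "\<lambda>k. f k x"] by simp
    finally show ?thesis using True by simp
  qed auto
  then have "(\<integral>\<^sup>+ x. ennreal (if x \<in> S then exp (- h x) else 0) \<partial>lborel) \<le> (\<integral>\<^sup>+ x. (\<Sum>k. f k x) \<partial>lborel)"
    by (intro nn_integral_mono)
  also have "\<dots> = (\<Sum>k. \<integral>\<^sup>+ x. f k x \<partial>lborel)" by (intro nn_integral_suminf f)
  also have "\<dots> = (\<Sum>k. ennreal (exp (- real k)) * emeasure lborel {x \<in> S. h x \<le> real k + 1})"
    unfolding f_def by (subst nn_integral_cmult_indicator) auto
  also have "\<dots> \<le> (\<Sum>k. ennreal (exp (- real k) * v k))"
    using vol v by (intro suminf_le summableI) (auto simp: ennreal_mult intro!: mult_left_mono)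
  also have "\<dots> = ennreal (\<Sum>k. exp (- real k) * v k)"
    using v summable by (intro suminf_ennreal2) auto
  finally show ?thesis .
qed

text \<open>Half of the exponential is spent on the power, through y \<le> exp y with y = (k + 1) /
  (2 m); a geometric series remains.\<close>

lemma summable_exp_polynomial:
  assumes "m \<ge> 1" shows "summable (\<lambda>k. exp (- real k) * (real k + 1) ^ m)"
proof (rule summable_comparison_test')
  let ?C = "(2 * real m) ^ m * exp (1 / 2)"
  show "summable (\<lambda>k. ?C * exp (- 1 / 2) ^ k)"
    by (intro summable_mult summable_geometric) auto
  show "norm (exp (- real k) * (real k + 1) ^ m) \<le> ?C * exp (- 1 / 2) ^ k" if "k \<ge> 0" for k
  proof -
    define y where "y = (real k + 1) / (2 * real m)"
    have y: "0 \<le> y" "real k + 1 = 2 * real m * y" "real m * y = (real k + 1) / 2"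
      using assms by (auto simp: y_def)
    have "y \<le> exp y" using exp_ge_add_one_self[of y] by linarith
    then have "y ^ m \<le> exp y ^ m" using y(1) by (intro power_mono) auto
    also have "\<dots> = exp ((real k + 1) / 2)" using y(3) by (simp add: exp_of_nat_mult[symmetric])
    finally have "(real k + 1) ^ m \<le> (2 * real m) ^ m * exp ((real k + 1) / 2)"
      unfolding y(2) power_mult_distrib by (intro mult_left_mono) (auto simp: y(3))
    then have "exp (- real k) * (real k + 1) ^ m \<le> exp (- real k) * ((2 * real m) ^ m * exp ((real k + 1) / 2))"
      by (intro mult_left_mono) auto
    also have "\<dots> = (2 * real m) ^ m * exp (- real k + (real k + 1) / 2)" by (simp only: exp_add mult_ac)
    also have "- real k + (real k + 1) / 2 = 1 / 2 + real k * (- 1 / 2)" by (simp add: field_simps)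
    also have "exp (1 / 2 + real k * (- 1 / 2)) = exp (1 / 2) * exp (- 1 / 2) ^ k"
      by (simp only: exp_add exp_of_nat_mult)
    finally show ?thesis by (simp add: mult.assoc)
  qed
qed

lemma nn_integral_exp_japanese:
  assumes \<kappa>: "\<kappa> > 0"
  obtains J where "J \<ge> 0" "(\<integral>\<^sup>+ x. ennreal (exp (- \<kappa> * japanese (x :: real^'n))) \<partial>lborel) \<le> ennreal J"
proof -
  define v where "v = (\<lambda>k. unit_ball_vol (real CARD('n)) * ((real k + 1) / \<kappa>) ^ CARD('n))"
  have v: "v k \<ge> 0" for k using \<kappa> by (simp add: v_def)
  have sum: "summable (\<lambda>k. exp (- real k) * v k)"
  proof -
    have "summable (\<lambda>k. (unit_ball_vol (real CARD('n)) / \<kappa> ^ CARD('n)) * (exp (- real k) * (real k + 1) ^ CARD('n)))"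
      by (intro summable_mult summable_exp_polynomial) (simp add: Suc_le_eq)
    then show ?thesis by (simp add: v_def power_divide mult_ac)
  qed
  have jm: "japanese \<in> borel_measurable borel"
    by (intro borel_measurable_continuous_onI continuous_on_japanese continuous_on_id)
  have "(\<integral>\<^sup>+ x. ennreal (if x \<in> UNIV then exp (- (\<kappa> * japanese (x :: real^'n))) else 0) \<partial>lborel)
      \<le> ennreal (\<Sum>k. exp (- real k) * v k)"
  proof (rule nn_integral_exp_layers[OF _ _ _ _ v sum])
    show "(\<lambda>x. \<kappa> * japanese (x :: real^'n)) \<in> borel_measurable borel" using jm by measurable
    show "0 \<le> \<kappa> * japanese x" for x :: "real^'n"
      using \<kappa> japanese_bounds(3)[of x] by (intro mult_nonneg_nonneg) auto
    show "emeasure lborel {x \<in> UNIV. \<kappa> * japanese (x :: real^'n) \<le> real k + 1} \<le> ennreal (v k)" for k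
    proof -
      have "{x \<in> UNIV. \<kappa> * japanese (x :: real^'n) \<le> real k + 1} \<subseteq> cball 0 ((real k + 1) / \<kappa>)"
      proof
        fix x :: "real^'n" assume "x \<in> {x \<in> UNIV. \<kappa> * japanese x \<le> real k + 1}"
        then have "japanese x \<le> (real k + 1) / \<kappa>" using \<kappa> by (simp add: pos_le_divide_eq mult.commute)
        then show "x \<in> cball 0 ((real k + 1) / \<kappa>)" using japanese_bounds(1)[of x] by simp
      qed
      then have "emeasure lborel {x \<in> UNIV. \<kappa> * japanese (x :: real^'n) \<le> real k + 1}
          \<le> emeasure lborel (cball (0 :: real^'n) ((real k + 1) / \<kappa>))"
        by (intro emeasure_mono) auto
      also have "\<dots> = ennreal (v k)" using \<kappa> by (subst emeasure_cball) (auto simp: v_def)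
      finally show ?thesis .
    qed
  qed auto
  moreover have "(\<Sum>k. exp (- real k) * v k) \<ge> 0" using v sum by (intro suminf_nonneg) auto
  ultimately show thesis using that by simp
qed

context tube
begin

text \<open>The layer \<kappa> |d| / \<epsilon> \<le> k + 1 has volume at most K (k + 1) \<epsilon>
  / \<kappa>. This is the origin of the rate \<epsilon>.\<close>

lemma tube_integral:
  assumes \<kappa>: "\<kappa> > 0"
  obtains J where "J \<ge> 0"
    "\<And>\<epsilon> t. 0 < \<epsilon> \<Longrightarrow> t \<in> {0..T} \<Longrightarrow>
      (\<integral>\<^sup>+ x. ennreal (if x \<in> {x. \<bar>d x t\<bar> \<le> \<delta> / 2} then exp (- (\<kappa> * \<bar>d x t\<bar> / \<epsilon>)) else 0) \<partial>lborel) \<le> ennreal (J * \<epsilon>)"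
proof -
  define J where "J = K / \<kappa> * (\<Sum>k. exp (- real k) * (real k + 1) ^ 1)"
  have sum: "summable (\<lambda>k. exp (- real k) * (real k + 1) ^ 1)" by (rule summable_exp_polynomial) simp
  show thesis
  proof (rule that[of J])
    show "J \<ge> 0" unfolding J_def using K \<kappa> sum by (intro mult_nonneg_nonneg suminf_nonneg) auto
    fix \<epsilon> t assume \<epsilon>: "(0::real) < \<epsilon>" and t: "t \<in> {0..T}"
    note dc = d_cont_space[OF t]
    have dm[measurable]: "(\<lambda>x. d x t) \<in> borel_measurable borel" by (rule borel_measurable_continuous_onI[OF dc])
    define v where "v = (\<lambda>k::nat. K * ((real k + 1) * \<epsilon> / \<kappa>))"
    have eq: "(\<lambda>k. exp (- real k) * v k) = (\<lambda>k. (K / \<kappa> * \<epsilon>) * (exp (- real k) * (real k + 1) ^ 1))"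
      by (simp add: v_def fun_eq_iff)
    have "(\<integral>\<^sup>+ x. ennreal (if x \<in> {x. \<bar>d x t\<bar> \<le> \<delta> / 2} then exp (- (\<kappa> * \<bar>d x t\<bar> / \<epsilon>)) else 0) \<partial>lborel)
        \<le> ennreal (\<Sum>k. exp (- real k) * v k)"
    proof (rule nn_integral_exp_layers)
      show "(\<lambda>x. \<kappa> * \<bar>d x t\<bar> / \<epsilon>) \<in> borel_measurable borel" by measurable
      show "{x. \<bar>d x t\<bar> \<le> \<delta> / 2} \<in> sets borel"
        by (intro borel_closed closed_Collect_le continuous_intros dc)
      show "0 \<le> \<kappa> * \<bar>d x t\<bar> / \<epsilon>" for x using \<kappa> \<epsilon> by simp
      show "0 \<le> v k" for k using K \<kappa> \<epsilon> by (simp add: v_def)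
      show "summable (\<lambda>k. exp (- real k) * v k)" unfolding eq by (rule summable_mult[OF sum])
      show "emeasure lborel {x \<in> {x. \<bar>d x t\<bar> \<le> \<delta> / 2}. \<kappa> * \<bar>d x t\<bar> / \<epsilon> \<le> real k + 1} \<le> ennreal (v k)" for k
      proof -
        \<comment> \<open>Truncated at \<delta>/2 because the volume bound holds below \<delta>
          only; the integrand vanishes beyond.\<close>
        define s where "s = min (\<delta> / 2) ((real k + 1) * \<epsilon> / \<kappa>)"
        have s: "0 < s" "s < \<delta>" "s \<le> (real k + 1) * \<epsilon> / \<kappa>" using \<delta> \<epsilon> \<kappa> by (auto simp: s_def)
        have "{x \<in> {x. \<bar>d x t\<bar> \<le> \<delta> / 2}. \<kappa> * \<bar>d x t\<bar> / \<epsilon> \<le> real k + 1} = {x. \<bar>d x t\<bar> \<le> s}"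
          using \<kappa> \<epsilon> by (auto simp: s_def pos_divide_le_eq pos_le_divide_eq mult_ac)
        then have "emeasure lborel {x \<in> {x. \<bar>d x t\<bar> \<le> \<delta> / 2}. \<kappa> * \<bar>d x t\<bar> / \<epsilon> \<le> real k + 1} \<le> ennreal (K * s)"
          using d_vol[OF t s(1,2)] by simp
        also have "\<dots> \<le> ennreal (v k)" unfolding v_def using s(3) K by (intro ennreal_leI mult_left_mono) auto
        finally show ?thesis .
      qed
    qed
    also have "(\<Sum>k. exp (- real k) * v k) = J * \<epsilon>"
      unfolding eq suminf_mult[OF sum] J_def by simp
    finally show "(\<integral>\<^sup>+ x. ennreal (if x \<in> {x. \<bar>d x t\<bar> \<le> \<delta> / 2} then exp (- (\<kappa> * \<bar>d x t\<bar> / \<epsilon>)) else 0) \<partial>lborel) \<le> ennreal (J * \<epsilon>)" .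
  qed
qed

lemma cutoff_le: "cutoff x \<le> exp (R + \<delta> + 1) * exp (- 1 * japanese x)"
  using cutoff_bounds(3)[of x] by (simp add: exp_diff exp_minus divide_inverse)

text \<open>For small \<epsilon> the background \<epsilon>^2 is relaxed to \<epsilon> times an
  integrable exponential; for \<epsilon> > \<epsilon>0 the fixed bound C2 J2 is at most (C2 J2 /
  \<epsilon>0) \<epsilon>.\<close>

lemma half_error_integral:
  obtains C where "C \<ge> 0"
    "\<And>\<epsilon> u t. 0 < \<epsilon> \<Longrightarrow> \<epsilon> \<le> 1 \<Longrightarrow> solution \<epsilon> u \<Longrightarrow> t \<in> {0..T} \<Longrightarrow>
      (\<integral>\<^sup>+ x. ennreal (if d x t \<le> 0 then u x t + 1 else 0) \<partial>lborel) \<le> ennreal (C * \<epsilon>)"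
proof -
  obtain \<epsilon>0 C1 \<kappa>1 where 1: "\<epsilon>0 > 0" "C1 \<ge> 0" "\<kappa>1 > 0"
    "\<And>\<epsilon> u x t. 0 < \<epsilon> \<Longrightarrow> \<epsilon> \<le> \<epsilon>0 \<Longrightarrow> \<epsilon> \<le> 1 \<Longrightarrow> solution \<epsilon> u \<Longrightarrow> t \<in> {0..T} \<Longrightarrow> d x t \<le> 0 \<Longrightarrow>
       u x t + 1 \<le> C1 * (\<epsilon>\<^sup>2 * cutoff x + (if \<bar>d x t\<bar> \<le> \<delta> / 2 then exp (- (\<kappa>1 * \<bar>d x t\<bar> / \<epsilon>)) else 0))"
    using upper_bound_small by blast
  obtain C2 \<kappa>2 where 2: "C2 \<ge> 0" "\<kappa>2 > 0"
    "\<And>\<epsilon> u x t. \<epsilon>0 \<le> \<epsilon> \<Longrightarrow> \<epsilon> \<le> 1 \<Longrightarrow> solution \<epsilon> u \<Longrightarrow> t \<in> {0..T} \<Longrightarrow> d x t \<le> 0 \<Longrightarrow>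
       u x t + 1 \<le> C2 * exp (- \<kappa>2 * japanese x)"
    using upper_bound_large[OF 1(1)] by blast
  obtain J where J: "J \<ge> 0"
    "\<And>\<epsilon> t. 0 < \<epsilon> \<Longrightarrow> t \<in> {0..T} \<Longrightarrow>
      (\<integral>\<^sup>+ x. ennreal (if x \<in> {x. \<bar>d x t\<bar> \<le> \<delta> / 2} then exp (- (\<kappa>1 * \<bar>d x t\<bar> / \<epsilon>)) else 0) \<partial>lborel) \<le> ennreal (J * \<epsilon>)"
    using tube_integral[OF 1(3)] by blast
  obtain J1 where J1: "J1 \<ge> 0" "(\<integral>\<^sup>+ x. ennreal (exp (- 1 * japanese (x :: real^'n))) \<partial>lborel) \<le> ennreal J1"
    using nn_integral_exp_japanese[of 1] by auto
  obtain J2 where J2: "J2 \<ge> 0" "(\<integral>\<^sup>+ x. ennreal (exp (- \<kappa>2 * japanese (x :: real^'n))) \<partial>lborel) \<le> ennreal J2"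
    using nn_integral_exp_japanese[OF 2(2)] by blast
  have jm[measurable]: "(japanese :: real^'n \<Rightarrow> real) \<in> borel_measurable borel"
    by (intro borel_measurable_continuous_onI continuous_on_japanese continuous_on_id)
  define E where "E = exp (R + \<delta> + 1)"
  define C where "C = C1 * (E * J1 + J) + C2 * J2 / \<epsilon>0"
  have Cn: "C1 * (E * J1 + J) \<ge> 0" "C2 * J2 / \<epsilon>0 \<ge> 0" using 1 2 J J1 J2 by (auto simp: E_def)
  show thesis
  proof (rule that[of C])
    show "C \<ge> 0" using Cn by (simp add: C_def)
    fix \<epsilon> u t assume \<epsilon>: "(0::real) < \<epsilon>" "\<epsilon> \<le> 1" and u: "solution \<epsilon> u" and t: "t \<in> {0..T}"
    have dm[measurable]: "(\<lambda>x. d x t) \<in> borel_measurable borel"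
      by (rule borel_measurable_continuous_onI[OF d_cont_space[OF t]])
    show "(\<integral>\<^sup>+ x. ennreal (if d x t \<le> 0 then u x t + 1 else 0) \<partial>lborel) \<le> ennreal (C * \<epsilon>)"
    proof (cases "\<epsilon> \<le> \<epsilon>0")
      case True
      define g1 where "g1 = (\<lambda>x. exp (- 1 * japanese (x :: real^'n)))"
      define g2 where "g2 = (\<lambda>x. if x \<in> {x. \<bar>d x t\<bar> \<le> \<delta> / 2} then exp (- (\<kappa>1 * \<bar>d x t\<bar> / \<epsilon>)) else 0)"
      have [measurable]: "g1 \<in> borel_measurable lborel" "g2 \<in> borel_measurable lborel"
        unfolding g1_def g2_def by measurable
      have nn: "g1 x \<ge> 0" "g2 x \<ge> 0" for x by (auto simp: g1_def g2_def)
      have "\<epsilon>\<^sup>2 \<le> \<epsilon>" using \<epsilon> by (simp add: power2_eq_square mult_left_le)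
      have pt: "(if d x t \<le> 0 then u x t + 1 else 0) \<le> (C1 * \<epsilon> * E) * g1 x + C1 * g2 x" for x
      proof (cases "d x t \<le> 0")
        case neg: True
        have "\<epsilon>\<^sup>2 * cutoff x \<le> \<epsilon> * (E * g1 x)"
          using \<open>\<epsilon>\<^sup>2 \<le> \<epsilon>\<close> cutoff_le[of x] cutoff_bounds(1)[of x] \<epsilon> by (intro mult_mono) (auto simp: E_def g1_def)
        then have "C1 * (\<epsilon>\<^sup>2 * cutoff x + g2 x) \<le> C1 * (\<epsilon> * (E * g1 x) + g2 x)"
          using 1(2) by (intro mult_left_mono) auto
        moreover have "u x t + 1 \<le> C1 * (\<epsilon>\<^sup>2 * cutoff x + g2 x)"
          using 1(4)[OF \<epsilon>(1) True \<epsilon>(2) u t neg] by (simp add: g2_def)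
        ultimately show ?thesis using neg by (simp add: algebra_simps)
      next
        case False
        then show ?thesis using 1(2) \<epsilon> nn[of x] by (auto simp: E_def intro!: add_nonneg_nonneg mult_nonneg_nonneg)
      qed
      have "(\<integral>\<^sup>+ x. ennreal (if d x t \<le> 0 then u x t + 1 else 0) \<partial>lborel)
          \<le> (\<integral>\<^sup>+ x. ennreal (C1 * \<epsilon> * E) * ennreal (g1 x) + ennreal C1 * ennreal (g2 x) \<partial>lborel)"
      proof (rule nn_integral_mono)
        fix x
        have c: "0 \<le> C1 * \<epsilon> * E" using 1(2) \<epsilon> by (simp add: E_def)
        have "ennreal (if d x t \<le> 0 then u x t + 1 else 0) \<le> ennreal ((C1 * \<epsilon> * E) * g1 x + C1 * g2 x)"
          by (rule ennreal_leI[OF pt])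
        also have "\<dots> = ennreal ((C1 * \<epsilon> * E) * g1 x) + ennreal (C1 * g2 x)"
          by (rule ennreal_plus) (use c 1(2) nn in \<open>auto intro: mult_nonneg_nonneg\<close>)
        also have "\<dots> = ennreal (C1 * \<epsilon> * E) * ennreal (g1 x) + ennreal C1 * ennreal (g2 x)"
          by (simp only: ennreal_mult[OF c nn(1)] ennreal_mult[OF 1(2) nn(2)])
        finally show "ennreal (if d x t \<le> 0 then u x t + 1 else 0)
            \<le> ennreal (C1 * \<epsilon> * E) * ennreal (g1 x) + ennreal C1 * ennreal (g2 x)" .
      qed
      also have "\<dots> = ennreal (C1 * \<epsilon> * E) * (\<integral>\<^sup>+ x. ennreal (g1 x) \<partial>lborel) + ennreal C1 * (\<integral>\<^sup>+ x. ennreal (g2 x) \<partial>lborel)"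
        by (subst nn_integral_add) (auto simp: nn_integral_cmult)
      also have "\<dots> \<le> ennreal (C1 * \<epsilon> * E) * ennreal J1 + ennreal C1 * ennreal (J * \<epsilon>)"
        unfolding g1_def g2_def by (intro add_mono mult_left_mono J1(2) J(2) \<epsilon> t) auto
      also have "\<dots> = ennreal (C1 * (E * J1 + J) * \<epsilon>)"
        using 1(2) \<epsilon> J(1) J1(1)
        by (simp add: ennreal_mult[symmetric] ennreal_plus[symmetric] E_def algebra_simps del: ennreal_plus)
      also have "\<dots> \<le> ennreal (C * \<epsilon>)"
        using Cn \<epsilon> by (intro ennreal_leI mult_right_mono) (auto simp: C_def)
      finally show ?thesis .
    next
      case False
      have pt: "(if d x t \<le> 0 then u x t + 1 else 0) \<le> C2 * exp (- \<kappa>2 * japanese x)" for x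
        using 2(3)[of \<epsilon> u t x] False \<epsilon> u t 2(1) by auto
      have "(\<integral>\<^sup>+ x. ennreal (if d x t \<le> 0 then u x t + 1 else 0) \<partial>lborel)
          \<le> (\<integral>\<^sup>+ x. ennreal C2 * ennreal (exp (- \<kappa>2 * japanese (x :: real^'n))) \<partial>lborel)"
      proof (rule nn_integral_mono)
        show "ennreal (if d x t \<le> 0 then u x t + 1 else 0) \<le> ennreal C2 * ennreal (exp (- \<kappa>2 * japanese x))" for x
          using ennreal_leI[OF pt] by (simp only: ennreal_mult[OF 2(1) exp_ge_zero])
      qed
      also have "\<dots> = ennreal C2 * (\<integral>\<^sup>+ x. ennreal (exp (- \<kappa>2 * japanese (x :: real^'n))) \<partial>lborel)"
        by (rule nn_integral_cmult) measurable
      also have "\<dots> \<le> ennreal C2 * ennreal J2" by (rule mult_left_mono[OF J2(2)]) simp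
      also have "\<dots> = ennreal (C2 * J2)" using 2(1) J2(1) by (simp add: ennreal_mult)
      also have "\<dots> \<le> ennreal (C * \<epsilon>)"
      proof (rule ennreal_leI)
        have "C2 * J2 / \<epsilon>0 * \<epsilon>0 \<le> C * \<epsilon>"
          using Cn False 1(1) by (intro mult_mono) (auto simp: C_def)
        then show "C2 * J2 \<le> C * \<epsilon>" using 1(1) by simp
      qed
      finally show ?thesis .
    qed
  qed
qed

end

section \<open>From the stated notions to the hypotheses of the barrier argument\<close>

lemma gderiv_gradient:
  fixes f :: "real^'n \<Rightarrow> real"
  assumes "f differentiable (at x)"
  shows "GDERIV f x :> gradient f x"
proof -
  obtain D where D: "(f has_derivative D) (at x)" using assms by (auto simp: differentiable_def)
  have lin: "linear D" using D by (rule has_derivative_linear)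
  define g where "g = (\<Sum>b\<in>Basis. D b *\<^sub>R b)"
  have "D h = h \<bullet> g" for h
    using Linear_Algebra.linear_componentwise[OF lin, of h 1] by (simp add: g_def inner_sum_right mult.commute)
  then have "D = (\<lambda>h. h \<bullet> g)" by (rule ext)
  then have "GDERIV f x :> g" using D by (simp add: gderiv_def)
  then show ?thesis using gradient_eqI by metis
qed

text \<open>Differentiability gives the definite description in \<open>gradient\<close> its meaning,
  and the \<open>laplacian\<close> becomes the trace of the derivative of that field.\<close>

lemma allen_cahn_solution_classical:
  assumes "allen_cahn_solution W \<epsilon> T u0 u"
  shows "classical_allen_cahn (deriv W) \<epsilon> T u"
  unfolding classical_allen_cahn_def
proof (intro conjI allI ballI)
  show "bounded ((\<lambda>(x, t). u x t) ` (UNIV \<times> {0..T}))" "continuous_on (UNIV \<times> {0..T}) (\<lambda>(x, t). u x t)"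
    using assms by (simp_all add: allen_cahn_solution_def)
  fix x t assume t: "t \<in> {0<..T}"
  have "(\<lambda>x. u x t) differentiable_on UNIV" "gradient (\<lambda>x. u x t) differentiable_on UNIV"
    using assms t by (auto simp: allen_cahn_solution_def)
  then have du: "(\<lambda>x. u x t) differentiable (at y)" and dg: "gradient (\<lambda>x. u x t) differentiable (at y)" for y
    by (auto simp: differentiable_on_def)
  define A where "A = frechet_derivative (gradient (\<lambda>x. u x t)) (at x)"
  have A: "(gradient (\<lambda>x. u x t) has_derivative A) (at x)"
    using dg by (simp add: A_def frechet_derivative_works)
  have "second_order_at (\<lambda>y. u y t) x (gradient (\<lambda>x. u x t) x) A"
    unfolding second_order_at_def
    by (intro exI[of _ "gradient (\<lambda>x. u x t)"] conjI refl A) (simp add: gderiv_gradient[OF du])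
  moreover have "laplacian (\<lambda>y. u y t) x = optrace A"
    unfolding laplacian_def by (rule divergence_eqI[OF A])
  moreover have "((\<lambda>s. u x s) has_real_derivative laplacian (\<lambda>y. u y t) x - 1 / \<epsilon>\<^sup>2 * deriv W (u x t)) (at t within {0..T})"
    using assms t by (auto simp: allen_cahn_solution_def)
  ultimately show "\<exists>g A. second_order_at (\<lambda>y. u y t) x g A \<and>
      ((\<lambda>s. u x s) has_real_derivative optrace A - deriv W (u x t) / \<epsilon>\<^sup>2) (at t within {0..T})"
    by (intro exI[of _ "gradient (\<lambda>x. u x t) x"] exI[of _ A]) simp
qed

lemma classical_allen_cahn_uminus:
  assumes u: "classical_allen_cahn f \<epsilon> T u" and odd: "\<And>s. f (- s) = - f s"
  shows "classical_allen_cahn f \<epsilon> T (\<lambda>x t. - u x t)"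
  unfolding classical_allen_cahn_def
proof (intro conjI allI ballI)
  have "bounded ((\<lambda>(x, t). u x t) ` (UNIV \<times> {0..T}))" using u by (simp add: classical_allen_cahn_def)
  then show "bounded ((\<lambda>(x, t). - u x t) ` (UNIV \<times> {0..T}))"
    by (simp add: bounded_iff case_prod_unfold)
  have "continuous_on (UNIV \<times> {0..T}) (\<lambda>z. u (fst z) (snd z))"
    using u by (simp add: classical_allen_cahn_def case_prod_unfold)
  then show "continuous_on (UNIV \<times> {0..T}) (\<lambda>(x, t). - u x t)"
    unfolding case_prod_unfold by (rule continuous_on_minus)
  fix x t assume "t \<in> {0<..T}"
  then obtain g A where A: "second_order_at (\<lambda>y. u y t) x g A"
    "((\<lambda>s. u x s) has_real_derivative optrace A - f (u x t) / \<epsilon>\<^sup>2) (at t within {0..T})"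
    using u unfolding classical_allen_cahn_def by blast
  have "((\<lambda>s. - u x s) has_real_derivative optrace (\<lambda>h. (- 1) *\<^sub>R A h) - f (- u x t) / \<epsilon>\<^sup>2) (at t within {0..T})"
    by (rule DERIV_cong[OF DERIV_minus[OF A(2)]]) (use optrace_scaleR[of "- 1" A] in \<open>simp add: odd\<close>)
  moreover have "second_order_at (\<lambda>y. - u y t) x ((- 1) *\<^sub>R g) (\<lambda>h. (- 1) *\<^sub>R A h)"
    using second_order_at_cmult[OF A(1), of "- 1"] by simp
  ultimately show "\<exists>g A. second_order_at (\<lambda>y. - u y t) x g A \<and>
      ((\<lambda>s. - u x s) has_real_derivative optrace A - f (- u x t) / \<epsilon>\<^sup>2) (at t within {0..T})"
    by blast
qed

lemma tube_regular_at_uminus: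
  assumes "tube_regular_at T d K x t"
  shows "tube_regular_at T (\<lambda>x t. - d x t) K x t"
proof -
  obtain g A b where A: "second_order_at (\<lambda>y. d y t) x g A" "norm g = 1"
    "((\<lambda>s. d x s) has_real_derivative b) (at t within {0..T})" "\<bar>b - optrace A\<bar> \<le> K * \<bar>d x t\<bar>"
    using assms unfolding tube_regular_at_def by blast
  have "\<bar>- b - optrace (\<lambda>h. (- 1) *\<^sub>R A h)\<bar> \<le> K * \<bar>- d x t\<bar>"
    using A(4) by (simp only: optrace_scaleR) simp
  moreover have "second_order_at (\<lambda>y. - d y t) x ((- 1) *\<^sub>R g) (\<lambda>h. (- 1) *\<^sub>R A h)"
    using second_order_at_cmult[OF A(1), of "- 1"] by simp
  moreover have "norm ((- 1) *\<^sub>R g) = 1" using A(2) by simp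
  ultimately show ?thesis
    unfolding tube_regular_at_def using DERIV_minus[OF A(3)] by blast
qed

theorem theorem1:
  fixes T :: real
    and \<Omega> :: "real \<Rightarrow> (real^'n) set"
    and W \<theta> :: "real \<Rightarrow> real"
  assumes "0 < T"
    and "smooth_mean_curvature_flow T \<Omega>"
    and "standard_double_well W"
    and "equilibrium_profile W \<theta>"
  shows "\<exists>C\<ge>0. \<forall>\<epsilon>\<in>{0<..1}. \<forall>u.
           allen_cahn_solution W \<epsilon> T (\<lambda>x. \<theta> (signed_dist (\<Omega> 0) x / \<epsilon>)) u \<longrightarrow>
           (SUP t\<in>{0..T}. L1_norm (\<lambda>x. psi W u x t - phase \<Omega> x t)) \<le> ennreal (C * \<epsilon>)"
proof -
  note W = \<open>standard_double_well W\<close> and \<theta> = \<open>equilibrium_profile W \<theta>\<close>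
  note th = equilibrium_profile_bounds[OF W \<theta>]
  define d where "d = (\<lambda>x t. signed_dist (\<Omega> t) x)"
  obtain \<delta> K R where tube: "\<delta> > 0" "K \<ge> 0" "continuous_on (UNIV \<times> {0..T}) (\<lambda>(x, t). d x t)"
    "\<And>t x. t \<in> {0..T} \<Longrightarrow> norm x - R \<le> \<bar>d x t\<bar>"
    "\<And>t x. t \<in> {0..T} \<Longrightarrow> \<bar>d x t\<bar> < \<delta> \<Longrightarrow> tube_regular_at T d K x t"
    "\<And>t s. t \<in> {0..T} \<Longrightarrow> 0 < s \<Longrightarrow> s < \<delta> \<Longrightarrow> emeasure lborel {x. \<bar>d x t\<bar> \<le> s} \<le> ennreal (K * s)"
    unfolding d_def using mean_curvature_flow_tube[OF assms(1,2)] by metis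
  interpret outer: tube T \<delta> K R d W \<theta>
    by unfold_locales (use assms tube in auto)
  have "continuous_on (UNIV \<times> {0..T}) (\<lambda>z. d (fst z) (snd z))"
    using tube(3) by (simp add: case_prod_unfold)
  then have neg_cont: "continuous_on (UNIV \<times> {0..T}) (\<lambda>(x, t). - d x t)"
    unfolding case_prod_unfold by (rule continuous_on_minus)
  interpret inner: tube T \<delta> K R "\<lambda>x t. - d x t" W \<theta>
    by unfold_locales (use assms tube neg_cont in \<open>auto intro: tube_regular_at_uminus\<close>)
  obtain C1 where C1: "C1 \<ge> 0"
    "\<And>\<epsilon> u t. 0 < \<epsilon> \<Longrightarrow> \<epsilon> \<le> 1 \<Longrightarrow> outer.solution \<epsilon> u \<Longrightarrow> t \<in> {0..T} \<Longrightarrow>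
      (\<integral>\<^sup>+ x. ennreal (if d x t \<le> 0 then u x t + 1 else 0) \<partial>lborel) \<le> ennreal (C1 * \<epsilon>)"
    using outer.half_error_integral by blast
  obtain C2 where C2: "C2 \<ge> 0"
    "\<And>\<epsilon> u t. 0 < \<epsilon> \<Longrightarrow> \<epsilon> \<le> 1 \<Longrightarrow> inner.solution \<epsilon> u \<Longrightarrow> t \<in> {0..T} \<Longrightarrow>
      (\<integral>\<^sup>+ x. ennreal (if - d x t \<le> 0 then u x t + 1 else 0) \<partial>lborel) \<le> ennreal (C2 * \<epsilon>)"
    using inner.half_error_integral by blast
  obtain S where S: "S \<ge> 1"
    "\<And>v. \<bar>v\<bar> \<le> 1 \<Longrightarrow> \<bar>(LBINT s=0..ereal v. sqrt (2 * W s)) - 1\<bar> \<le> S * (1 - v)"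
    "\<And>v. \<bar>v\<bar> \<le> 1 \<Longrightarrow> \<bar>(LBINT s=0..ereal v. sqrt (2 * W s)) + 1\<bar> \<le> S * (1 + v)"
    using double_well_primitive[OF W] by metis
  define C where "C = S * (C1 + C2)"
  have "L1_norm (\<lambda>x. psi W u x t - phase \<Omega> x t) \<le> ennreal (C * \<epsilon>)"
    if \<epsilon>: "\<epsilon> \<in> {0<..1}" and u: "allen_cahn_solution W \<epsilon> T (\<lambda>x. \<theta> (signed_dist (\<Omega> 0) x / \<epsilon>)) u"
      and t: "t \<in> {0..T}" for \<epsilon> u t
  proof -
    have \<epsilon>0: "0 < \<epsilon>" "\<epsilon> \<le> 1" using \<epsilon> by auto
    have cl: "classical_allen_cahn (deriv W) \<epsilon> T u" by (rule allen_cahn_solution_classical[OF u])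
    have cl': "classical_allen_cahn (deriv W) \<epsilon> T (\<lambda>x t. - u x t)"
      by (rule classical_allen_cahn_uminus[OF cl double_well_deriv_odd[OF W]])
    have init: "u x 0 = \<theta> (d x 0 / \<epsilon>)" for x using u by (simp add: allen_cahn_solution_def d_def)
    have i1: "u x 0 \<le> 1" "- u x 0 \<le> 1" for x
      using th(2)[of "d x 0 / \<epsilon>"] unfolding init by (auto simp: abs_less_iff)
    \<comment> \<open>Comparison with the constant 1, once for u and once for - u.\<close>
    have bound: "\<bar>u x t\<bar> \<le> 1" if "t \<in> {0..T}" for x t
      using allen_cahn_upper_one[OF W \<epsilon>0(1) cl i1(1) that, of x] allen_cahn_upper_one[OF W \<epsilon>0(1) cl' i1(2) that, of x]
      by (simp add: abs_le_iff)
    have sol: "outer.solution \<epsilon> u" "inner.solution \<epsilon> (\<lambda>x t. - u x t)"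
      unfolding outer.solution_def inner.solution_def using cl cl' init bound th(3)[of "d _ 0 / \<epsilon>"] by auto
    define g1 where "g1 = (\<lambda>x. if d x t \<le> 0 then u x t + 1 else 0)"
    define g2 where "g2 = (\<lambda>x. if - d x t \<le> 0 then - u x t + 1 else 0)"
    have uc: "continuous_on UNIV (\<lambda>x. u x t)"
    proof -
      have "continuous_on (UNIV \<times> {0..T}) (\<lambda>(x, t). u x t)" using cl by (simp add: classical_allen_cahn_def)
      moreover have "continuous_on UNIV (\<lambda>x :: real^'n. (x, t))"
        by (intro continuous_on_Pair continuous_on_id continuous_on_const)
      moreover have "range (\<lambda>x :: real^'n. (x, t)) \<subseteq> UNIV \<times> {0..T}" using t by auto
      ultimately have "continuous_on UNIV (\<lambda>x. case (x, t) of (x, t) \<Rightarrow> u x t)"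
        by (rule continuous_on_compose2)
      then show ?thesis by simp
    qed
    have [measurable]: "(\<lambda>x. u x t) \<in> borel_measurable borel" "(\<lambda>x. d x t) \<in> borel_measurable borel"
      by (rule borel_measurable_continuous_onI[OF uc], rule borel_measurable_continuous_onI[OF outer.d_cont_space[OF t]])
    have [measurable]: "g1 \<in> borel_measurable lborel" "g2 \<in> borel_measurable lborel"
      unfolding g1_def g2_def by measurable
    have nn: "g1 x \<ge> 0" "g2 x \<ge> 0" for x
      using bound[OF t, of x] by (auto simp: g1_def g2_def abs_le_iff)
    have dom: "smoothly_evolving_domain T \<Omega>" using assms(2) by (simp add: smooth_mean_curvature_flow_def)
    have mem: "x \<in> \<Omega> t \<longleftrightarrow> d x t > 0" for x
      unfolding d_def using dom t by (intro open_pos_iff_mem) (auto simp: smoothly_evolving_domain_def)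
    \<comment> \<open>Membership in \<open>\<Omega> t\<close> means d > 0, so points of the
      interface have phase -1 and are covered by \<open>g1\<close>.\<close>
    have pt: "\<bar>psi W u x t - phase \<Omega> x t\<bar> \<le> S * g1 x + S * g2 x" for x
    proof (cases "d x t > 0")
      case True
      then have "\<bar>psi W u x t - phase \<Omega> x t\<bar> \<le> S * g2 x"
        using S(2)[OF bound[OF t, of x]] mem[of x] by (simp add: psi_def phase_def g2_def)
      then show ?thesis using nn(1)[of x] S(1) by (simp add: add_increasing)
    next
      case False
      then have "\<bar>psi W u x t - phase \<Omega> x t\<bar> \<le> S * g1 x"
        using S(3)[OF bound[OF t, of x]] mem[of x] by (simp add: psi_def phase_def g1_def add.commute)
      then show ?thesis using nn(2)[of x] S(1) by (simp add: add_increasing2)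
    qed
    have S0: "S \<ge> 0" using S(1) by simp
    have "L1_norm (\<lambda>x. psi W u x t - phase \<Omega> x t)
        \<le> (\<integral>\<^sup>+ x. ennreal S * ennreal (g1 x) + ennreal S * ennreal (g2 x) \<partial>lborel)"
      unfolding L1_norm_def
    proof (rule nn_integral_mono)
      fix x
      have "ennreal \<bar>psi W u x t - phase \<Omega> x t\<bar> \<le> ennreal (S * g1 x + S * g2 x)" by (rule ennreal_leI[OF pt])
      also have "\<dots> = ennreal (S * g1 x) + ennreal (S * g2 x)"
        by (rule ennreal_plus) (use S0 nn in auto)
      also have "\<dots> = ennreal S * ennreal (g1 x) + ennreal S * ennreal (g2 x)"
        by (simp only: ennreal_mult[OF S0 nn(1)] ennreal_mult[OF S0 nn(2)])
      finally show "ennreal \<bar>psi W u x t - phase \<Omega> x t\<bar> \<le> ennreal S * ennreal (g1 x) + ennreal S * ennreal (g2 x)" .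
    qed
    also have "\<dots> = ennreal S * (\<integral>\<^sup>+ x. ennreal (g1 x) \<partial>lborel) + ennreal S * (\<integral>\<^sup>+ x. ennreal (g2 x) \<partial>lborel)"
      by (subst nn_integral_add) (auto simp: nn_integral_cmult)
    also have "\<dots> \<le> ennreal S * ennreal (C1 * \<epsilon>) + ennreal S * ennreal (C2 * \<epsilon>)"
      unfolding g1_def g2_def
      by (intro add_mono mult_left_mono C1(2)[OF \<epsilon>0 sol(1) t] C2(2)[OF \<epsilon>0 sol(2) t]) auto
    also have "\<dots> = ennreal (C * \<epsilon>)"
      using S0 C1(1) C2(1) \<epsilon>0
      by (simp add: C_def ennreal_mult[symmetric] ennreal_plus[symmetric] algebra_simps del: ennreal_plus)
    finally show ?thesis .
  qed
  moreover have "C \<ge> 0" using S(1) C1(1) C2(1) by (simp add: C_def)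
  ultimately show ?thesis by (intro exI[of _ C] conjI ballI allI impI SUP_least) auto
qed

end
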